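(* Let $P$ be a finite poset, regarded as a category with a unique arrow $p\to q$ whenever $p\le q$. Let $K:P\to\mathcal{S}$ be a diagram of topological spaces and let $X:P\to\mathcal{P}_{<\infty}$ be a diagram of finite posets, where each $X_p$ is viewed as a finite topological space. Let $\phi:K\to X$ be a morphism of diagrams (a family of continuous maps $\phi_p:K_p\to X_p$ commuting with the transition maps) such that $\phi_p$ is a weak homotopy equivalence for every $p\in P$. Then there exists a weak homotopy equivalence $$\hat\phi:\operatorname{hocolim} K\to \operatorname{\underline{hocolim}} X.$$
   Context: $\mathcal{S}$ is the category of topological spaces and $\mathcal{P}_{<\infty}$ the category of finite posets and order-preserving maps. A finite poset is viewed as a finite topological space whose open sets are the down-sets; order-preserving maps are exactly the continuous maps. A weak homotopy equivalence is a continuous map inducing isomorphisms on all homotopy groups (for all base points). For a diagram $X$ write $X_p=X(p)$ and $g_{pq}=X(p\to q)$ for $p\le q$. The non-Hausdorff homotopy colimit $\operatorname{\underline{hocolim}} X$ is the finite poset (= finite space) with underlying set $\coprod_{p\in P}X_p$, keeping the order inside each $X_p$, and for $x\in X_p$, $y\in X_q$ with $p\le q$ setting $x\le y$ iff $g_{pq}(x)\le y$ in $X_q$ (the Grothendieck construction). $\operatorname{hocolim} K$ denotes the usual (Bousfield–Kan) homotopy colimit in $\mathcal{S}$, which can be constructed as $\coprod_{p\in P}K_p\times\mathcal{K}(F_p)$ modulo the relation identifying $(\alpha,\beta)\in K_p\times \mathcal{K}(F_p)$ with $(K(p\to p')(\alpha),\beta)\in K_{p'}\times\mathcal{K}(F_{p'})$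 when $\beta\in\mathcal{K}(F_{p'})$, $p\le p'$; here $F_p=\{r\in P: r\ge p\}$ and $\mathcal{K}(Q)$ is the order complex of a poset $Q$ (the simplicial complex of nonempty chains). *)

theory Defs
  imports "HOL-Analysis.Analysis"
begin

definition poset_top :: "'b set \<Rightarrow> ('b \<Rightarrow> 'b \<Rightarrow> bool) \<Rightarrow> 'b topology" where
  "poset_top S le = topology (\<lambda>U. U \<subseteq> S \<and> (\<forall>x\<in>U. \<forall>y\<in>S. le y x \<longrightarrow> y \<in> U))"

lemma istopology_poset_top:
  "istopology (\<lambda>U. U \<subseteq> S \<and> (\<forall>x\<in>U. \<forall>y\<in>S. le y x \<longrightarrow> y \<in> U))"
  unfolding istopology_def by blast

lemma openin_poset_top:
  "openin (poset_top S le) U \<longleftrightarrow> U \<subseteq> S \<and> (\<forall>x\<in>U. \<forall>y\<in>S. le y x \<longrightarrow> y \<in> U)"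
  unfolding poset_top_def by (simp add: topology_inverse'[OF istopology_poset_top])

definition quot_top :: "'a topology \<Rightarrow> ('a \<Rightarrow> 'c) \<Rightarrow> 'c topology" where
  "quot_top X q = topology (\<lambda>U. U \<subseteq> q ` topspace X \<and> openin X {x \<in> topspace X. q x \<in> U})"

lemma istopology_quot_top:
  "istopology (\<lambda>U. U \<subseteq> q ` topspace X \<and> openin X {x \<in> topspace X. q x \<in> U})"
proof -
  have i: "openin X {x \<in> topspace X. q x \<in> S \<and> q x \<in> T}"
    if "openin X {x \<in> topspace X. q x \<in> S}" "openin X {x \<in> topspace X. q x \<in> T}" for S T
  proof -
    have "{x \<in> topspace X. q x \<in> S \<and> q x \<in> T} = {x \<in> topspace X. q x \<in> S} \<inter> {x \<in> topspace X. q x \<in> T}"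
      by blast
    then show ?thesis using that by (simp add: openin_Int)
  qed
  have u: "openin X {x \<in> topspace X. \<exists>U\<in>K. q x \<in> U}"
    if "\<forall>U\<in>K. openin X {x \<in> topspace X. q x \<in> U}" for K
  proof -
    have "{x \<in> topspace X. \<exists>U\<in>K. q x \<in> U} = \<Union> ((\<lambda>U. {x \<in> topspace X. q x \<in> U}) ` K)"
      by blast
    then show ?thesis using that by (auto intro!: openin_Union)
  qed
  show ?thesis unfolding istopology_def using i u by auto
qed

lemma openin_quot_top:
  "openin (quot_top X q) U \<longleftrightarrow> U \<subseteq> q ` topspace X \<and> openin X {x \<in> topspace X. q x \<in> U}"
  unfolding quot_top_def by (simp add: topology_inverse'[OF istopology_quot_top])

definition sphere_base :: "nat \<Rightarrow> real" where
  "sphere_base = (\<lambda>i. if i = 0 then 1 else 0)"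

text \<open>The map induced on the pointed homotopy classes of maps from the n-sphere
  (i.e. on pi_n, including pointed pi_0) is a bijection, for every base point and every n;
  additionally every path component of Y is hit (pi_0 surjective also when X is empty).\<close>
definition weak_homotopy_equivalence :: "'a topology \<Rightarrow> 'b topology \<Rightarrow> ('a \<Rightarrow> 'b) \<Rightarrow> bool" where
  "weak_homotopy_equivalence X Y f \<longleftrightarrow>
     continuous_map X Y f \<and>
     (\<forall>y\<in>topspace Y. \<exists>x\<in>topspace X. path_component_of Y (f x) y) \<and>
     (\<forall>n. \<forall>x\<in>topspace X.
        (\<forall>g. continuous_map (nsphere n) Y g \<and> g sphere_base = f x \<longrightarrow>
           (\<exists>a. continuous_map (nsphere n) X a \<and> a sphere_base = x \<and>
                homotopic_with (\<lambda>h. h sphere_base = f x) (nsphere n) Y (f \<circ> a) g)) \<and>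
        (\<forall>a b. continuous_map (nsphere n) X a \<and> a sphere_base = x \<and>
               continuous_map (nsphere n) X b \<and> b sphere_base = x \<and>
               homotopic_with (\<lambda>h. h sphere_base = f x) (nsphere n) Y (f \<circ> a) (f \<circ> b) \<longrightarrow>
               homotopic_with (\<lambda>h. h sphere_base = x) (nsphere n) X a b))"

definition space_diagram :: "'p::order set \<Rightarrow> ('p \<Rightarrow> 'a topology) \<Rightarrow> ('p \<Rightarrow> 'p \<Rightarrow> 'a \<Rightarrow> 'a) \<Rightarrow> bool" where
  "space_diagram P Kt Km \<longleftrightarrow>
     (\<forall>p\<in>P. \<forall>q\<in>P. p \<le> q \<longrightarrow> continuous_map (Kt p) (Kt q) (Km p q)) \<and>
     (\<forall>p\<in>P. \<forall>x\<in>topspace (Kt p). Km p p x = x) \<and>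
     (\<forall>p\<in>P. \<forall>q\<in>P. \<forall>r\<in>P. p \<le> q \<longrightarrow> q \<le> r \<longrightarrow>
        (\<forall>x\<in>topspace (Kt p). Km q r (Km p q x) = Km p r x))"

definition finite_poset :: "'b set \<Rightarrow> ('b \<Rightarrow> 'b \<Rightarrow> bool) \<Rightarrow> bool" where
  "finite_poset S le \<longleftrightarrow> finite S \<and>
     (\<forall>x\<in>S. le x x) \<and>
     (\<forall>x\<in>S. \<forall>y\<in>S. le x y \<longrightarrow> le y x \<longrightarrow> x = y) \<and>
     (\<forall>x\<in>S. \<forall>y\<in>S. \<forall>z\<in>S. le x y \<longrightarrow> le y z \<longrightarrow> le x z)"

definition poset_diagram :: "'p::order set \<Rightarrow> ('p \<Rightarrow> 'b set) \<Rightarrow> ('p \<Rightarrow> 'b \<Rightarrow> 'b \<Rightarrow> bool)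
     \<Rightarrow> ('p \<Rightarrow> 'p \<Rightarrow> 'b \<Rightarrow> 'b) \<Rightarrow> bool" where
  "poset_diagram P Xs Xle g \<longleftrightarrow>
     (\<forall>p\<in>P. finite_poset (Xs p) (Xle p)) \<and>
     (\<forall>p\<in>P. \<forall>q\<in>P. p \<le> q \<longrightarrow> g p q ` Xs p \<subseteq> Xs q \<and>
        (\<forall>x\<in>Xs p. \<forall>y\<in>Xs p. Xle p x y \<longrightarrow> Xle q (g p q x) (g p q y))) \<and>
     (\<forall>p\<in>P. \<forall>x\<in>Xs p. g p p x = x) \<and>
     (\<forall>p\<in>P. \<forall>q\<in>P. \<forall>r\<in>P. p \<le> q \<longrightarrow> q \<le> r \<longrightarrow>
        (\<forall>x\<in>Xs p. g q r (g p q x) = g p r x))"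

section \<open>The non-Hausdorff homotopy colimit (Grothendieck construction)\<close>

definition nh_hocolim_le :: "'p::order set \<Rightarrow> ('p \<Rightarrow> 'b \<Rightarrow> 'b \<Rightarrow> bool) \<Rightarrow> ('p \<Rightarrow> 'p \<Rightarrow> 'b \<Rightarrow> 'b)
     \<Rightarrow> 'p \<times> 'b \<Rightarrow> 'p \<times> 'b \<Rightarrow> bool" where
  "nh_hocolim_le P Xle g = (\<lambda>(p, x) (q, y). p \<le> q \<and> Xle q (g p q x) y)"

definition nh_hocolim :: "'p::order set \<Rightarrow> ('p \<Rightarrow> 'b set) \<Rightarrow> ('p \<Rightarrow> 'b \<Rightarrow> 'b \<Rightarrow> bool)
     \<Rightarrow> ('p \<Rightarrow> 'p \<Rightarrow> 'b \<Rightarrow> 'b) \<Rightarrow> ('p \<times> 'b) topology" where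
  "nh_hocolim P Xs Xle g = poset_top (Sigma P Xs) (nh_hocolim_le P Xle g)"

definition upset :: "'p::order set \<Rightarrow> 'p \<Rightarrow> 'p set" where
  "upset P p = {r \<in> P. p \<le> r}"

text \<open>Geometric realisation of the order complex of a finite poset Q \<subseteq> P: barycentric
  coordinates supported on a (nonempty) chain of Q, as a subspace of R^P.\<close>
definition order_complex_points :: "'p::order set \<Rightarrow> ('p \<Rightarrow> real) set" where
  "order_complex_points Q = {t. (\<forall>q. 0 \<le> t q) \<and> (\<forall>q. q \<notin> Q \<longrightarrow> t q = 0) \<and>
      sum t Q = 1 \<and> (\<forall>q r. t q \<noteq> 0 \<longrightarrow> t r \<noteq> 0 \<longrightarrow> q \<le> r \<or> r \<le> q)}"

definition order_complex :: "'p::order set \<Rightarrow> ('p \<Rightarrow> real) topology" where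
  "order_complex Q = subtopology (powertop_real UNIV) (order_complex_points Q)"

definition hocolim_pre :: "'p::order set \<Rightarrow> ('p \<Rightarrow> 'a topology) \<Rightarrow> ('p \<times> ('a \<times> ('p \<Rightarrow> real))) topology" where
  "hocolim_pre P Kt = sum_topology (\<lambda>p. prod_topology (Kt p) (order_complex (upset P p))) P"

definition hocolim_rel :: "'p::order set \<Rightarrow> ('p \<Rightarrow> 'a topology) \<Rightarrow> ('p \<Rightarrow> 'p \<Rightarrow> 'a \<Rightarrow> 'a)
     \<Rightarrow> (('p \<times> ('a \<times> ('p \<Rightarrow> real))) \<times> ('p \<times> ('a \<times> ('p \<Rightarrow> real)))) set" where
  "hocolim_rel P Kt Km = {((p, \<alpha>, \<beta>), (p', Km p p' \<alpha>, \<beta>)) | p p' \<alpha> \<beta>.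
      p \<in> P \<and> p' \<in> P \<and> p \<le> p' \<and> \<alpha> \<in> topspace (Kt p) \<and> \<beta> \<in> order_complex_points (upset P p')}"

definition hocolim_equiv :: "'p::order set \<Rightarrow> ('p \<Rightarrow> 'a topology) \<Rightarrow> ('p \<Rightarrow> 'p \<Rightarrow> 'a \<Rightarrow> 'a)
     \<Rightarrow> (('p \<times> ('a \<times> ('p \<Rightarrow> real))) \<times> ('p \<times> ('a \<times> ('p \<Rightarrow> real)))) set" where
  "hocolim_equiv P Kt Km = (hocolim_rel P Kt Km \<union> (hocolim_rel P Kt Km)\<inverse>)\<^sup>*"

definition hocolim :: "'p::order set \<Rightarrow> ('p \<Rightarrow> 'a topology) \<Rightarrow> ('p \<Rightarrow> 'p \<Rightarrow> 'a \<Rightarrow> 'a)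
     \<Rightarrow> ('p \<times> ('a \<times> ('p \<Rightarrow> real))) set topology" where
  "hocolim P Kt Km = quot_top (hocolim_pre P Kt) (\<lambda>x. hocolim_equiv P Kt Km `` {x})"

end

theory Submission
  imports Defs
begin

text \<open>
  The map \<open>\<psi>\<close> sends the class of \<open>(p, \<alpha>, \<beta>)\<close> to \<open>(m, \<phi>\<^sub>m (K(p \<rightarrow> m) \<alpha>))\<close>, where \<open>m\<close> is the least
  element of the chain supporting \<open>\<beta>\<close>. For a down-set \<open>D\<close> of \<open>P\<close> let \<open>V\<^sub>D\<close> be the open set of the points
  of the Grothendieck construction lying over \<open>D\<close>. For a principal down-set of \<open>r\<close>, both \<open>V\<^sub>D\<close> and its
  preimage deformation retract, compatibly with \<open>\<psi>\<close>, onto \<open>X\<^sub>r\<close> and \<open>K\<^sub>r\<close>, and the induced map is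
  \<open>\<phi>\<^sub>r\<close>. An arbitrary \<open>D\<close> with a maximal element \<open>r\<close> is the union of \<open>D - {r}\<close> and the down-set of \<open>r\<close>,
  which meet in a smaller down-set, so induction on \<open>D\<close> reduces the claim to gluing: a map that is a weak
  equivalence over two open sets and over their intersection is one over their union.

  Gluing is proved for a relative lifting property with respect to cubes and their boundaries, which
  is equivalent to being a weak equivalence: subdivide the cube into cells that map into one of the two
  open sets and lift cell by cell, keeping every homotopy inside all those open sets that contain
  the image of the cell.
\<close>

subsection \<open>Continuous maps out of subsets of a space\<close>

text \<open>Two lifting properties occur because each is convenient at a different place.
  \<open>deformation_lifting\<close> lets the whole square move freely, which is what a weak
  equivalence and a deformation retraction provide directly; \<open>relative_lifting\<close> fixes
  the data already chosen on the boundary, which is what a cell-by-cell construction needs. A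
  reparametrization of the cylinder turns the first into the second, and so a circle closes: weak
  equivalence, deformation lifting, relative lifting, weak equivalence. The finite spaces are not
  Hausdorff in general and the homotopy colimit is only a quotient, so the cutting and pasting of
  lifting homotopies takes place on cubes, which are compact metric. The homotopies over a principal
  down-set must commute with \<open>\<psi>\<close> on the nose. The one on the finite space stands
  still for \<open>t < 1\<close> and jumps at \<open>t = 1\<close>; hence the one upstairs has to
  keep the least element of the supporting chain until the very last moment. This dictates the form
  of \<open>slide_weight\<close>.\<close>

lemma continuous_map_top_of_set_compose:
  assumes "continuous_map (top_of_set T) Z h" "continuous_on S g" "\<And>x. x \<in> S \<Longrightarrow> g x \<in> T"
  shows "continuous_map (top_of_set S) Z (\<lambda>x. h (g x))"
proof -
  have "continuous_map (top_of_set S) (top_of_set T) g"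
    using assms by (simp add: continuous_map_in_subtopology image_subset_iff_funcset Pi_def)
  then show ?thesis
    using continuous_map_compose[OF _ assms(1)] unfolding o_def by blast
qed

lemma continuous_map_top_of_set_subset:
  assumes "continuous_map (top_of_set T) Z h" "S \<subseteq> T"
  shows "continuous_map (top_of_set S) Z h"
  using continuous_map_from_subtopology_mono[OF assms] .

lemma continuous_map_top_of_set_cong:
  assumes "continuous_map (top_of_set S) Z f" "\<And>x. x \<in> S \<Longrightarrow> f x = g x"
  shows "continuous_map (top_of_set S) Z g"
  by (rule continuous_map_eq[OF assms(1)]) (use assms(2) in simp)

lemma continuous_map_top_of_set_Un:
  assumes f: "continuous_map (top_of_set S) Z f" and g: "continuous_map (top_of_set T) Z g"
    and clo: "closed S" "closed T"
    and eq: "\<And>x. x \<in> S \<Longrightarrow> x \<in> T \<Longrightarrow> f x = g x"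
  shows "continuous_map (top_of_set (S \<union> T)) Z (\<lambda>x. if x \<in> S then f x else g x)"
proof (rule pasting_lemma_closed[where I = UNIV and T = "\<lambda>b. if b then S else T"
      and f = "\<lambda>b. if b then f else g"])
  show "closedin (top_of_set (S \<union> T)) (if b then S else T)" for b
    using clo by (auto intro: closed_subset)
  show "continuous_map (subtopology (top_of_set (S \<union> T)) (if b then S else T)) Z (if b then f else g)" for b
    using f g by (auto simp: subtopology_subtopology Int_absorb1)
qed (use eq in \<open>auto split: if_splits\<close>)

lemma continuous_map_top_of_set_closed_cases:
  assumes "continuous_map (top_of_set S) Z h" "continuous_map (top_of_set T) Z h"
    and "closed S" "closed T"
  shows "continuous_map (top_of_set (S \<union> T)) Z h"
  using continuous_map_top_of_set_Un[OF assms(1,2)] assms(3,4) by simp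

lemma continuous_on_apply:
  "continuous_on S g \<Longrightarrow> continuous_on S (\<lambda>z. g z i)"
  by (rule continuous_on_compose2[OF continuous_on_product_coordinates]) auto

lemmas continuous_on_coordinate =
  continuous_on_apply[OF continuous_on_id] continuous_on_apply[OF continuous_on_fst[OF continuous_on_id]]
  continuous_on_apply[OF continuous_on_snd[OF continuous_on_id]]

subsection \<open>Cubes in the sup norm\<close>

text \<open>All cubes live in the one space \<open>nat \<Rightarrow> real\<close> that also carries
  the spheres, with coordinates from \<open>n\<close> on equal to zero. The dimension is thus an
  ordinary number that a proof may change, and the sup norm makes faces and radial maps
  explicit.\<close>

primrec supn :: "nat \<Rightarrow> (nat \<Rightarrow> real) \<Rightarrow> real" where
  "supn 0 x = 0"
| "supn (Suc n) x = max (supn n x) \<bar>x n\<bar>"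

lemma supn_nonneg [simp]: "0 \<le> supn n x"
  by (induction n) auto

lemma abs_le_supn: "i < n \<Longrightarrow> \<bar>x i\<bar> \<le> supn n x"
  by (induction n) (auto simp: less_Suc_eq)

lemma supn_le_iff: "0 \<le> c \<Longrightarrow> supn n x \<le> c \<longleftrightarrow> (\<forall>i<n. \<bar>x i\<bar> \<le> c)"
  by (induction n) (auto simp: less_Suc_eq)

lemma supn_attained: "supn n x \<noteq> 0 \<Longrightarrow> \<exists>i<n. \<bar>x i\<bar> = supn n x"
  by (induction n) (auto simp: less_Suc_eq max_def)

lemma supn_eq_1_iff: "supn n x \<le> 1 \<Longrightarrow> supn n x = 1 \<longleftrightarrow> (\<exists>i<n. \<bar>x i\<bar> = 1)"
  using supn_attained[of n x] abs_le_supn[of _ n x] by (metis order_antisym zero_neq_one)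

lemma supn_scale: "supn n (\<lambda>i. c * x i) = \<bar>c\<bar> * supn n x"
  by (induction n) (auto simp: abs_mult max_mult_distrib_left)

lemma supn_cong: "(\<And>i. i < n \<Longrightarrow> x i = y i) \<Longrightarrow> supn n x = supn n y"
  by (induction n) auto

lemma continuous_on_supn [continuous_intros]:
  "continuous_on S g \<Longrightarrow> continuous_on S (\<lambda>z. supn n (g z))"
  by (induction n) (simp_all add: continuous_on_max continuous_on_rabs continuous_on_apply)

lemmas continuous_on_basics = continuous_on_Pair continuous_on_fst continuous_on_snd continuous_on_id continuous_on_const
  continuous_on_add continuous_on_diff continuous_on_mult continuous_on_min
  continuous_on_max continuous_on_supn

definition cube :: "nat \<Rightarrow> (nat \<Rightarrow> real) set" where
  "cube n = {x. supn n x \<le> 1 \<and> (\<forall>i\<ge>n. x i = 0)}"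

definition cube_boundary :: "nat \<Rightarrow> (nat \<Rightarrow> real) set" where
  "cube_boundary n = {x. supn n x = 1 \<and> (\<forall>i\<ge>n. x i = 0)}"

text \<open>Bottom and sides of the cylinder: the part on which a homotopy is prescribed before it
  is extended.\<close>

definition cube_cup :: "nat \<Rightarrow> ((nat \<Rightarrow> real) \<times> real) set" where
  "cube_cup n = cube n \<times> {0} \<union> cube_boundary n \<times> {0..1}"

text \<open>Top and sides: the part over which a deformation of a square has to be covered by a map
  into the source.\<close>

definition cube_cap :: "nat \<Rightarrow> ((nat \<Rightarrow> real) \<times> real) set" where
  "cube_cap n = cube n \<times> {1} \<union> cube_boundary n \<times> {0..1}"

lemma cube_boundary_subset: "cube_boundary n \<subseteq> cube n"
  by (auto simp: cube_def cube_boundary_def)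

lemma closed_zero_from: "closed {x :: nat \<Rightarrow> real. \<forall>i\<ge>n. x i = 0}"
proof -
  have "closed {x :: nat \<Rightarrow> real. x i = 0}" for i
    by (intro closed_Collect_eq continuous_on_coordinate continuous_on_const)
  then have "closed (\<Inter>i\<in>{n..}. {x :: nat \<Rightarrow> real. x i = 0})" by auto
  moreover have "(\<Inter>i\<in>{n..}. {x :: nat \<Rightarrow> real. x i = 0}) = {x. \<forall>i\<ge>n. x i = 0}" by auto
  ultimately show ?thesis by simp
qed

lemma closed_cube: "closed (cube n)"
  unfolding cube_def Collect_conj_eq
  by (intro closed_Int closed_zero_from closed_Collect_le continuous_on_basics)

lemma closed_cube_boundary: "closed (cube_boundary n)"
  unfolding cube_boundary_def Collect_conj_eq
  by (intro closed_Int closed_zero_from closed_Collect_eq continuous_on_basics)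

lemma compact_cube: "compact (cube n)"
proof -
  have "compactin (product_topology (\<lambda>i. euclideanreal) UNIV) (PiE UNIV (\<lambda>i. {-1..1}))"
    by (subst compactin_PiE) auto
  then have "compact (PiE UNIV (\<lambda>i. {-1..1}) :: (nat \<Rightarrow> real) set)"
    by (simp add: euclidean_product_topology)
  moreover have "cube n \<subseteq> PiE UNIV (\<lambda>i. {-1..1})"
  proof
    fix x assume x: "x \<in> cube n"
    have "\<bar>x i\<bar> \<le> 1" for i
      using x abs_le_supn[of i n x] unfolding cube_def by (cases "i < n") auto
    then have "- 1 \<le> x i \<and> x i \<le> 1" for i by (metis abs_le_D1 abs_le_D2 minus_le_iff)
    then show "x \<in> PiE UNIV (\<lambda>i. {-1..1})" by (simp add: PiE_iff)
  qed
  ultimately show ?thesis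
    using closed_cube compact_Int_closed by (metis inf.absorb_iff2)
qed

lemma zero_in_cube: "(\<lambda>_. 0) \<in> cube n"
  using supn_scale[of n 0 "\<lambda>_. 0"] by (simp add: cube_def)

lemma scale_in_cube:
  assumes "x \<in> cube n" "\<bar>c\<bar> * supn n x \<le> 1"
  shows "(\<lambda>i. c * x i) \<in> cube n"
  using assms by (auto simp: cube_def supn_scale)

lemma scale_in_cube_boundary:
  assumes "x \<in> cube n" "\<bar>c\<bar> * supn n x = 1"
  shows "(\<lambda>i. c * x i) \<in> cube_boundary n"
  using assms by (auto simp: cube_def cube_boundary_def supn_scale)

subsection \<open>Two lifting properties\<close>

text \<open>A map of arrows from the inclusion of the boundary of a cube to \<open>f\<close> can be deformed,
  through maps of arrows, until it admits a diagonal filler.\<close>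

definition deformation_lifting :: "'e topology \<Rightarrow> 'y topology \<Rightarrow> ('e \<Rightarrow> 'y) \<Rightarrow> bool" where
  "deformation_lifting E Y f \<longleftrightarrow> (\<forall>n u v.
     continuous_map (top_of_set (cube_boundary n)) E u \<and>
     continuous_map (top_of_set (cube n)) Y v \<and>
     (\<forall>x\<in>cube_boundary n. v x = f (u x)) \<longrightarrow>
     (\<exists>K H. continuous_map (top_of_set (cube_cap n)) E K \<and>
            continuous_map (top_of_set (cube n \<times> {0..1})) Y H \<and>
            (\<forall>x\<in>cube n. H (x, 0) = v x) \<and>
            (\<forall>x\<in>cube_boundary n. K (x, 0) = u x) \<and>
            (\<forall>z\<in>cube_cap n. H z = f (K z))))"

text \<open>The homotopy extension and lifting property: the lift \<open>u\<close> over the boundary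
  covers \<open>h\<close> only at time 1, and the sides of \<open>h\<close> join it to the map on
  the bottom. For \<open>n = 0\<close> the boundary is empty and only surjectivity on path
  components is left.\<close>

definition relative_lifting :: "'e topology \<Rightarrow> 'y topology \<Rightarrow> ('e \<Rightarrow> 'y) \<Rightarrow> bool" where
  "relative_lifting E Y f \<longleftrightarrow> (\<forall>n u h.
     continuous_map (top_of_set (cube_boundary n)) E u \<and>
     continuous_map (top_of_set (cube_cup n)) Y h \<and>
     (\<forall>x\<in>cube_boundary n. h (x, 1) = f (u x)) \<longrightarrow>
     (\<exists>U H. continuous_map (top_of_set (cube n)) E U \<and>
            continuous_map (top_of_set (cube n \<times> {0..1})) Y H \<and>
            (\<forall>x\<in>cube_boundary n. U x = u x) \<and>
            (\<forall>z\<in>cube_cup n. H z = h z) \<and>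
            (\<forall>x\<in>cube n. H (x, 1) = f (U x))))"

text \<open>The cylinder is reparametrized. Folding the cup flat turns the bottom and the prescribed
  sides of \<open>h\<close> into one map on the cube, with boundary values \<open>f (u x)\<close>.
  The deformation then obtained is read off on the cap, whose rim at time 0 carries
  \<open>u\<close>. The free motion on the sides has thereby moved into the interior of the
  cube.\<close>

lemma deformation_lifting_imp_relative_lifting:
  assumes "deformation_lifting E Y f"
  shows "relative_lifting E Y f"
  unfolding relative_lifting_def
proof (intro allI impI, elim conjE, goal_cases)
  case (1 n u h)
  note u = 1(1) and h = 1(2) and hu = 1(3)
  \<comment> \<open>\<open>\<rho>\<close> and \<open>\<rho>'\<close> stretch the cube of half size
    over the bottom, respectively the top, and use the norm on the outer shell as time coordinate:
    upwards for \<open>\<rho>\<close>, downwards for \<open>\<rho>'\<close>. They identify the cube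
    with the cup and with the cap.\<close>
  define \<rho> where "\<rho> x = ((\<lambda>i. (1 / max (supn n x) (1/2)) * x i), max 0 (2 * supn n x - 1))" for x
  define \<rho>' where "\<rho>' x = ((\<lambda>i. (1 / max (supn n x) (1/2)) * x i), min 1 (2 - 2 * supn n x))" for x
  have scale_cases: "(\<lambda>i. (1 / max (supn n x) (1/2)) * x i) \<in> cube n"
    "supn n x \<ge> 1/2 \<Longrightarrow> (\<lambda>i. (1 / max (supn n x) (1/2)) * x i) \<in> cube_boundary n"
    if "x \<in> cube n" for x
  proof -
    show "(\<lambda>i. (1 / max (supn n x) (1/2)) * x i) \<in> cube n"
      using that by (intro scale_in_cube) (auto simp: max_def field_simps)
    show "(\<lambda>i. (1 / max (supn n x) (1/2)) * x i) \<in> cube_boundary n" if "supn n x \<ge> 1/2"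
      using that \<open>x \<in> cube n\<close> by (intro scale_in_cube_boundary) (auto simp:
            max_def field_simps)
  qed
  have \<rho>_in: "\<rho> x \<in> cube_cup n" if "x \<in> cube n" for x
    using scale_cases[OF that] that
    by (cases "supn n x \<ge> 1/2") (auto simp: \<rho>_def cube_cup_def cube_def)
  have \<rho>'_in: "\<rho>' x \<in> cube_cap n" if "x \<in> cube n" for x
    using scale_cases[OF that] that
    by (cases "supn n x \<ge> 1/2") (auto simp: \<rho>'_def cube_cap_def cube_def)
  have cont_scale: "continuous_on S (\<lambda>x i. (1 / max (supn n x) (1/2)) * x i)" for S
    by (intro continuous_on_coordinatewise_then_product continuous_on_basics continuous_on_divide
          continuous_on_coordinate) auto
  have cont_\<rho>: "continuous_on S \<rho>" for S
    unfolding \<rho>_def by (intro continuous_on_basics cont_scale)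
  have cont_\<rho>': "continuous_on S \<rho>'" for S
    unfolding \<rho>'_def by (intro continuous_on_basics cont_scale)
  have \<rho>_bd: "\<rho> x = (x, 1)" "\<rho>' x = (x, 0)" if "x \<in> cube_boundary n" for x
    using that by (auto simp: \<rho>_def \<rho>'_def cube_boundary_def)
  have v: "continuous_map (top_of_set (cube n)) Y (\<lambda>x. h (\<rho> x))"
    by (rule continuous_map_top_of_set_compose[OF h cont_\<rho> \<rho>_in])
  obtain K H where K: "continuous_map (top_of_set (cube_cap n)) E K"
    and H: "continuous_map (top_of_set (cube n \<times> {0..1})) Y H"
    and H0: "\<forall>x\<in>cube n. H (x, 0) = h (\<rho> x)" and K0: "\<forall>x\<in>cube_boundary n. K (x, 0) = u x"
    and HK: "\<forall>z\<in>cube_cap n. H z = f (K z)"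
    using assms[unfolded deformation_lifting_def, rule_format, of n u "\<lambda>x. h (\<rho> x)"] u v hu \<rho>_bd
    by auto
  \<comment> \<open>\<open>\<Phi>\<close> must be the inverse of \<open>\<rho>\<close>, placed at
    time 0, on the cup, and must equal \<open>\<rho>'\<close> at time 1. Near the centre it scales
    by \<open>(1 + 3 * t) / 2\<close>, which runs from 1/2 to 2; further out it makes the norm equal
    to \<open>(1 + t) / 2\<close>, which runs from 1/2 to 1. The two rules meet at norm
    \<open>(1 + t) / (1 + 3 * t)\<close>.\<close>
  define s where "s x t = (1 + t) / (2 * max (supn n x) ((1 + t) / (1 + 3 * t)))" for x and t :: real
  define \<Phi> where "\<Phi> = (\<lambda>(x, t). ((\<lambda>i. s x t * x i), min t (2 - 2 * supn n x)))"
  have s_le: "\<bar>s x t\<bar> * supn n x \<le> (1 + t) / 2" if "0 \<le> t" for x t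
  proof -
    define M where "M = max (supn n x) ((1 + t) / (1 + 3 * t))"
    have "(1 + t) / (1 + 3 * t) > 0" using that by simp
    then have M: "M > 0" "supn n x \<le> M" by (auto simp: M_def)
    have "\<bar>s x t\<bar> * supn n x = (1 + t) / 2 * (supn n x / M)"
      using that M by (simp add: s_def flip: M_def)
    also have "\<dots> \<le> (1 + t) / 2 * 1"
      using that M by (intro mult_left_mono) auto
    finally show ?thesis by simp
  qed
  have \<Phi>_in: "\<Phi> z \<in> cube n \<times> {0..1}" if z_in: "z \<in> cube n \<times> {0..1}" for z
  proof -
    obtain x t where z: "z = (x, t)" "x \<in> cube n" "0 \<le> t" "t \<le> 1" using z_in by auto
    have "(\<lambda>i. s x t * x i) \<in> cube n"
      using s_le[of t x] z by (intro scale_in_cube) auto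
    then show ?thesis using z by (auto simp: \<Phi>_def cube_def)
  qed
  have cont_\<Phi>: "continuous_on (cube n \<times> {0..1}) \<Phi>"
  proof -
    have "1 + 3 * t \<noteq> 0" "max a ((1 + t) / (1 + 3 * t)) \<noteq> 0" if "t \<in> {0..1}" for a t :: real
    proof -
      have "(1 + t) / (1 + 3 * t) > 0" using that by simp
      then show "max a ((1 + t) / (1 + 3 * t)) \<noteq> 0" by linarith
    qed (use that in auto)
    then show ?thesis
      unfolding \<Phi>_def s_def case_prod_unfold
      by (intro continuous_on_basics continuous_on_coordinatewise_then_product continuous_on_divide
            continuous_on_coordinate) auto
  qed
  define U where "U x = K (\<rho>' x)" for x
  define H' where "H' z = H (\<Phi> z)" for z
  have "continuous_map (top_of_set (cube n)) E U"
    unfolding U_def by (rule continuous_map_top_of_set_compose[OF K cont_\<rho>' \<rho>'_in])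
  moreover have "continuous_map (top_of_set (cube n \<times> {0..1})) Y H'"
    unfolding H'_def by (rule continuous_map_top_of_set_compose[OF H cont_\<Phi> \<Phi>_in])
  moreover have "\<forall>x\<in>cube_boundary n. U x = u x"
    using K0 by (simp add: U_def \<rho>_bd)
  moreover have "H' z = h z" if z: "z \<in> cube_cup n" for z
  proof -
    obtain x t where xt: "z = (x, t)" by fastforce
    consider "x \<in> cube n" "t = 0" | "x \<in> cube_boundary n" "0 \<le> t" "t \<le> 1"
      using z by (auto simp: cube_cup_def xt)
    then show ?thesis
    proof cases
      case 1
      have s: "s x t = 1 / 2" using 1 by (auto simp: s_def cube_def max_def)
      have "(\<lambda>i. 1 / 2 * x i) \<in> cube n" using 1 by (intro scale_in_cube) (auto simp: cube_def)
      moreover have "\<rho> (\<lambda>i. 1 / 2 * x i) = (x, 0)"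
        unfolding \<rho>_def supn_scale using 1 by (auto simp: cube_def max_def)
      moreover have "\<Phi> z = (\<lambda>i. 1 / 2 * x i, 0)"
        using 1 s by (auto simp: \<Phi>_def xt cube_def)
      ultimately show ?thesis using H0 1 by (simp add: H'_def xt)
    next
      case 2
      have "(1 + t) / (1 + 3 * t) \<le> 1" using 2 by (simp add: field_simps)
      then have s: "s x t = (1 + t) / 2" using 2 by (simp add: s_def cube_boundary_def max_def)
      have xn: "supn n x = 1" "x \<in> cube n" using 2 by (auto simp: cube_boundary_def cube_def)
      have "(\<lambda>i. s x t * x i) \<in> cube n" using 2 xn s by (intro scale_in_cube) auto
      moreover have "\<rho> (\<lambda>i. s x t * x i) = (x, t)"
        unfolding \<rho>_def supn_scale using 2 xn s by (auto simp: max_def field_simps)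
      moreover have "\<Phi> z = (\<lambda>i. s x t * x i, 0)"
        using 2 xn by (auto simp: \<Phi>_def xt)
      ultimately show ?thesis using H0 by (simp add: H'_def xt)
    qed
  qed
  moreover have "H' (x, 1) = f (U x)" if x: "x \<in> cube n" for x
  proof -
    have "s x 1 = 1 / max (supn n x) (1 / 2)"
      by (simp add: s_def)
    then have "\<Phi> (x, 1) = \<rho>' x" by (simp add: \<Phi>_def \<rho>'_def)
    then show ?thesis using HK \<rho>'_in[OF x] by (simp add: H'_def U_def)
  qed
  ultimately show ?case
    by blast
qed

subsection \<open>The sphere as a quotient of a cube\<close>

definition usphere :: "nat \<Rightarrow> (nat \<Rightarrow> real) set" where
  "usphere n = {x. (\<Sum>i\<le>n. (x i)\<^sup>2) = 1 \<and> (\<forall>i>n. x i = 0)}"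

lemma nsphere_eq_usphere: "nsphere n = top_of_set (usphere n)"
  by (simp add: nsphere usphere_def euclidean_product_topology)

lemma sphere_base_in_usphere: "sphere_base \<in> usphere n"
proof -
  have "(\<Sum>i\<le>n. (sphere_base i)\<^sup>2) = (\<Sum>i\<le>n. if i = 0 then 1 else 0)"
    by (rule sum.cong) (auto simp: sphere_base_def)
  then show ?thesis by (simp add: usphere_def sphere_base_def)
qed

definition norm2 :: "nat \<Rightarrow> (nat \<Rightarrow> real) \<Rightarrow> real" where
  "norm2 n x = sqrt (\<Sum>i\<le>n. (x i)\<^sup>2)"

lemma norm2_pos: "i \<le> n \<Longrightarrow> x i \<noteq> 0 \<Longrightarrow> 0 < norm2 n x"
  unfolding norm2_def real_sqrt_gt_0_iff by (rule sum_pos2[of _ i]) simp_all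

lemma norm2_scale: "norm2 n (\<lambda>i. c * x i) = \<bar>c\<bar> * norm2 n x"
  by (simp add: norm2_def power_mult_distrib real_sqrt_mult flip: sum_distrib_left)

lemma norm2_usphere: "x \<in> usphere n \<Longrightarrow> norm2 n x = 1"
  by (simp add: norm2_def usphere_def)

lemma usphere_nonzero: "x \<in> usphere n \<Longrightarrow> \<exists>i\<le>n. x i \<noteq> 0"
  by (rule ccontr) (simp add: usphere_def)

lemma normalize_in_usphere:
  assumes "norm2 n x > 0" "\<And>i. i > n \<Longrightarrow> x i = 0"
  shows "(\<lambda>i. x i / norm2 n x) \<in> usphere n"
proof -
  have "(norm2 n x)\<^sup>2 = (\<Sum>i\<le>n. (x i)\<^sup>2)"
    by (simp add: norm2_def sum_nonneg)
  then show ?thesis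
    using assms by (auto simp: usphere_def power_divide simp flip: sum_divide_distrib)
qed

lemma continuous_on_norm2:
  "continuous_on S g \<Longrightarrow> continuous_on S (\<lambda>z. norm2 n (g z))"
  unfolding norm2_def
  by (intro continuous_on_real_sqrt continuous_on_sum continuous_on_power) (rule continuous_on_apply)

text \<open>The added isolated point goes to the base point of the sphere; it matters only in dimension 0,
  where the cube itself misses the base point.\<close>

definition pointed_cube :: "nat \<Rightarrow> (nat \<Rightarrow> real) set" where
  "pointed_cube n = insert (\<lambda>i. if i = n then 1 else 0) (cube n)"

text \<open>On the cube the height goes from -1 at the centre to 1 at the boundary, and the
  remaining coordinates vanish together only at these two places; division by the norm then gives a
  point of the sphere. The norm is \<open>supn (Suc n)\<close> so that the added point, whose only
  nonzero coordinate has index \<open>n\<close>, counts as a boundary point.\<close>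

definition sphere_cover :: "nat \<Rightarrow> (nat \<Rightarrow> real) \<Rightarrow> nat \<Rightarrow> real" where
  "sphere_cover n x i = (if i = 0 then 2 * supn (Suc n) x - 1
     else if i \<le> n then (1 - supn (Suc n) x) * x (i - 1) else 0)"

definition sphere_quotient :: "nat \<Rightarrow> (nat \<Rightarrow> real) \<Rightarrow> nat \<Rightarrow> real" where
  "sphere_quotient n x = (\<lambda>i. sphere_cover n x i / norm2 n (sphere_cover n x))"

lemma supn_Suc_cube: "x \<in> cube n \<Longrightarrow> supn (Suc n) x = supn n x"
  by (simp add: cube_def)

lemma supn_zero: "supn n (\<lambda>_. 0) = 0"
  by (induction n) auto

lemma supn_unit_vector: "supn (Suc n) (\<lambda>i. if i = n then 1 else 0) = 1"
proof -
  have "supn n (\<lambda>i. if i = n then 1 else 0) = supn n (\<lambda>_. 0)"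
    by (rule supn_cong) auto
  then show ?thesis by (simp add: supn_zero)
qed

lemma pointed_cube_cases:
  assumes "x \<in> pointed_cube n"
  obtains "x = (\<lambda>i. if i = n then 1 else 0)" "supn (Suc n) x = 1"
    | "x \<in> cube n" "supn (Suc n) x = supn n x"
  using assms supn_unit_vector supn_Suc_cube unfolding pointed_cube_def by blast

lemma norm2_sphere_cover_pos:
  assumes "x \<in> pointed_cube n"
  shows "0 < norm2 n (sphere_cover n x)"
proof (cases "supn (Suc n) x = 1 / 2")
  case False
  then show ?thesis by (intro norm2_pos[of 0]) (auto simp: sphere_cover_def)
next
  \<comment> \<open>The height vanishes exactly at norm 1/2; there a coordinate that attains the
    norm keeps the cover away from zero.\<close>
  case True
  then have x: "x \<in> cube n" "supn n x = 1 / 2"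
    using assms by (auto elim!: pointed_cube_cases simp del: supn.simps)
  then obtain i where "i < n" "\<bar>x i\<bar> = 1 / 2" using supn_attained[of n x] by auto
  then show ?thesis using True
    by (intro norm2_pos[of "Suc i"]) (auto simp: sphere_cover_def simp del: supn.simps)
qed

lemma sphere_quotient_in_usphere: "x \<in> pointed_cube n \<Longrightarrow> sphere_quotient n x \<in> usphere n"
  unfolding sphere_quotient_def
  by (intro normalize_in_usphere norm2_sphere_cover_pos) (auto simp: sphere_cover_def)

lemma sphere_quotient_eq_base:
  assumes "supn (Suc n) x = 1"
  shows "sphere_quotient n x = sphere_base"
proof -
  have "sphere_cover n x = sphere_base"
    using assms by (auto simp: sphere_cover_def sphere_base_def fun_eq_iff simp del: supn.simps)
  then show ?thesis
    using norm2_usphere[OF sphere_base_in_usphere[of n]]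
    by (simp add: sphere_quotient_def)
qed

lemma sphere_quotient_boundary: "x \<in> cube_boundary n \<Longrightarrow> sphere_quotient n x = sphere_base"
  by (rule sphere_quotient_eq_base) (simp add: cube_boundary_def)

lemma continuous_on_sphere_quotient: "continuous_on (pointed_cube n) (sphere_quotient n)"
proof -
  have c: "continuous_on S (\<lambda>x. sphere_cover n x i)" for S i
  proof -
    consider "i = 0" | "0 < i" "i \<le> n" | "i > n" by linarith
    then show ?thesis
      by cases (auto simp: sphere_cover_def simp del: supn.simps
          intro!: continuous_on_diff continuous_on_mult continuous_on_supn continuous_on_coordinate continuous_on_const)
  qed
  then have "continuous_on S (sphere_cover n)" for S
    by (rule continuous_on_coordinatewise_then_product)
  then have "continuous_on S (\<lambda>x. norm2 n (sphere_cover n x))" for S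
    by (rule continuous_on_norm2)
  then show ?thesis
    unfolding sphere_quotient_def using c norm2_sphere_cover_pos
    by (intro continuous_on_coordinatewise_then_product continuous_on_divide) fastforce+
qed

text \<open>Two points with the same image have proportional covers, so their sup norms \<open>a\<close>, \<open>b\<close> satisfy
  \<open>(2a - 1)(1 - b)b = (2b - 1)(1 - a)a\<close>, which factors as \<open>(a - b)((1 - a)(1 - b) + ab) = 0\<close>.\<close>

lemma sphere_quotient_eqD:
  assumes x: "x \<in> pointed_cube n" and y: "y \<in> pointed_cube n"
    and eq: "sphere_quotient n x = sphere_quotient n y"
  shows "x = y \<or> (supn (Suc n) x = 1 \<and> supn (Suc n) y = 1)"
proof -
  define a b where "a = supn (Suc n) x" and "b = supn (Suc n) y"
  define c where "c = norm2 n (sphere_cover n x) / norm2 n (sphere_cover n y)"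
  have pos: "norm2 n (sphere_cover n x) > 0" "norm2 n (sphere_cover n y) > 0"
    using x y by (auto intro: norm2_sphere_cover_pos)
  then have c: "c > 0" by (simp add: c_def)
  have cov: "sphere_cover n x i = c * sphere_cover n y i" for i
    using fun_cong[OF eq, of i] pos by (simp add: sphere_quotient_def c_def field_simps)
  have 0: "2 * a - 1 = c * (2 * b - 1)"
    using cov[of 0] by (simp add: sphere_cover_def a_def b_def del: supn.simps)
  have coord: "(1 - a) * x i = c * (1 - b) * y i" if "i < n" for i
    using cov[of "Suc i"] that by (simp add: sphere_cover_def a_def b_def mult.assoc del: supn.simps)
  have ab: "0 \<le> a" "a \<le> 1" "0 \<le> b" "b \<le> 1"
    using pointed_cube_cases[OF x] pointed_cube_cases[OF y] supn_nonneg
    unfolding a_def b_def cube_def by (metis (no_types, lifting) mem_Collect_eq order_refl)+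
  have "\<bar>1 - a\<bar> * supn n x = \<bar>c * (1 - b)\<bar> * supn n y"
    using supn_cong[of n "\<lambda>i. (1 - a) * x i" "\<lambda>i. c * (1 - b) * y i"] coord
    by (simp only: supn_scale)
  then have "(1 - a) * supn n x = c * ((1 - b) * supn n y)"
    using ab c by (simp add: abs_mult)
  \<comment> \<open>\<open>supn n\<close> and \<open>supn (Suc n)\<close> differ only at the added
    point, and there the factor \<open>1 - a\<close> is zero.\<close>
  moreover have "(1 - a) * supn n x = (1 - a) * a"
    using pointed_cube_cases[OF x] unfolding a_def by (metis diff_self mult_zero_left)
  moreover have "(1 - b) * supn n y = (1 - b) * b"
    using pointed_cube_cases[OF y] unfolding b_def by (metis diff_self mult_zero_left)
  ultimately have 1: "(1 - a) * a = c * ((1 - b) * b)" by simp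
  have "c * ((a - b) * ((1 - a) * (1 - b) + a * b))
      = (c * ((1 - b) * b)) * (2 * a - 1) - (c * (2 * b - 1)) * ((1 - a) * a)"
    by algebra
  also have "\<dots> = 0" unfolding 0[symmetric] 1[symmetric] by simp
  finally have "a = b \<or> (1 - a) * (1 - b) + a * b = 0" using c by simp
  \<comment> \<open>One point would be the centre and the other would have norm 1, so their heights
    would have opposite signs, against \<open>c > 0\<close>.\<close>
  moreover have False if "(1 - a) * (1 - b) + a * b = 0"
  proof -
    have "(1 - a) * (1 - b) \<ge> 0" "a * b \<ge> 0" using ab by auto
    with that have "(1 - a) * (1 - b) = 0" "a * b = 0" by linarith+
    then consider "a = 1" "b = 0" | "a = 0" "b = 1" by auto
    then show False using 0 c by cases auto
  qed
  ultimately have "a = b" by blast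
  show ?thesis
  proof (cases "a = 1")
    case True
    then show ?thesis using \<open>a = b\<close> a_def b_def by simp
  next
    case False
    then have xy: "x \<in> cube n" "y \<in> cube n" and sn: "supn n x = a" "supn n y = a"
      using pointed_cube_cases[OF x] pointed_cube_cases[OF y] \<open>a = b\<close>
      unfolding a_def b_def by metis+
    have co: "x i = c * y i" for i
      using coord[of i] False \<open>a = b\<close> xy by (cases "i < n") (auto simp: cube_def)
    have "x i = y i" for i
    proof (cases "a = 0")
      case True
      then show ?thesis using abs_le_supn[of i n y] sn co[of i] xy by (cases "i < n") (auto simp: cube_def)
    next
      case a0: False
      then have "c = 1" using 1 False \<open>a = b\<close> by simp
      then show ?thesis using co by simp
    qed
    then show ?thesis by auto
  qed
qed

text \<open>Away from the poles the direction of \<open>x\<close> is forced by the coordinates of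
  \<open>z\<close> after the first, so only the norm of \<open>x\<close> has to be found. The base
  point comes from the added point and the opposite pole from the centre.\<close>

lemma sphere_quotient_surj:
  assumes z: "z \<in> usphere n"
  shows "\<exists>x\<in>pointed_cube n. sphere_quotient n x = z"
proof -
  define y where "y i = (if i < n then z (Suc i) else 0)" for i
  define M where "M = supn n y"
  have zi: "z i = 0" if "i > n" for i using z that by (auto simp: usphere_def)
  show ?thesis
  proof (cases "M = 0")
    case True
    have "y i = 0" if "i < n" for i using abs_le_supn[of i n y] that True by (simp add: M_def)
    then have "z (Suc i) = 0" if "i < n" for i using that by (simp add: y_def)
    then have zs: "z i = 0" if "i \<noteq> 0" for i using zi that by (cases i; cases "i > n") auto
    then have "(\<Sum>i\<le>n. (z i)\<^sup>2) = (\<Sum>i\<in>{0}. (z i)\<^sup>2)"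
      by (intro sum.mono_neutral_right) auto
    then have "(z 0)\<^sup>2 = 1" using z by (simp add: usphere_def)
    then consider "z 0 = 1" | "z 0 = -1" by (auto simp: power2_eq_1_iff)
    then show ?thesis
    proof cases
      case 1
      then have "z = sphere_base" using zs by (auto simp: sphere_base_def)
      then show ?thesis
        using sphere_quotient_eq_base[OF supn_unit_vector] by (auto simp: pointed_cube_def)
    next
      case 2
      have "sphere_cover n (\<lambda>_. 0) = z"
        using 2 zs supn_zero[of "Suc n"] by (auto simp: sphere_cover_def simp del: supn.simps)
      then have "sphere_quotient n (\<lambda>_. 0) = z"
        using norm2_usphere[OF z] by (simp add: sphere_quotient_def)
      then show ?thesis using zero_in_cube by (auto simp: pointed_cube_def)
    qed
  next
    case False
    then have M: "M > 0" using supn_nonneg[of n y] unfolding M_def by linarith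
    \<comment> \<open>A point of norm \<tau> in the direction of \<open>y\<close> has a cover
      proportional to \<open>z\<close> exactly when its height \<open>2 * \<tau> - 1\<close> is
      \<open>(1 - \<tau>) * \<tau> / M\<close> times \<open>z 0\<close>. Since
      \<open>G 0 = -1\<close> and \<open>G 1 = 1\<close>, such a \<tau> exists strictly between 0
      and 1.\<close>
    define G where "G \<tau> = 2 * \<tau> - 1 - (1 - \<tau>) * \<tau> * z 0 / M" for \<tau>
    have "continuous_on {0..1} G"
      unfolding G_def using M by (intro continuous_intros) auto
    then have "\<exists>\<tau>\<ge>0. \<tau> \<le> 1 \<and> G \<tau> = 0"
      by (intro IVT') (auto simp: G_def)
    then obtain \<tau> where \<tau>: "0 \<le> \<tau>" "\<tau> \<le> 1" "G \<tau> = 0" by blast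
    then have "\<tau> \<noteq> 0" "\<tau> \<noteq> 1" by (auto simp: G_def)
    then have \<tau>01: "0 < \<tau>" "\<tau> < 1" using \<tau> by auto
    define x where "x = (\<lambda>i. (\<tau> / M) * y i)"
    have sx: "supn n x = \<tau>" using \<tau>01 M unfolding x_def supn_scale M_def[symmetric] by simp
    then have x: "x \<in> cube n" using \<tau> by (auto simp: cube_def x_def y_def)
    define k where "k = (1 - \<tau>) * \<tau> / M"
    have k: "k > 0" using \<tau>01 M by (simp add: k_def)
    have "sphere_cover n x i = k * z i" for i
    proof -
      consider "i = 0" | "0 < i" "i \<le> n" | "i > n" by linarith
      then show ?thesis
      proof cases
        case 1
        then show ?thesis using \<tau>(3) supn_Suc_cube[OF x] sx M
          by (simp add: sphere_cover_def G_def k_def del: supn.simps)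
      next
        case 2
        then show ?thesis using supn_Suc_cube[OF x] sx
          by (cases i) (auto simp: sphere_cover_def k_def x_def y_def simp del: supn.simps)
      next
        case 3
        then show ?thesis using zi by (simp add: sphere_cover_def)
      qed
    qed
    then have "sphere_cover n x = (\<lambda>i. k * z i)" by auto
    then have "sphere_quotient n x = z"
      using norm2_usphere[OF z] k by (simp add: sphere_quotient_def norm2_scale)
    then show ?thesis using x by (auto simp: pointed_cube_def)
  qed
qed

lemma compact_pointed_cube: "compact (pointed_cube n)"
  unfolding pointed_cube_def by (intro compact_insert compact_cube)

text \<open>A continuous surjection of a compact space onto a Hausdorff space is a quotient map.
  Applied to the product with the interval, this lets a homotopy that is constant on the boundary
  descend in one step, whatever the target \<open>Z\<close>. A single map is treated as a stationary
  homotopy.\<close>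

lemma sphere_quotient_lift:
  fixes F :: "(nat \<Rightarrow> real) \<times> real \<Rightarrow> 'z"
  assumes F: "continuous_map (top_of_set (cube n \<times> {0..1})) Z F" and z: "z \<in> topspace Z"
    and bd: "\<And>x t. x \<in> cube_boundary n \<Longrightarrow> t \<in> {0..1} \<Longrightarrow> F (x, t) = z"
  obtains G where "continuous_map (top_of_set (usphere n \<times> {0..1})) Z G"
    "\<And>x t. x \<in> cube n \<Longrightarrow> t \<in> {0..1} \<Longrightarrow> G (sphere_quotient n x, t) = F (x, t)"
    "\<And>t. t \<in> {0..1} \<Longrightarrow> G (sphere_base, t) = z"
proof -
  define e where "e = (\<lambda>i::nat. if i = n then 1 else (0::real))"
  have e: "e \<notin> cube n" by (auto simp: e_def cube_def)
  \<comment> \<open>The added point is isolated from the cube and is sent to \<open>z\<close>. For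
    \<open>n = 0\<close> the boundary is empty and this is the only source of the value at the base
    point.\<close>
  define F' where "F' z' = (if z' \<in> {e} \<times> {0..1} then z else F z')" for z'
  have "continuous_map (top_of_set ({e} \<times> {0..1} \<union> cube n \<times> {0..1})) Z F'"
    unfolding F'_def
    by (intro continuous_map_top_of_set_Un F closed_Times closed_cube closed_real_atLeastAtMost)
          (use z e in auto)
  moreover have "{e} \<times> {0..1} \<union> cube n \<times> {0..1} = pointed_cube n \<times> {0..1::real}"
    by (auto simp: pointed_cube_def e_def)
  ultimately have F': "continuous_map (top_of_set (pointed_cube n \<times> {0..1})) Z F'" by simp
  have q: "quotient_map (top_of_set (pointed_cube n \<times> {0..1})) (top_of_set (usphere n \<times> {0..1::real}))
     (\<lambda>z. (sphere_quotient n (fst z), snd z))"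
  proof (rule continuous_imp_quotient_map)
    have "continuous_on (pointed_cube n \<times> {0..1::real}) (\<lambda>z. (sphere_quotient n (fst z), snd z))"
      by (intro continuous_on_basics continuous_on_compose2[OF continuous_on_sphere_quotient]) auto
    then show "continuous_map (top_of_set (pointed_cube n \<times> {0..1})) (top_of_set (usphere n \<times> {0..1::real}))
       (\<lambda>z. (sphere_quotient n (fst z), snd z))"
      using sphere_quotient_in_usphere by (auto simp: continuous_map_in_subtopology)
    show "compact_space (top_of_set (pointed_cube n \<times> {0..1::real}))"
      by (simp add: compact_space_subtopology compact_Times compact_pointed_cube)
    show "Hausdorff_space (top_of_set (usphere n \<times> {0..1::real}))"
      by (simp add: Hausdorff_space_subtopology)
    show "(\<lambda>z. (sphere_quotient n (fst z), snd z)) ` topspace (top_of_set (pointed_cube n \<times> {0..1}))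
      = topspace (top_of_set (usphere n \<times> {0..1::real}))"
    proof (intro equalityI subsetI)
      fix w assume "w \<in> topspace (top_of_set (usphere n \<times> {0..1::real}))"
      then obtain x where "x \<in> pointed_cube n" "sphere_quotient n x = fst w" "snd w \<in> {0..1}"
        using sphere_quotient_surj[of "fst w" n] by auto
      then show "w \<in> (\<lambda>z. (sphere_quotient n (fst z), snd z)) ` topspace (top_of_set (pointed_cube n \<times> {0..1}))"
        by (intro image_eqI[of _ _ "(x, snd w)"]) auto
    qed (use sphere_quotient_in_usphere in auto)
  qed
  have F'1: "F' (x, t) = z" if "x \<in> pointed_cube n" "supn (Suc n) x = 1" "t \<in> {0..1}" for x t
    using that(1)
  proof (cases rule: pointed_cube_cases)
    case 1
    then show ?thesis using that by (simp add: F'_def e_def)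
  next
    case 2
    then have "x \<in> cube_boundary n" using that by (auto simp: cube_def cube_boundary_def)
    then show ?thesis using bd that by (simp add: F'_def)
  qed
  obtain G where G: "continuous_map (top_of_set (usphere n \<times> {0..1})) Z G"
    and GF: "\<And>w. w \<in> pointed_cube n \<times> {0..1} \<Longrightarrow> G (sphere_quotient n (fst w), snd w) = F' w"
  proof (rule quotient_map_lift_exists[OF q F'])
    fix w w' assume w: "w \<in> topspace (top_of_set (pointed_cube n \<times> {0..1::real}))"
      "w' \<in> topspace (top_of_set (pointed_cube n \<times> {0..1::real}))"
      "(sphere_quotient n (fst w), snd w) = (sphere_quotient n (fst w'), snd w')"
    then have "fst w = fst w' \<or> (supn (Suc n) (fst w) = 1 \<and> supn (Suc n) (fst w') = 1)"
      by (intro sphere_quotient_eqD) auto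
    moreover have "w \<in> pointed_cube n \<times> {0..1}" "w' \<in> pointed_cube n \<times> {0..1}" "snd w = snd w'"
      using w by auto
    ultimately show "F' w = F' w'"
      using F'1 by (cases w; cases w') (auto simp del: supn.simps)
  qed auto
  show thesis
  proof
    show "continuous_map (top_of_set (usphere n \<times> {0..1})) Z G" by (rule G)
    show "G (sphere_quotient n x, t) = F (x, t)" if "x \<in> cube n" "t \<in> {0..1}" for x t
      using GF[of "(x, t)"] that e by (auto simp: pointed_cube_def F'_def)
    show "G (sphere_base, t) = z" if "t \<in> {0..1}" for t
      using GF[of "(e, t)"] that sphere_quotient_eq_base[OF supn_unit_vector[of n]]
      by (auto simp: pointed_cube_def F'_def e_def)
  qed
qed

lemma usphere_eq_or_base:
  assumes "y \<in> usphere n"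
  obtains "y = sphere_base" | x where "x \<in> cube n" "y = sphere_quotient n x"
proof -
  obtain x where "x \<in> pointed_cube n" "sphere_quotient n x = y"
    using sphere_quotient_surj[OF assms] by blast
  then show thesis
    using that sphere_quotient_eq_base[of n x] by (cases rule: pointed_cube_cases) metis+
qed

subsection \<open>Weak equivalences and lifting\<close>

text \<open>Cylinders are written here with time as the second factor, whereas in
  \<open>homotopic_with\<close> it is the first.\<close>

lemma nsphere_homotopyI:
  fixes h :: "(nat \<Rightarrow> real) \<times> real \<Rightarrow> 'y"
  assumes h: "continuous_map (top_of_set (usphere n \<times> {0..1})) Y h"
    and "\<And>x. x \<in> usphere n \<Longrightarrow> h (x, 0) = p x" "\<And>x. x \<in> usphere n \<Longrightarrow> h (x, 1) = g x"
    and "\<And>t. t \<in> {0..1} \<Longrightarrow> h (sphere_base, t) = b"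
  shows "homotopic_with (\<lambda>k. k sphere_base = b) (nsphere n) Y p g"
proof -
  have "continuous_map (top_of_set ({0..1} \<times> usphere n)) Y (\<lambda>z. h (snd z, fst z))"
    by (rule continuous_map_top_of_set_compose[OF h])
      (auto intro!: continuous_on_Pair continuous_on_fst continuous_on_snd continuous_on_id)
  then show ?thesis
    using assms(2-4) sphere_base_in_usphere
    by (subst homotopic_with)
      (auto simp: nsphere_eq_usphere intro!: exI[of _ "\<lambda>z. h (snd z, fst z)"])
qed

lemma nsphere_homotopyE:
  assumes "homotopic_with (\<lambda>k. k sphere_base = b) (nsphere n) Y p g"
  obtains h :: "(nat \<Rightarrow> real) \<times> real \<Rightarrow> 'y"
  where "continuous_map (top_of_set (usphere n \<times> {0..1})) Y h"
    "\<And>x. h (x, 0) = p x" "\<And>x. h (x, 1) = g x"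
    "\<And>t. t \<in> {0..1} \<Longrightarrow> h (sphere_base, t) = b"
proof -
  obtain h :: "real \<times> (nat \<Rightarrow> real) \<Rightarrow> 'y"
  where h: "continuous_map (top_of_set ({0..1} \<times> usphere n)) Y h"
    "\<forall>x. h (0, x) = p x" "\<forall>x. h (1, x) = g x" "\<forall>t\<in>{0..1}. h (t, sphere_base) = b"
    using assms unfolding homotopic_with_def nsphere_eq_usphere by auto
  show thesis
  proof (rule that[of "\<lambda>z. h (snd z, fst z)"])
    show "continuous_map (top_of_set (usphere n \<times> {0..1})) Y (\<lambda>z. h (snd z, fst z))"
      by (rule continuous_map_top_of_set_compose[OF h(1)])
        (auto intro!: continuous_on_Pair continuous_on_fst continuous_on_snd continuous_on_id)
  qed (use h in auto)
qed

lemma cube_boundary_0 [simp]: "cube_boundary 0 = {}"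
  by (auto simp: cube_boundary_def)

lemma cube_0: "cube 0 = {\<lambda>_. 0}"
  by (auto simp: cube_def)

lemma cube_in_pointed_cube: "x \<in> cube n \<Longrightarrow> x \<in> pointed_cube n"
  by (simp add: pointed_cube_def)

lemma continuous_on_sphere_quotient_cube: "continuous_on (cube n) (sphere_quotient n)"
  by (rule continuous_on_subset[OF continuous_on_sphere_quotient]) (auto simp: pointed_cube_def)

section \<open>From relative lifting to bijections on homotopy classes of spheres\<close>

context
  fixes E :: "'e topology" and Y :: "'y topology" and f :: "'e \<Rightarrow> 'y"
  assumes f: "continuous_map E Y f" and RL: "relative_lifting E Y f"
begin

lemma relative_liftingE:
  assumes "continuous_map (top_of_set (cube_boundary n)) E u"
    "continuous_map (top_of_set (cube_cup n)) Y h"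
    "\<And>x. x \<in> cube_boundary n \<Longrightarrow> h (x, 1) = f (u x)"
  obtains U H where "continuous_map (top_of_set (cube n)) E U"
            "continuous_map (top_of_set (cube n \<times> {0..1})) Y H"
            "\<And>x. x \<in> cube_boundary n \<Longrightarrow> U x = u x"
            "\<And>z. z \<in> cube_cup n \<Longrightarrow> H z = h z"
            "\<And>x. x \<in> cube n \<Longrightarrow> H (x, 1) = f (U x)"
  using RL[unfolded relative_lifting_def, rule_format, of n u h] assms by blast

lemma relative_lifting_path_component:
  assumes "y \<in> topspace Y"
  shows "\<exists>x\<in>topspace E. path_component_of Y (f x) y"
proof -
  \<comment> \<open>The boundary of the 0-cube is empty, so any function is a lift over it. The
    homotopy starts at \<open>y\<close>, hence the path is traversed backwards afterwards.\<close>
  obtain U H where U: "continuous_map (top_of_set (cube 0)) E U"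
    and H: "continuous_map (top_of_set (cube 0 \<times> {0..1})) Y H"
    and H0: "\<And>z. z \<in> cube_cup 0 \<Longrightarrow> H z = y"
    and H1: "\<And>x. x \<in> cube 0 \<Longrightarrow> H (x, 1) = f (U x)"
    by (rule relative_liftingE[of 0 undefined "\<lambda>_. y"]) (use assms in auto)
  have "continuous_map (top_of_set {0..1}) Y (\<lambda>t. H (\<lambda>_. 0, 1 - t))"
    by (rule continuous_map_top_of_set_compose[OF H])
      (auto simp: cube_0 intro!: continuous_on_Pair continuous_intros)
  then have "path_component_of Y (f (U (\<lambda>_. 0))) y"
    unfolding path_component_of_def pathin_def
    using H1[of "\<lambda>_. 0"] H0[of "(\<lambda>_. 0, 0)"]
    by (intro exI[of _ "\<lambda>t. H (\<lambda>_. 0, 1 - t)"]) (auto simp: cube_0 cube_cup_def)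
  moreover have "U (\<lambda>_. 0) \<in> topspace E"
    using U by (auto simp: continuous_map_def cube_0)
  ultimately show ?thesis by blast
qed

text \<open>The pullback of \<open>g\<close> to the cube sends the boundary to \<open>f x\<close>,
  so it can be lifted relative to the constant \<open>x\<close> there, with a stationary prescribed
  homotopy. Lift and homotopy are then constant on the boundary and descend to the sphere.\<close>

lemma relative_lifting_sphere_surj:
  assumes x: "x \<in> topspace E" and g: "continuous_map (nsphere n) Y g" "g sphere_base = f x"
  shows "\<exists>a. continuous_map (nsphere n) E a \<and> a sphere_base = x \<and>
            homotopic_with (\<lambda>h. h sphere_base = f x) (nsphere n) Y (f \<circ> a) g"
proof -
  have h: "continuous_map (top_of_set (cube_cup n)) Y (\<lambda>z. g (sphere_quotient n (fst z)))"
    using cube_boundary_subset[of n] sphere_quotient_in_usphere[OF cube_in_pointed_cube]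
    by (intro continuous_map_top_of_set_compose[OF g(1)[unfolded nsphere_eq_usphere]]
         continuous_on_compose2[OF continuous_on_sphere_quotient_cube] continuous_on_fst continuous_on_id)
       (auto simp: cube_cup_def)
  obtain U H where U: "continuous_map (top_of_set (cube n)) E U"
    and H: "continuous_map (top_of_set (cube n \<times> {0..1})) Y H"
    and U0: "\<And>z. z \<in> cube_boundary n \<Longrightarrow> U z = x"
    and H0: "\<And>z. z \<in> cube_cup n \<Longrightarrow> H z = g (sphere_quotient n (fst z))"
    and H1: "\<And>x. x \<in> cube n \<Longrightarrow> H (x, 1) = f (U x)"
    by (rule relative_liftingE[OF _ h, of "\<lambda>_. x"]) (use x g in \<open>auto simp: sphere_quotient_boundary\<close>)
  have "continuous_map (top_of_set (cube n \<times> {0..1})) E (\<lambda>z. U (fst z))"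
    by (intro continuous_map_top_of_set_compose[OF U] continuous_on_fst continuous_on_id) auto
  then obtain A :: "(nat \<Rightarrow> real) \<times> real \<Rightarrow> 'e"
  where A: "continuous_map (top_of_set (usphere n \<times> {0..1})) E A"
    and Aq: "\<And>x t. x \<in> cube n \<Longrightarrow> t \<in> {0..1} \<Longrightarrow> A (sphere_quotient n x, t) = U x"
    and A0: "\<And>t. t \<in> {0..1} \<Longrightarrow> A (sphere_base, t) = x"
    by (rule sphere_quotient_lift[of n E "\<lambda>z. U (fst z)" x]) (use x U0 in auto)
  have "f x \<in> topspace Y" using f x by (auto simp: continuous_map_def)
  moreover have "H (z, t) = f x" if "z \<in> cube_boundary n" "t \<in> {0..1}" for z t
    using H0[of "(z, t)"] that g(2) by (auto simp: cube_cup_def sphere_quotient_boundary)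
  ultimately obtain G :: "(nat \<Rightarrow> real) \<times> real \<Rightarrow> 'y" where G: "continuous_map (top_of_set (usphere n \<times> {0..1})) Y G"
    and Gq: "\<And>x t. x \<in> cube n \<Longrightarrow> t \<in> {0..1} \<Longrightarrow> G (sphere_quotient n x, t) = H (x, t)"
    and G0: "\<And>t. t \<in> {0..1} \<Longrightarrow> G (sphere_base, t) = f x"
    by (rule sphere_quotient_lift[OF H, of "f x"]) auto
  define a where "a y = A (y, 0)" for y
  have "continuous_map (nsphere n) E a"
    unfolding a_def nsphere_eq_usphere
    by (intro continuous_map_top_of_set_compose[OF A] continuous_on_basics) auto
  moreover have "a sphere_base = x" using A0 by (simp add: a_def)
  moreover have "homotopic_with (\<lambda>h. h sphere_base = f x) (nsphere n) Y g (f \<circ> a)"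
  proof (rule nsphere_homotopyI[OF G])
    fix y assume "y \<in> usphere n"
    then show "G (y, 0) = g y" "G (y, 1) = (f \<circ> a) y"
      by (cases rule: usphere_eq_or_base; use G0 Gq H0 H1 A0 Aq g(2) in \<open>simp add: a_def cube_cup_def\<close>)+
  qed (use G0 in auto)
  ultimately show ?thesis by (metis homotopic_with_symD)
qed

text \<open>The cube of dimension \<open>Suc n\<close> is the cylinder over the
  \<open>n\<close>-cube, its last coordinate being time. The homotopy between
  \<open>f \<circ> a\<close> and \<open>f \<circ> b\<close> is a map on it whose boundary lifts
  through \<open>a\<close>, \<open>b\<close> and the constant \<open>x\<close>; a filler of this
  boundary is the homotopy sought.\<close>

lemma relative_lifting_sphere_inj:
  assumes x: "x \<in> topspace E"
    and a: "continuous_map (nsphere n) E a" "a sphere_base = x"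
    and b: "continuous_map (nsphere n) E b" "b sphere_base = x"
    and ab: "homotopic_with (\<lambda>h. h sphere_base = f x) (nsphere n) Y (f \<circ> a) (f \<circ> b)"
  shows "homotopic_with (\<lambda>h. h sphere_base = x) (nsphere n) E a b"
proof -
  obtain G :: "(nat \<Rightarrow> real) \<times> real \<Rightarrow> 'y" where G: "continuous_map (top_of_set (usphere n \<times> {0..1})) Y G"
    and Ga: "\<And>x. G (x, 0) = f (a x)" and Gb: "\<And>x. G (x, 1) = f (b x)"
    and G0: "\<And>t. t \<in> {0..1} \<Longrightarrow> G (sphere_base, t) = f x"
    by (rule nsphere_homotopyE[OF ab]) auto
  define r where "r z = (\<lambda>i. if i < n then z i else 0)" for z :: "nat \<Rightarrow> real"
  have supr: "supn n (r z) = supn n z" for z by (rule supn_cong) (simp add: r_def)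
  have r_cube: "r z \<in> cube n" if "z \<in> cube (Suc n)" for z
    using that supr by (auto simp: cube_def r_def)
  have r_bd: "r z \<in> cube_boundary n" if "supn n z = 1" for z
    using that supr by (auto simp: cube_boundary_def r_def)
  have cr: "continuous_on S r" for S
  proof (rule continuous_on_coordinatewise_then_product)
    show "continuous_on S (\<lambda>z. r z i)" for i
      unfolding r_def by (cases "i < n") (simp_all add: continuous_on_coordinate)
  qed
  define q where "q z = sphere_quotient n (r z)" for z
  have cq: "continuous_on (cube (Suc n)) q"
    unfolding q_def
    by (intro continuous_on_compose2[OF continuous_on_sphere_quotient_cube cr]) (use r_cube in auto)
  have q_in: "q z \<in> usphere n" if "z \<in> cube (Suc n)" for z
    unfolding q_def using r_cube[OF that] by (intro sphere_quotient_in_usphere cube_in_pointed_cube)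
  have q_base: "q z = sphere_base" if "supn n z = 1" for z
    unfolding q_def using r_bd[OF that] by (rule sphere_quotient_boundary)
  \<comment> \<open>The two end faces carry \<open>a\<close> and \<open>b\<close>, the lateral faces
    the constant \<open>x\<close>. Where they meet, \<open>q z\<close> is the base point, so the
    pieces agree.\<close>
  define u where "u z = (if z n = -1 then a (q z) else if z n = 1 then b (q z) else x)" for z
  define S where "S = cube_boundary (Suc n)"
  have clS: "closed S" by (simp add: S_def closed_cube_boundary)
  have S_cube: "S \<subseteq> cube (Suc n)" by (simp add: S_def cube_boundary_subset)
  have cS: "closed (S \<inter> {z. z n = c})" for c
    by (intro closed_Int clS closed_Collect_eq continuous_on_coordinate continuous_on_const)
  have "continuous_map (top_of_set (S \<inter> {z. z n = -1})) E u"
  proof (rule continuous_map_top_of_set_cong)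
    show "continuous_map (top_of_set (S \<inter> {z. z n = -1})) E (\<lambda>z. a (q z))"
      using a(1)[unfolded nsphere_eq_usphere]
      by (rule continuous_map_top_of_set_compose) (use S_cube q_in in \<open>auto intro: continuous_on_subset[OF cq]\<close>)
  qed (auto simp: u_def)
  moreover have "continuous_map (top_of_set (S \<inter> {z. z n = 1})) E u"
  proof (rule continuous_map_top_of_set_cong)
    show "continuous_map (top_of_set (S \<inter> {z. z n = 1})) E (\<lambda>z. b (q z))"
      using b(1)[unfolded nsphere_eq_usphere]
      by (rule continuous_map_top_of_set_compose) (use S_cube q_in in \<open>auto intro: continuous_on_subset[OF cq]\<close>)
  qed (auto simp: u_def)
  moreover have "continuous_map (top_of_set (S \<inter> {z. supn n z = 1})) E u"
  proof (rule continuous_map_top_of_set_cong)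
    show "continuous_map (top_of_set (S \<inter> {z. supn n z = 1})) E (\<lambda>z. x)"
      using x by simp
  qed (use a b q_base in \<open>auto simp: u_def\<close>)
  moreover have "closed (S \<inter> {z. supn n z = 1})"
    by (intro closed_Int clS closed_Collect_eq continuous_on_basics)
  ultimately have "continuous_map (top_of_set (S \<inter> {z. z n = -1} \<union> (S \<inter> {z. z n = 1} \<union> S \<inter> {z. supn n z = 1}))) E u"
    using cS by (intro continuous_map_top_of_set_closed_cases closed_Un) auto
  moreover have S_cases: "z n = -1 \<or> z n = 1 \<or> supn n z = 1" if "z \<in> S" for z
    using that by (auto simp: S_def cube_boundary_def max_def split: if_splits)
  then have "S \<inter> {z. z n = -1} \<union> (S \<inter> {z. z n = 1} \<union> S \<inter> {z. supn n z = 1}) = S" by auto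
  ultimately have u: "continuous_map (top_of_set S) E u" by simp
  have zn: "(z n + 1) / 2 \<in> {0..1}" if "z \<in> cube (Suc n)" for z
    using that abs_le_supn[of n "Suc n" z] by (auto simp: cube_def simp del: supn.simps)
  \<comment> \<open>The last coordinate ranges from -1 to 1, hence the rescaling to a time in the
    unit interval. The homotopy prescribed on the cup is stationary.\<close>
  have h: "continuous_map (top_of_set (cube_cup (Suc n))) Y (\<lambda>z. G (q (fst z), (fst z n + 1) / 2))"
  proof (intro continuous_map_top_of_set_compose[OF G] continuous_on_basics continuous_on_compose2[OF cq])
    show "continuous_on (cube_cup (Suc n)) (\<lambda>x. (fst x n + 1) / 2)"
      by (intro continuous_on_divide continuous_on_add continuous_on_const continuous_on_coordinate) auto
    show "(q (fst z), (fst z n + 1) / 2) \<in> usphere n \<times> {0..1}" if "z \<in> cube_cup (Suc n)" for z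
    proof -
      have "fst z \<in> cube (Suc n)" using that cube_boundary_subset[of "Suc n"] by (auto simp: cube_cup_def)
      then show ?thesis using q_in zn by blast
    qed
  qed (use cube_boundary_subset[of "Suc n"] in \<open>auto simp: cube_cup_def\<close>)
  have hu: "G (q z, (z n + 1) / 2) = f (u z)" if "z \<in> S" for z
    using S_cases[OF that] zn[of z] q_base[of z] that S_cube Ga Gb G0 a(2) b(2)
    by (auto simp: u_def)
  obtain U where U: "continuous_map (top_of_set (cube (Suc n))) E U"
    and Uu: "\<And>z. z \<in> S \<Longrightarrow> U z = u z"
    by (rule relative_liftingE[OF u[unfolded S_def] h]) (use hu in \<open>auto simp: S_def\<close>)
  define F :: "(nat \<Rightarrow> real) \<times> real \<Rightarrow> 'e" where "F w = U ((fst w)(n := 2 * snd w - 1))" for w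
  have upd_in: "y(n := 2 * t - 1) \<in> cube (Suc n)" "supn n (y(n := 2 * t - 1)) = supn n y"
    "r (y(n := 2 * t - 1)) = y" if "y \<in> cube n" "t \<in> {0..1}" for y and t :: real
  proof -
    show *: "supn n (y(n := 2 * t - 1)) = supn n y" by (rule supn_cong) auto
    show "y(n := 2 * t - 1) \<in> cube (Suc n)"
      using that * by (auto simp: cube_def)
    show "r (y(n := 2 * t - 1)) = y" using that by (auto simp: r_def cube_def)
  qed
  have F: "continuous_map (top_of_set (cube n \<times> {0..1})) E F"
    unfolding F_def
  proof (rule continuous_map_top_of_set_compose[OF U])
    have "continuous_on X (\<lambda>w. ((fst w)(n := 2 * snd w - 1)) i)" for X :: "((nat \<Rightarrow> real) \<times> real) set" and i
      by (cases "i = n") (auto intro!: continuous_intros continuous_on_coordinate)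
    then show "continuous_on (cube n \<times> {0..1}) (\<lambda>w. (fst w)(n := 2 * snd w - 1))"
      by (rule continuous_on_coordinatewise_then_product)
  qed (use upd_in in auto)
  have bdS: "y(n := 2 * t - 1) \<in> S" if "y \<in> cube_boundary n" "t \<in> {0..1}" for y t
  proof -
    have "y \<in> cube n" "supn n y = 1" using that by (auto simp: cube_def cube_boundary_def)
    with upd_in[of y t] that have "supn n (y(n := 2 * t - 1)) = 1" "y(n := 2 * t - 1) \<in> cube (Suc n)" by auto
    then show ?thesis by (auto simp: S_def cube_def cube_boundary_def)
  qed
  have "F (y, t) = x" if "y \<in> cube_boundary n" "t \<in> {0..1}" for y t
  proof -
    have "q (y(n := 2 * t - 1)) = sphere_base"
      using upd_in[of y t] that cube_boundary_subset[of n] by (intro q_base) (auto simp: cube_boundary_def)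
    then have "u (y(n := 2 * t - 1)) = x" unfolding u_def using a(2) b(2) by metis
    then show ?thesis using Uu[OF bdS[OF that]] by (simp add: F_def)
  qed
  then obtain A :: "(nat \<Rightarrow> real) \<times> real \<Rightarrow> 'e"
  where A: "continuous_map (top_of_set (usphere n \<times> {0..1})) E A"
    and Aq: "\<And>y t. y \<in> cube n \<Longrightarrow> t \<in> {0..1} \<Longrightarrow> A (sphere_quotient n y, t) = F (y, t)"
    and A0: "\<And>t. t \<in> {0..1} \<Longrightarrow> A (sphere_base, t) = x"
    by (rule sphere_quotient_lift[OF F x]) auto
  show ?thesis
  proof (rule nsphere_homotopyI[OF A])
    fix y assume "y \<in> usphere n"
    then show "A (y, 0) = a y"
    proof (cases rule: usphere_eq_or_base)
      case (2 z)
      have zS: "z(n := -1) \<in> S" using upd_in[of z 0] 2 by (auto simp: S_def cube_def cube_boundary_def)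
      have "F (z, 0) = a (sphere_quotient n z)"
        using Uu[OF zS] upd_in[of z 0] 2 by (simp add: F_def u_def q_def)
      then show ?thesis using Aq[of z 0] 2 by simp
    qed (use A0 a in simp)
    from \<open>y \<in> usphere n\<close> show "A (y, 1) = b y"
    proof (cases rule: usphere_eq_or_base)
      case (2 z)
      have zS: "z(n := 1) \<in> S" using upd_in[of z 1] 2 by (auto simp: S_def cube_def cube_boundary_def)
      have "F (z, 1) = b (sphere_quotient n z)"
        using Uu[OF zS] upd_in[of z 1] 2 by (simp add: F_def u_def q_def)
      then show ?thesis using Aq[of z 1] 2 by simp
    qed (use A0 b in simp)
  qed (use A0 in auto)
qed

lemma relative_lifting_imp_weak_homotopy_equivalence: "weak_homotopy_equivalence E Y f"
  unfolding weak_homotopy_equivalence_def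
proof (intro conjI ballI allI impI; (elim conjE)?)
qed (fact f relative_lifting_path_component relative_lifting_sphere_surj relative_lifting_sphere_inj)+

end


text \<open>Central projection from the point at height 2 above the centre of the cube.\<close>

definition cup_retraction :: "nat \<Rightarrow> (nat \<Rightarrow> real) \<times> real \<Rightarrow> (nat \<Rightarrow> real) \<times> real" where
  "cup_retraction n z =
     ((\<lambda>i. (1 / max (supn n (fst z)) (1 - snd z / 2)) * fst z i),
      2 - (2 - snd z) / max (supn n (fst z)) (1 - snd z / 2))"

lemma continuous_on_cup_retraction: "continuous_on (cube n \<times> {0..1}) (cup_retraction n)"
proof -
  have "max a (1 - t / 2) \<noteq> 0" if "t \<in> {0..1}" for a t :: real
    using that by (auto simp: max_def)
  then show ?thesis
    unfolding cup_retraction_def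
    by (intro continuous_on_basics continuous_on_coordinatewise_then_product continuous_on_divide
          continuous_on_coordinate) auto
qed

lemma cup_retraction_in:
  assumes "z \<in> cube n \<times> {0..1}"
  shows "cup_retraction n z \<in> cube_cup n"
proof -
  obtain x t where z: "z = (x, t)" "x \<in> cube n" "0 \<le> t" "t \<le> 1" using assms by auto
  show ?thesis
  proof (cases "supn n x \<le> 1 - t / 2")
    case True
    have "(\<lambda>i. (1 / (1 - t / 2)) * x i) \<in> cube n"
      using True z by (intro scale_in_cube) (auto simp: field_simps)
    moreover have "2 - (2 - t) / (1 - t / 2) = 0" using z by (simp add: field_simps)
    ultimately show ?thesis using True z by (simp add: cup_retraction_def cube_cup_def max_def)
  next
    case False
    then have pos: "supn n x > 0" using z by linarith
    have "(\<lambda>i. (1 / supn n x) * x i) \<in> cube_boundary n"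
      using pos z by (intro scale_in_cube_boundary) auto
    moreover have "supn n x \<le> 1" using z by (simp add: cube_def)
    then have "2 - (2 - t) / supn n x \<in> {0..1}"
      using False pos z by (auto simp: field_simps)
    ultimately show ?thesis using False z by (simp add: cup_retraction_def cube_cup_def max_def)
  qed
qed

lemma cup_retraction_bottom: "x \<in> cube n \<Longrightarrow> cup_retraction n (x, 0) = (x, 0)"
  by (simp add: cup_retraction_def cube_def max_def)

lemma cup_retraction_side: "x \<in> cube_boundary n \<Longrightarrow> t \<in> {0..1} \<Longrightarrow> cup_retraction n (x, t) = (x, t)"
  by (cases "t = 0") (auto simp: cup_retraction_def cube_boundary_def max_def)

section \<open>The round sphere as the boundary of a cube\<close>

lemma sphere_base_in_cube_boundary: "sphere_base \<in> cube_boundary (Suc k)"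
proof -
  have "supn (Suc k) sphere_base = 1"
  proof (rule antisym)
    show "supn (Suc k) sphere_base \<le> 1"
      by (subst supn_le_iff) (auto simp: sphere_base_def)
    show "1 \<le> supn (Suc k) sphere_base"
      using abs_le_supn[of 0 "Suc k" sphere_base] by (simp add: sphere_base_def del: supn.simps)
  qed
  then show ?thesis by (simp add: cube_boundary_def sphere_base_def del: supn.simps)
qed

lemma usphere_to_cube_boundary:
  assumes "y \<in> usphere k"
  shows "supn (Suc k) y > 0" "(\<lambda>i. y i / supn (Suc k) y) \<in> cube_boundary (Suc k)"
proof -
  obtain i where i: "i \<le> k" "y i \<noteq> 0" using usphere_nonzero[OF assms] by blast
  then show pos: "supn (Suc k) y > 0"
    using abs_le_supn[of i "Suc k" y] by (auto simp del: supn.simps)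
  then show "(\<lambda>i. y i / supn (Suc k) y) \<in> cube_boundary (Suc k)"
    using supn_scale[of "Suc k" "1 / supn (Suc k) y" y] assms
    by (auto simp: cube_boundary_def usphere_def simp del: supn.simps)
qed

lemma cube_boundary_to_usphere:
  assumes "x \<in> cube_boundary (Suc k)"
  shows "norm2 k x > 0" "(\<lambda>i. x i / norm2 k x) \<in> usphere k"
proof -
  have "supn (Suc k) x = 1" using assms by (simp add: cube_boundary_def)
  then obtain i where "i < Suc k" "\<bar>x i\<bar> = 1" using supn_attained[of "Suc k" x] by auto
  then have "i \<le> k" "x i \<noteq> 0" by auto
  then show pos: "norm2 k x > 0" by (rule norm2_pos)
  then show "(\<lambda>i. x i / norm2 k x) \<in> usphere k"
    using assms by (intro normalize_in_usphere) (auto simp: cube_boundary_def)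
qed

lemma cube_boundary_usphere_inverse:
  assumes "x \<in> cube_boundary (Suc k)"
  shows "(\<lambda>i. (x i / norm2 k x) / supn (Suc k) (\<lambda>i. x i / norm2 k x)) = x"
  using supn_scale[of "Suc k" "1 / norm2 k x" x] cube_boundary_to_usphere(1)[OF assms] assms
  by (auto simp: cube_boundary_def simp del: supn.simps)

lemma segment_in_cube:
  assumes "x \<in> cube n" "y \<in> cube n" "t \<in> {0..1}"
  shows "(\<lambda>i. (1 - t) * x i + t * y i) \<in> cube n"
proof -
  have "\<bar>(1 - t) * x i + t * y i\<bar> \<le> 1" if "i < n" for i
  proof -
    have "\<bar>x i\<bar> \<le> 1" "\<bar>y i\<bar> \<le> 1"
      using assms abs_le_supn[OF that, of x] abs_le_supn[OF that, of y] by (auto simp: cube_def)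
    then have "(1 - t) * \<bar>x i\<bar> + t * \<bar>y i\<bar> \<le> (1 - t) * 1 + t * 1"
      using assms(3) by (intro add_mono mult_left_mono) auto
    moreover have "\<bar>(1 - t) * x i + t * y i\<bar> \<le> (1 - t) * \<bar>x i\<bar> + t * \<bar>y i\<bar>"
      using assms(3) abs_triangle_ineq[of "(1 - t) * x i" "t * y i"] by (simp add: abs_mult)
    ultimately show ?thesis by simp
  qed
  then show ?thesis using assms(1,2) by (auto simp: cube_def supn_le_iff)
qed

lemma weak_homotopy_equivalenceD:
  assumes "weak_homotopy_equivalence E Y f"
  shows "continuous_map E Y f"
    and "y \<in> topspace Y \<Longrightarrow> \<exists>x\<in>topspace E. path_component_of Y (f x) y"
    and "x \<in> topspace E \<Longrightarrow> continuous_map (nsphere n) Y g \<Longrightarrow> g sphere_base = f x \<Longrightarrow>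
      \<exists>a. continuous_map (nsphere n) E a \<and> a sphere_base = x \<and>
          homotopic_with (\<lambda>h. h sphere_base = f x) (nsphere n) Y (f \<circ> a) g"
    and "x \<in> topspace E \<Longrightarrow> continuous_map (nsphere n) E a \<Longrightarrow> a sphere_base = x \<Longrightarrow>
      continuous_map (nsphere n) E b \<Longrightarrow> b sphere_base = x \<Longrightarrow>
      homotopic_with (\<lambda>h. h sphere_base = f x) (nsphere n) Y (f \<circ> a) (f \<circ> b) \<Longrightarrow>
      homotopic_with (\<lambda>h. h sphere_base = x) (nsphere n) E a b"
  using assms[unfolded weak_homotopy_equivalence_def] by simp_all

text \<open>Injectivity on homotopy groups makes the boundary map constant; the map on the cube then
  factors through the sphere, where surjectivity applies.\<close>

lemma weak_homotopy_equivalence_imp_deformation_lifting: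
  fixes E :: "'e topology" and Y :: "'y topology"
  assumes whe: "weak_homotopy_equivalence E Y f"
  shows "deformation_lifting E Y f"
  unfolding deformation_lifting_def
proof (intro allI impI, elim conjE, goal_cases)
  case (1 n u v)
  note u = 1(1) and v = 1(2) and vu = 1(3)
  have f: "continuous_map E Y f" using whe by (rule weak_homotopy_equivalenceD(1))
  show ?case
  proof (cases n)
    \<comment> \<open>Over the 0-cube a square is just a point of \<open>Y\<close>, and a path from
      it to the image of \<open>f\<close> is a deformation. It is run backwards because
      \<open>p\<close> starts in that image.\<close>
    case 0
    have "v (\<lambda>_. 0) \<in> topspace Y" using v 0 by (auto simp: continuous_map_def cube_0)
    then obtain x and p :: "real \<Rightarrow> 'y" where x: "x \<in> topspace E" and p: "continuous_map (top_of_set {0..1}) Y p"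
      and p01: "p 0 = f x" "p 1 = v (\<lambda>_. 0)"
      using weak_homotopy_equivalenceD(2)[OF whe] unfolding path_component_of_def pathin_def by blast
    have "continuous_map (top_of_set (cube n \<times> {0..1})) Y (\<lambda>z. p (1 - snd z))"
      by (rule continuous_map_top_of_set_compose[OF p])
        (auto intro!: continuous_on_diff continuous_on_snd continuous_on_id continuous_on_const)
    then show ?thesis
      using x p01 0 by (intro exI[of _ "\<lambda>_. x"] exI[of _ "\<lambda>z. p (1 - snd z)"])
        (auto simp: cube_0 cube_cap_def)
  next
    case (Suc k)
    define x0 where "x0 = u sphere_base"
    have base: "sphere_base \<in> cube_boundary n" using sphere_base_in_cube_boundary Suc by simp
    then have x0: "x0 \<in> topspace E" using u by (auto simp: continuous_map_def x0_def)
    then have fx0: "f x0 \<in> topspace Y" using f by (auto simp: continuous_map_def)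
    define \<theta> where "\<theta> y = (\<lambda>i. y i / supn n y)" for y
    have \<theta>_in: "\<theta> y \<in> cube_boundary n" if "y \<in> usphere k" for y
      using usphere_to_cube_boundary[OF that] Suc by (simp add: \<theta>_def)
    have \<theta>_base: "\<theta> sphere_base = sphere_base" using base by (simp add: \<theta>_def cube_boundary_def)
    have c\<theta>: "continuous_on (usphere k) \<theta>"
      unfolding \<theta>_def using usphere_to_cube_boundary(1) Suc
      by (intro continuous_on_coordinatewise_then_product continuous_on_divide continuous_on_supn
          continuous_on_id continuous_on_coordinate) fastforce
    have a: "continuous_map (nsphere k) E (\<lambda>y. u (\<theta> y))"
      unfolding nsphere_eq_usphere
      by (intro continuous_map_top_of_set_compose[OF u c\<theta>] \<theta>_in)
    \<comment> \<open>The cube is convex: moving boundary points along straight segments to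
      \<open>sphere_base\<close> and applying \<open>v\<close> gives a null homotopy that fixes the
      base point.\<close>
    have null: "homotopic_with (\<lambda>h. h sphere_base = f x0) (nsphere k) Y (f \<circ> (\<lambda>y. u (\<theta> y))) (f \<circ> (\<lambda>_. x0))"
    proof (rule nsphere_homotopyI)
      show "continuous_map (top_of_set (usphere k \<times> {0..1})) Y
        (\<lambda>z. v (\<lambda>i. (1 - snd z) * \<theta> (fst z) i + snd z * sphere_base i))"
      proof (rule continuous_map_top_of_set_compose[OF v])
        have "continuous_on (usphere k \<times> {0..1::real}) (\<lambda>z. \<theta> (fst z))"
          by (rule continuous_on_compose2[OF c\<theta>]) (auto intro: continuous_on_fst continuous_on_id)
        then show "continuous_on (usphere k \<times> {0..1})
          (\<lambda>z i. (1 - snd z) * \<theta> (fst z) i + snd z * sphere_base i)"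
          by (intro continuous_on_coordinatewise_then_product continuous_on_basics)
            (rule continuous_on_apply)
        show "(\<lambda>i. (1 - snd z) * \<theta> (fst z) i + snd z * sphere_base i) \<in> cube n"
          if "z \<in> usphere k \<times> {0..1}" for z
        proof (rule segment_in_cube)
          show "\<theta> (fst z) \<in> cube n" "sphere_base \<in> cube n"
            using \<theta>_in[of "fst z"] base that cube_boundary_subset[of n] by auto
        qed (use that in auto)
      qed
    next
      fix y assume "y \<in> usphere k"
      then show "v (\<lambda>i. (1 - snd (y, 0)) * \<theta> (fst (y, 0)) i + snd (y, 0) * sphere_base i) = (f \<circ> (\<lambda>y. u (\<theta> y))) y"
        using vu \<theta>_in by simp
      show "v (\<lambda>i. (1 - snd (y, 1)) * \<theta> (fst (y, 1)) i + snd (y, 1) * sphere_base i) = (f \<circ> (\<lambda>_. x0)) y"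
        using vu base by (simp add: x0_def)
    next
      fix t :: real
      have "(\<lambda>i. (1 - t) * sphere_base i + t * sphere_base i) = sphere_base"
        by (auto simp: algebra_simps)
      then show "v (\<lambda>i. (1 - snd (sphere_base, t)) * \<theta> (fst (sphere_base, t)) i + snd (sphere_base, t) * sphere_base i) = f x0"
        using vu base \<theta>_base by (simp add: x0_def)
    qed
    have "homotopic_with (\<lambda>h. h sphere_base = x0) (nsphere k) E (\<lambda>y. u (\<theta> y)) (\<lambda>_. x0)"
      by (rule weak_homotopy_equivalenceD(4)[OF whe x0 a _ _ _ null]) (use x0 \<theta>_base in \<open>auto simp: x0_def\<close>)
    then obtain k0 :: "(nat \<Rightarrow> real) \<times> real \<Rightarrow> 'e"
      where k0: "continuous_map (top_of_set (usphere k \<times> {0..1})) E k0"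
        and k00: "\<And>y. k0 (y, 0) = u (\<theta> y)" and k01: "\<And>y. k0 (y, 1) = x0"
      by (rule nsphere_homotopyE) auto
    \<comment> \<open>The null homotopy in \<open>E\<close>, moved from the round sphere back to the
      boundary of the cube.\<close>
    define kk where "kk z = k0 ((\<lambda>i. fst z i / norm2 k (fst z)), snd z)" for z :: "(nat \<Rightarrow> real) \<times> real"
    have kk: "continuous_map (top_of_set (cube_boundary n \<times> {0..1})) E kk"
      unfolding kk_def
    proof (rule continuous_map_top_of_set_compose[OF k0])
      have nz: "\<forall>z\<in>cube_boundary n \<times> {0..1::real}. norm2 k (fst z) \<noteq> 0"
        using cube_boundary_to_usphere(1)[of _ k] Suc by force
      show "continuous_on (cube_boundary n \<times> {0..1::real}) (\<lambda>z. (\<lambda>i. fst z i / norm2 k (fst z), snd z))"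
        by (intro continuous_on_basics continuous_on_coordinatewise_then_product
              continuous_on_divide continuous_on_norm2 continuous_on_coordinate nz)
    qed (use cube_boundary_to_usphere(2)[of _ k] Suc in auto)
    have kk0: "kk (x, 0) = u x" if "x \<in> cube_boundary n" for x
      using cube_boundary_usphere_inverse[of x k] that Suc by (simp add: kk_def k00 \<theta>_def del: supn.simps)
    have kk1: "kk (x, 1) = x0" for x by (simp add: kk_def k01)
    define w where "w z = (if z \<in> cube n \<times> {0} then v (fst z) else f (kk z))" for z
    have w_side: "w (x, t) = f (kk (x, t))" if "x \<in> cube_boundary n" for x t
      using that kk0 vu by (auto simp: w_def)
    have w: "continuous_map (top_of_set (cube_cup n)) Y w"
      unfolding w_def cube_cup_def
    proof (rule continuous_map_top_of_set_Un)
      show "continuous_map (top_of_set (cube n \<times> {0})) Y (\<lambda>x. v (fst x))"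
        by (intro continuous_map_top_of_set_compose[OF v] continuous_on_fst continuous_on_id) auto
      show "continuous_map (top_of_set (cube_boundary n \<times> {0..1})) Y (\<lambda>z. f (kk z))"
        using continuous_map_compose[OF kk f] by (simp add: o_def)
    qed (use kk0 vu in \<open>auto intro!: closed_Times closed_cube closed_cube_boundary\<close>)
    \<comment> \<open>Homotopy extension: \<open>v\<close> on the bottom and
      \<open>f \<circ> kk\<close> on the sides extend over the cylinder by the retraction. At time 1
      the boundary goes to \<open>f x0\<close>, so that slice factors through the sphere.\<close>
    define H1 where "H1 z = w (cup_retraction n z)" for z
    have H1: "continuous_map (top_of_set (cube n \<times> {0..1})) Y H1"
      unfolding H1_def
      by (rule continuous_map_top_of_set_compose[OF w continuous_on_cup_retraction cup_retraction_in])
    have H1_bottom: "H1 (x, 0) = v x" if "x \<in> cube n" for x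
      using that by (simp add: H1_def cup_retraction_bottom w_def)
    have H1_side: "H1 (x, t) = f (kk (x, t))" if "x \<in> cube_boundary n" "t \<in> {0..1}" for x t
      using that by (simp add: H1_def cup_retraction_side w_side)
    have "continuous_map (top_of_set (cube n \<times> {0..1})) Y (\<lambda>z. H1 (fst z, 1))"
      by (intro continuous_map_top_of_set_compose[OF H1] continuous_on_basics) auto
    then obtain G :: "(nat \<Rightarrow> real) \<times> real \<Rightarrow> 'y"
      where G: "continuous_map (top_of_set (usphere n \<times> {0..1})) Y G"
        and Gq: "\<And>x t. x \<in> cube n \<Longrightarrow> t \<in> {0..1} \<Longrightarrow> G (sphere_quotient n x, t) = H1 (x, 1)"
        and G0: "\<And>t. t \<in> {0..1} \<Longrightarrow> G (sphere_base, t) = f x0"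
      by (rule sphere_quotient_lift[of n Y "\<lambda>z. H1 (fst z, 1)" "f x0"]) (use fx0 H1_side kk1 in auto)
    define g where "g y = G (y, 0)" for y
    have g: "continuous_map (nsphere n) Y g" "g sphere_base = f x0"
      unfolding g_def nsphere_eq_usphere
      by (intro continuous_map_top_of_set_compose[OF G] continuous_on_basics)
        (use G0 in auto)
    obtain a where a: "continuous_map (nsphere n) E a" "a sphere_base = x0"
      and hom: "homotopic_with (\<lambda>h. h sphere_base = f x0) (nsphere n) Y (f \<circ> a) g"
      using weak_homotopy_equivalenceD(3)[OF whe x0 g] by blast
    obtain h2 :: "(nat \<Rightarrow> real) \<times> real \<Rightarrow> 'y"
      where h2: "continuous_map (top_of_set (usphere n \<times> {0..1})) Y h2"
        and h20: "\<And>y. h2 (y, 0) = f (a y)" and h21: "\<And>y. h2 (y, 1) = g y"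
        and h2b: "\<And>t. t \<in> {0..1} \<Longrightarrow> h2 (sphere_base, t) = f x0"
      by (rule nsphere_homotopyE[OF hom]) auto
    \<comment> \<open>Two stages of equal length. During the first, \<open>H1\<close> runs at double
      speed and \<open>kk\<close> covers it on the sides. During the second, \<open>kk\<close> rests
      at \<open>x0\<close> while the homotopy from \<open>f \<circ> a\<close> to \<open>g\<close> is
      run backwards, so that in the end the top is covered by \<open>a\<close>.\<close>
    define K where "K z = (if z \<in> cube n \<times> {1} then a (sphere_quotient n (fst z))
       else kk (fst z, min 1 (2 * snd z)))" for z
    have K_side: "K (x, t) = kk (x, min 1 (2 * t))" if "x \<in> cube_boundary n" for x t
      using that a(2) kk1 by (auto simp: K_def sphere_quotient_boundary)
    have "continuous_map (top_of_set (cube_cap n)) E K"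
      unfolding K_def cube_cap_def
    proof (rule continuous_map_top_of_set_Un)
      show "continuous_map (top_of_set (cube n \<times> {1})) E (\<lambda>z. a (sphere_quotient n (fst z)))"
        using sphere_quotient_in_usphere[OF cube_in_pointed_cube]
        by (intro continuous_map_top_of_set_compose[OF a(1)[unfolded nsphere_eq_usphere]]
            continuous_on_compose2[OF continuous_on_sphere_quotient_cube] continuous_on_fst continuous_on_id) auto
      show "continuous_map (top_of_set (cube_boundary n \<times> {0..1})) E (\<lambda>z. kk (fst z, min 1 (2 * snd z)))"
        by (intro continuous_map_top_of_set_compose[OF kk] continuous_on_basics) auto
    qed (use a(2) kk1 in \<open>auto intro!: closed_Times closed_cube closed_cube_boundary simp: sphere_quotient_boundary\<close>)
    moreover define H where "H z = (if z \<in> cube n \<times> {0..1/2} then H1 (fst z, 2 * snd z)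
       else h2 (sphere_quotient n (fst z), 2 - 2 * snd z))" for z
    have "continuous_map (top_of_set (cube n \<times> {0..1/2} \<union> cube n \<times> {1/2..1})) Y H"
      unfolding H_def
    proof (rule continuous_map_top_of_set_Un)
      show "continuous_map (top_of_set (cube n \<times> {0..1/2})) Y (\<lambda>z. H1 (fst z, 2 * snd z))"
        by (intro continuous_map_top_of_set_compose[OF H1] continuous_on_basics) auto
      show "continuous_map (top_of_set (cube n \<times> {1/2..1})) Y (\<lambda>z. h2 (sphere_quotient n (fst z), 2 - 2 * snd z))"
        using sphere_quotient_in_usphere[OF cube_in_pointed_cube]
        by (intro continuous_map_top_of_set_compose[OF h2] continuous_on_basics
              continuous_on_compose2[OF continuous_on_sphere_quotient_cube]) auto
      fix z assume "z \<in> cube n \<times> {0..1/2}" "z \<in> cube n \<times> {1/2..1::real}"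
      then obtain x where "z = (x, 1/2)" "x \<in> cube n" by (cases z) auto
      then show "H1 (fst z, 2 * snd z) = h2 (sphere_quotient n (fst z), 2 - 2 * snd z)"
        using Gq[of x 0] by (simp add: h21 g_def)
    qed (auto intro!: closed_Times closed_cube)
    moreover have "cube n \<times> {0..1/2} \<union> cube n \<times> {1/2..1} = cube n \<times> {0..1::real}" by force
    moreover have "H (x, 0) = v x" if "x \<in> cube n" for x
      using that H1_bottom by (simp add: H_def)
    moreover have "K (x, 0) = u x" if "x \<in> cube_boundary n" for x
      using that K_side kk0 by simp
    moreover have "H z = f (K z)" if z: "z \<in> cube_cap n" for z
    proof -
      obtain x t where xt: "z = (x, t)" by fastforce
      consider "x \<in> cube n" "t = 1" | "x \<in> cube_boundary n" "t \<in> {0..1/2}" | "x \<in> cube_boundary n" "t \<in> {1/2<..1}"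
        using z unfolding xt cube_cap_def by fastforce
      then show ?thesis
      proof cases
        case 1
        then show ?thesis by (simp add: xt H_def K_def h20)
      next
        case 2
        then have "min 1 (2 * t) = 2 * t" "2 * t \<in> {0..1}" by auto
        then show ?thesis using 2 K_side[of x t] H1_side[of x "2 * t"] cube_boundary_subset[of n]
          by (auto simp: xt H_def)
      next
        case 3
        then show ?thesis using K_side[of x t] h2b[of "2 - 2 * t"] kk1
          by (auto simp: xt H_def min_def sphere_quotient_boundary)
      qed
    qed
    ultimately show ?thesis by (intro exI[of _ K] exI[of _ H]) auto
  qed
qed

subsection \<open>Integer boxes\<close>

text \<open>Natural corners make the total edge length a natural number, available for induction.
  Directions with \<open>a i = b i\<close> are frozen, so faces and cutting walls of a box are boxes
  again.\<close>

definition ibox :: "(nat \<Rightarrow> nat) \<Rightarrow> (nat \<Rightarrow> nat) \<Rightarrow> (nat \<Rightarrow> real) set" where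
  "ibox a b = {x. \<forall>i. real (a i) \<le> x i \<and> x i \<le> real (b i)}"

text \<open>The boundary relative to the directions in which the box extends; a single vertex has
  empty boundary, like the 0-cube.\<close>

definition ibox_boundary :: "(nat \<Rightarrow> nat) \<Rightarrow> (nat \<Rightarrow> nat) \<Rightarrow> (nat \<Rightarrow> real) set" where
  "ibox_boundary a b = {x \<in> ibox a b. \<exists>i. a i < b i \<and> (x i = real (a i) \<or> x i = real (b i))}"

lemma closed_ibox: "closed (ibox a b)"
proof -
  have "closed {x. real (a i) \<le> x i \<and> x i \<le> real (b i)}" for i
    unfolding Collect_conj_eq
    by (intro closed_Int closed_Collect_le continuous_on_coordinate continuous_on_const)
  then have "closed (\<Inter>i. {x. real (a i) \<le> x i \<and> x i \<le> real (b i)})" by blast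
  moreover have "(\<Inter>i. {x. real (a i) \<le> x i \<and> x i \<le> real (b i)}) = ibox a b"
    by (auto simp: ibox_def)
  ultimately show ?thesis by simp
qed

lemma closed_ibox_boundary:
  assumes "finite {i. a i < b i}"
  shows "closed (ibox_boundary a b)"
proof -
  have "closed (ibox a b \<inter> ({x. x i = real (a i)} \<union> {x. x i = real (b i)}))" for i
    by (intro closed_Int closed_Un closed_ibox closed_Collect_eq continuous_on_coordinate continuous_on_const)
  then have "closed (\<Union>i\<in>{i. a i < b i}. ibox a b \<inter> ({x. x i = real (a i)} \<union> {x. x i = real (b i)}))"
    using assms by (intro closed_UN) auto
  moreover have "(\<Union>i\<in>{i. a i < b i}. ibox a b \<inter> ({x. x i = real (a i)} \<union> {x. x i = real (b i)})) = ibox_boundary a b"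
    by (auto simp: ibox_boundary_def)
  ultimately show ?thesis by simp
qed

lemma ibox_boundary_subset: "ibox_boundary a b \<subseteq> ibox a b"
  by (auto simp: ibox_boundary_def)

lemma ibox_subset:
  assumes "\<And>i. b i \<le> N i"
  shows "ibox a b \<subseteq> ibox (\<lambda>_. 0) N"
proof
  fix x assume "x \<in> ibox a b"
  then have x: "real (a i) \<le> x i" "x i \<le> real (b i)" for i by (auto simp: ibox_def)
  have "0 \<le> x i" "x i \<le> real (N i)" for i
    using x[of i] assms[of i] by (meson of_nat_0_le_iff order_trans of_nat_mono)+
  then show "x \<in> ibox (\<lambda>_. 0) N" by (simp add: ibox_def)
qed

text \<open>For \<open>x\<close> with nonnegative coordinates this is the smallest integer box
  around \<open>x\<close>, its carrier in the cubical subdivision. It lies in every integer box that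
  contains \<open>x\<close>, in particular in every such face of a cell.\<close>

definition carrier_box :: "(nat \<Rightarrow> real) \<Rightarrow> (nat \<Rightarrow> real) set" where
  "carrier_box x = ibox (\<lambda>i. nat \<lfloor>x i\<rfloor>) (\<lambda>i. nat \<lceil>x i\<rceil>)"

lemma carrier_box_subset:
  assumes "x \<in> ibox a b"
  shows "carrier_box x \<subseteq> ibox a b"
proof
  fix y assume y: "y \<in> carrier_box x"
  show "y \<in> ibox a b"
    unfolding ibox_def
  proof (intro CollectI allI conjI)
    fix i
    have x: "real (a i) \<le> x i" "x i \<le> real (b i)" using assms by (auto simp: ibox_def)
    then have "a i \<le> nat \<lfloor>x i\<rfloor>" "nat \<lceil>x i\<rceil> \<le> b i" by (auto simp: le_nat_floor ceiling_le_iff)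
    moreover have "real (nat \<lfloor>x i\<rfloor>) \<le> y i" "y i \<le> real (nat \<lceil>x i\<rceil>)"
      using y by (auto simp: carrier_box_def ibox_def)
    ultimately show "real (a i) \<le> y i" "y i \<le> real (b i)"
      by (meson of_nat_mono order_trans)+
  qed
qed

lemma mem_carrier_box: "x \<in> ibox a b \<Longrightarrow> x \<in> carrier_box x"
proof -
  assume x: "x \<in> ibox a b"
  have "0 \<le> x i" for i using x by (auto simp: ibox_def intro: order_trans[of 0 "real (a i)"])
  then show ?thesis by (auto simp: carrier_box_def ibox_def)
qed

text \<open>In a unit box, a point off the boundary lies strictly between consecutive integers in
  each extended direction, so rounding recovers the corners.\<close>

lemma carrier_box_eq:
  assumes "\<And>i. b i \<le> Suc (a i)" "x \<in> ibox a b" "x \<notin> ibox_boundary a b"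
  shows "carrier_box x = ibox a b"
proof -
  have "nat \<lfloor>x i\<rfloor> = a i \<and> nat \<lceil>x i\<rceil> = b i" for i
  proof -
    have x: "real (a i) \<le> x i" "x i \<le> real (b i)" using assms(2) by (auto simp: ibox_def)
    show ?thesis
    proof (cases "a i < b i")
      case True
      then have "b i = Suc (a i)" using assms(1)[of i] by simp
      moreover have "x i \<noteq> real (a i)" "x i \<noteq> real (b i)"
        using assms(2,3) True by (auto simp: ibox_boundary_def)
      ultimately have "real (a i) < x i" "x i < real (a i) + 1" using x by auto
      then have "\<lfloor>x i\<rfloor> = int (a i)" "\<lceil>x i\<rceil> = int (a i) + 1"
        by (auto simp: floor_eq_iff ceiling_eq_iff)
      then show ?thesis using \<open>b i = Suc (a i)\<close> by simp
    next
      case False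
      then have "a i = b i" using x by (meson antisym_conv3 not_le of_nat_less_iff order_trans)
      then have "x i = real (a i)" using x by simp
      then show ?thesis using \<open>a i = b i\<close> by simp
    qed
  qed
  then show ?thesis by (simp add: carrier_box_def)
qed

lemma ibox_split:
  assumes "a i < s" "s < b i"
  shows "ibox a (b(i := s)) = {x \<in> ibox a b. x i \<le> real s}"
    "ibox (a(i := s)) b = {x \<in> ibox a b. real s \<le> x i}"
    "ibox (a(i := s)) (b(i := s)) = {x \<in> ibox a b. x i = real s}"
proof -
  have s: "real (a i) \<le> real s" "real s \<le> real (b i)" using assms by auto
  have *: "x \<in> ibox a' b' \<longleftrightarrow> (real (a' i) \<le> x i \<and> x i \<le> real (b' i)) \<and>
      (\<forall>j. j \<noteq> i \<longrightarrow> real (a' j) \<le> x j \<and> x j \<le> real (b' j))" for x a' b'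
    unfolding ibox_def mem_Collect_eq by metis
  show "ibox a (b(i := s)) = {x \<in> ibox a b. x i \<le> real s}"
    "ibox (a(i := s)) b = {x \<in> ibox a b. real s \<le> x i}"
    "ibox (a(i := s)) (b(i := s)) = {x \<in> ibox a b. x i = real s}"
    using s by (auto simp: *)
qed

text \<open>The faces in directions other than \<open>i\<close> are shared by the box, both halves
  and the separating wall. Collecting them in one predicate \<open>Q\<close> reduces the later
  identities between these boundaries to case distinctions on \<open>x i\<close>.\<close>

lemma ibox_boundary_split:
  assumes s: "a i < s" "s < b i"
  defines "Q \<equiv> \<lambda>x. \<exists>j. j \<noteq> i \<and> a j < b j \<and> (x j = real (a j) \<or> x j = real (b j))"
  shows "ibox_boundary a b = {x \<in> ibox a b. Q x \<or> x i = real (a i) \<or> x i = real (b i)}"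
    "ibox_boundary a (b(i := s)) = {x \<in> ibox a b. x i \<le> real s \<and> (Q x \<or> x i = real (a i) \<or> x i = real s)}"
    "ibox_boundary (a(i := s)) b = {x \<in> ibox a b. real s \<le> x i \<and> (Q x \<or> x i = real s \<or> x i = real (b i))}"
    "ibox_boundary (a(i := s)) (b(i := s)) = {x \<in> ibox a b. x i = real s \<and> Q x}"
proof -
  have *: "(\<exists>j. a' j < b' j \<and> (x j = real (a' j) \<or> x j = real (b' j))) \<longleftrightarrow>
      (a' i < b' i \<and> (x i = real (a' i) \<or> x i = real (b' i))) \<or>
      (\<exists>j. j \<noteq> i \<and> a' j < b' j \<and> (x j = real (a' j) \<or> x j = real (b' j)))" for x a' b'
    by metis
  have Q: "(\<exists>j. j \<noteq> i \<and> (a(i := s)) j < b j \<and> (x j = real ((a(i := s)) j) \<or> x j = real (b j))) \<longleftrightarrow> Q x"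
    "(\<exists>j. j \<noteq> i \<and> a j < (b(i := s)) j \<and> (x j = real (a j) \<or> x j = real ((b(i := s)) j))) \<longleftrightarrow> Q x"
    "(\<exists>j. j \<noteq> i \<and> (a(i := s)) j < (b(i := s)) j \<and> (x j = real ((a(i := s)) j) \<or> x j = real ((b(i := s)) j))) \<longleftrightarrow> Q x"
    "(\<exists>j. j \<noteq> i \<and> a j < b j \<and> (x j = real (a j) \<or> x j = real (b j))) \<longleftrightarrow> Q x" for x
    unfolding Q_def by (auto cong: conj_cong)
  note sp = ibox_split[where a = a and b = b and i = i and s = s, OF s]
  show "ibox_boundary a b = {x \<in> ibox a b. Q x \<or> x i = real (a i) \<or> x i = real (b i)}"
    "ibox_boundary a (b(i := s)) = {x \<in> ibox a b. x i \<le> real s \<and> (Q x \<or> x i = real (a i) \<or> x i = real s)}"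
    "ibox_boundary (a(i := s)) b = {x \<in> ibox a b. real s \<le> x i \<and> (Q x \<or> x i = real s \<or> x i = real (b i))}"
    "ibox_boundary (a(i := s)) (b(i := s)) = {x \<in> ibox a b. x i = real s \<and> Q x}"
    unfolding ibox_boundary_def sp * Q using s by auto
qed

text \<open>A unit box is a cube in its extended directions, which \<open>e\<close> enumerates; the
  dimension may be 0. Lifting problems on the box are pulled back along \<open>\<theta>\<close> and
  solutions are brought back along \<open>\<theta>'\<close>; that
  \<open>\<theta> (\<theta>' x) = x\<close> restores the given data.\<close>

lemma unit_ibox_parametrization:
  assumes fin: "finite {i. a i < b i}" and le: "\<And>i. a i \<le> b i" and unit: "\<And>i. b i \<le> Suc (a i)"
  obtains k \<theta> \<theta>' where "continuous_on (cube k) \<theta>" "continuous_on (ibox a b) \<theta>'"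
    "\<And>y. y \<in> cube k \<Longrightarrow> \<theta> y \<in> ibox a b" "\<And>x. x \<in> ibox a b \<Longrightarrow> \<theta>' x \<in> cube k"
    "\<And>y. y \<in> cube_boundary k \<Longrightarrow> \<theta> y \<in> ibox_boundary a b"
    "\<And>x. x \<in> ibox_boundary a b \<Longrightarrow> \<theta>' x \<in> cube_boundary k"
    "\<And>x. x \<in> ibox a b \<Longrightarrow> \<theta> (\<theta>' x) = x"
proof -
  define J where "J = {i. a i < b i}"
  define k where "k = card J"
  obtain e where e: "bij_betw e {0..<k} J"
    using ex_bij_betw_nat_finite fin J_def k_def by blast
  define e' where "e' = inv_into {0..<k} e"
  have e_in: "e j \<in> J" if "j < k" for j using e that by (auto simp: bij_betw_def)
  have e'_in: "e' i < k" "e (e' i) = i" if "i \<in> J" for i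
    using bij_betw_inv_into[OF e] bij_betw_inv_into_right[OF e that] that
    by (auto simp: e'_def bij_betw_def)
  have e'e: "e' (e j) = j" if "j < k" for j
    using bij_betw_inv_into_left[OF e, of j] that by (simp add: e'_def)
  have b: "b i = Suc (a i)" if "i \<in> J" for i using that unit[of i] by (simp add: J_def)
  have b': "b i = a i" if "i \<notin> J" for i using that le[of i] by (simp add: J_def)
  define \<theta> where "\<theta> y = (\<lambda>i. if i \<in> J then real (a i) + (y (e' i) + 1) / 2 else real (a i))" for y :: "nat \<Rightarrow> real"
  define \<theta>' where "\<theta>' x = (\<lambda>j. if j < k then 2 * (x (e j) - real (a (e j))) - 1 else 0)" for x :: "nat \<Rightarrow> real"
  show thesis
  proof
    show "continuous_on (cube k) \<theta>"
    proof (rule continuous_on_coordinatewise_then_product)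
      show "continuous_on (cube k) (\<lambda>y. \<theta> y i)" for i
        unfolding \<theta>_def by (cases "i \<in> J") (auto intro!: continuous_intros continuous_on_coordinate)
    qed
    show "continuous_on (ibox a b) \<theta>'"
    proof (rule continuous_on_coordinatewise_then_product)
      show "continuous_on (ibox a b) (\<lambda>y. \<theta>' y i)" for i
        unfolding \<theta>'_def by (cases "i < k") (auto intro!: continuous_intros continuous_on_coordinate)
    qed
    show \<theta>_in: "\<theta> y \<in> ibox a b" if "y \<in> cube k" for y
      unfolding ibox_def
    proof (intro CollectI allI)
      fix i
      show "real (a i) \<le> \<theta> y i \<and> \<theta> y i \<le> real (b i)"
      proof (cases "i \<in> J")
        case True
        have "\<bar>y (e' i)\<bar> \<le> 1" using abs_le_supn[OF e'_in(1)[OF True], of y] that by (simp add: cube_def)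
        then show ?thesis using True b by (auto simp: \<theta>_def)
      qed (use b' in \<open>auto simp: \<theta>_def\<close>)
    qed
    show \<theta>'_in: "\<theta>' x \<in> cube k" if "x \<in> ibox a b" for x
    proof -
      have "\<bar>\<theta>' x j\<bar> \<le> 1" if j: "j < k" for j
      proof -
        have "real (a (e j)) \<le> x (e j) \<and> x (e j) \<le> real (a (e j)) + 1"
          using \<open>x \<in> ibox a b\<close>[unfolded ibox_def mem_Collect_eq, rule_format, of "e j"] b[OF e_in[OF j]] by simp
        then show ?thesis using j by (auto simp: \<theta>'_def)
      qed
      then show ?thesis by (auto simp: cube_def supn_le_iff) (simp add: \<theta>'_def)
    qed
    show "\<theta> y \<in> ibox_boundary a b" if y: "y \<in> cube_boundary k" for y
    proof -
      have "supn k y = 1" using y by (simp add: cube_boundary_def)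
      then obtain j where j: "j < k" "\<bar>y j\<bar> = 1" using supn_attained[of k y] by auto
      have "\<theta> y (e j) = real (a (e j)) + (y j + 1) / 2" using j e_in e'e by (simp add: \<theta>_def)
      moreover have "y j = 1 \<or> y j = -1" using j by linarith
      ultimately have "\<theta> y (e j) = real (a (e j)) \<or> \<theta> y (e j) = real (b (e j))"
        using b[OF e_in[OF j(1)]] by auto
      moreover have "a (e j) < b (e j)" using e_in[OF j(1)] by (simp add: J_def)
      moreover have "\<theta> y \<in> ibox a b" using y cube_boundary_subset \<theta>_in by blast
      ultimately show ?thesis by (auto simp: ibox_boundary_def)
    qed
    show "\<theta>' x \<in> cube_boundary k" if "x \<in> ibox_boundary a b" for x
    proof -
      obtain i where i: "i \<in> J" "x i = real (a i) \<or> x i = real (b i)"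
        using \<open>x \<in> ibox_boundary a b\<close> by (auto simp: ibox_boundary_def J_def)
      have "\<theta>' x (e' i) = 2 * (x i - real (a i)) - 1" using e'_in[OF i(1)] by (simp add: \<theta>'_def)
      then have "\<bar>\<theta>' x (e' i)\<bar> = 1" using i b[OF i(1)] by auto
      moreover have "\<theta>' x \<in> cube k" using that ibox_boundary_subset \<theta>'_in by blast
      ultimately show ?thesis using e'_in(1)[OF i(1)] supn_eq_1_iff[of k "\<theta>' x"]
        by (auto simp: cube_def cube_boundary_def)
    qed
    show "\<theta> (\<theta>' x) = x" if x: "x \<in> ibox a b" for x
    proof
      fix i
      show "\<theta> (\<theta>' x) i = x i"
      proof (cases "i \<in> J")
        case True
        then show ?thesis using e'_in[OF True] by (simp add: \<theta>_def \<theta>'_def field_simps)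
      next
        case False
        then have "x i = real (a i)"
          using x[unfolded ibox_def mem_Collect_eq, rule_format, of i] b'[OF False] by simp
        then show ?thesis using False by (simp add: \<theta>_def)
      qed
    qed
  qed
qed


subsection \<open>Gluing lifting properties over an open cover\<close>

text \<open>Restricting the target to \<open>W\<close> as well as the source makes the property
  assert that the whole homotopy stays inside \<open>W\<close>.\<close>

definition lifting_over :: "'e topology \<Rightarrow> 'y topology \<Rightarrow> ('e \<Rightarrow> 'y) \<Rightarrow> 'y set \<Rightarrow> bool" where
  "lifting_over E Y f W \<longleftrightarrow>
     relative_lifting (subtopology E {x \<in> topspace E. f x \<in> W}) (subtopology Y W) f"

lemma lifting_over_unit_ibox:
  fixes H0 :: "(nat \<Rightarrow> real) \<times> real \<Rightarrow> 'y"
  assumes W: "lifting_over E Y f W"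
    and fin: "finite {i. a i < b i}" and le: "\<And>i. a i \<le> b i" and unit: "\<And>i. b i \<le> Suc (a i)"
    and v: "continuous_map (top_of_set (ibox a b)) Y v"
    and U0: "continuous_map (top_of_set (ibox_boundary a b)) E U0"
    and H0: "continuous_map (top_of_set (ibox_boundary a b \<times> {0..1})) Y H0"
    and H00: "\<forall>x\<in>ibox_boundary a b. H0 (x, 0) = v x"
    and H01: "\<forall>x\<in>ibox_boundary a b. H0 (x, 1) = f (U0 x)"
    and vW: "v ` ibox a b \<subseteq> W" and H0W: "H0 ` (ibox_boundary a b \<times> {0..1}) \<subseteq> W"
  shows "\<exists>U H. continuous_map (top_of_set (ibox a b)) E U \<and>
    continuous_map (top_of_set (ibox a b \<times> {0..1::real})) Y H \<and>
    (\<forall>x\<in>ibox_boundary a b. U x = U0 x) \<and>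
    (\<forall>x\<in>ibox_boundary a b. \<forall>t\<in>{0..1}. H (x, t) = H0 (x, t)) \<and>
    (\<forall>x\<in>ibox a b. H (x, 0) = v x) \<and> (\<forall>x\<in>ibox a b. H (x, 1) = f (U x)) \<and>
    H ` (ibox a b \<times> {0..1}) \<subseteq> W"
proof -
  obtain k \<theta> \<theta>' where \<theta>: "continuous_on (cube k) \<theta>" and \<theta>': "continuous_on (ibox a b) \<theta>'"
    and \<theta>_in: "\<And>y. y \<in> cube k \<Longrightarrow> \<theta> y \<in> ibox a b"
    and \<theta>'_in: "\<And>x. x \<in> ibox a b \<Longrightarrow> \<theta>' x \<in> cube k"
    and \<theta>_bd: "\<And>y. y \<in> cube_boundary k \<Longrightarrow> \<theta> y \<in> ibox_boundary a b"
    and \<theta>'_bd: "\<And>x. x \<in> ibox_boundary a b \<Longrightarrow> \<theta>' x \<in> cube_boundary k"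
    and \<theta>\<theta>': "\<And>x. x \<in> ibox a b \<Longrightarrow> \<theta> (\<theta>' x) = x"
    using unit_ibox_parametrization[OF fin le unit] by blast
  let ?E = "subtopology E {x \<in> topspace E. f x \<in> W}" and ?Y = "subtopology Y W"
  have U0_in: "U0 x \<in> topspace E \<and> f (U0 x) \<in> W" if "x \<in> ibox_boundary a b" for x
  proof -
    have "U0 x \<in> topspace E" using U0 that by (auto simp: continuous_map_def)
    moreover have "H0 (x, 1) \<in> W" using H0W that by auto
    ultimately show ?thesis using H01 that by simp
  qed
  have u: "continuous_map (top_of_set (cube_boundary k)) ?E (\<lambda>y. U0 (\<theta> y))"
    using U0_in \<theta>_bd
    by (intro continuous_map_into_subtopology continuous_map_top_of_set_compose[OF U0])
      (auto intro: continuous_on_subset[OF \<theta> cube_boundary_subset])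
  \<comment> \<open>The homotopy over the boundary of the cell has been chosen before and is
    therefore prescribed on the sides; the bottom carries \<open>v\<close>. This is exactly a
    problem for \<open>relative_lifting\<close>.\<close>
  define h where "h z = (if z \<in> cube k \<times> {0} then v (\<theta> (fst z)) else H0 (\<theta> (fst z), snd z))" for z
  have h_side: "h (y, t) = H0 (\<theta> y, t)" if "y \<in> cube_boundary k" for y t
    using that \<theta>_bd H00 by (auto simp: h_def)
  have "continuous_map (top_of_set (cube_cup k)) Y h"
    unfolding h_def cube_cup_def
  proof (rule continuous_map_top_of_set_Un)
    show "continuous_map (top_of_set (cube k \<times> {0})) Y (\<lambda>z. v (\<theta> (fst z)))"
      using \<theta>_in by (intro continuous_map_top_of_set_compose[OF v] continuous_on_compose2[OF \<theta>]
         continuous_on_fst continuous_on_id) auto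
    have "continuous_on (cube_boundary k \<times> {0..1::real}) (\<lambda>z. \<theta> (fst z))"
      using cube_boundary_subset[of k] by (intro continuous_on_compose2[OF \<theta>]
            continuous_on_fst continuous_on_id) auto
    then show "continuous_map (top_of_set (cube_boundary k \<times> {0..1})) Y (\<lambda>z. H0 (\<theta> (fst z), snd z))"
      using \<theta>_bd by (intro continuous_map_top_of_set_compose[OF H0] continuous_on_basics) auto
  qed (use \<theta>_bd H00 in \<open>auto intro!: closed_Times closed_cube closed_cube_boundary\<close>)
  moreover have "h z \<in> W" if "z \<in> cube_cup k" for z
    using that vW H0W \<theta>_in \<theta>_bd unfolding cube_cup_def h_def by (auto simp: image_subset_iff)
  ultimately have h: "continuous_map (top_of_set (cube_cup k)) ?Y h"
    by (intro continuous_map_into_subtopology) auto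
  have "\<forall>y\<in>cube_boundary k. h (y, 1) = f (U0 (\<theta> y))" using h_side H01 \<theta>_bd by simp
  then obtain U H where U: "continuous_map (top_of_set (cube k)) ?E U"
      and H: "continuous_map (top_of_set (cube k \<times> {0..1})) ?Y H"
      and Uu: "\<forall>y\<in>cube_boundary k. U y = U0 (\<theta> y)"
      and Hh: "\<forall>z\<in>cube_cup k. H z = h z" and HU: "\<forall>y\<in>cube k. H (y, 1) = f (U y)"
    using W[unfolded lifting_over_def relative_lifting_def, rule_format, of k "\<lambda>y. U0 (\<theta> y)" h] u h by blast
  show ?thesis
  proof (intro exI conjI ballI)
    show "continuous_map (top_of_set (ibox a b)) E (\<lambda>x. U (\<theta>' x))"
      using continuous_map_top_of_set_compose[OF U \<theta>' \<theta>'_in] by (rule continuous_map_into_fulltopology)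
    have c: "continuous_map (top_of_set (ibox a b \<times> {0..1})) ?Y (\<lambda>z. H (\<theta>' (fst z), snd z))"
      using \<theta>'_in by (intro continuous_map_top_of_set_compose[OF H] continuous_on_basics
            continuous_on_compose2[OF \<theta>']) auto
    then show "continuous_map (top_of_set (ibox a b \<times> {0..1})) Y (\<lambda>z. H (\<theta>' (fst z), snd z))"
      by (rule continuous_map_into_fulltopology)
    show "(\<lambda>z. H (\<theta>' (fst z), snd z)) ` (ibox a b \<times> {0..1}) \<subseteq> W"
      using c by (auto simp: continuous_map_in_subtopology)
    show "U (\<theta>' x) = U0 x" if "x \<in> ibox_boundary a b" for x
      using Uu \<theta>'_bd[OF that] \<theta>\<theta>'[of x] that ibox_boundary_subset[of a b] by auto
    show "H (\<theta>' (fst (x, t)), snd (x, t)) = H0 (x, t)" if "x \<in> ibox_boundary a b" "t \<in> {0..1}" for x t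
    proof -
      have "H (\<theta>' x, t) = h (\<theta>' x, t)" using Hh \<theta>'_bd[OF that(1)] that(2) by (auto simp: cube_cup_def)
      also have "\<dots> = H0 (x, t)" using h_side[OF \<theta>'_bd[OF that(1)]] \<theta>\<theta>'[of x] that(1) ibox_boundary_subset[of a b] by auto
      finally show ?thesis by simp
    qed
    show "H (\<theta>' (fst (x, 0)), snd (x, 0)) = v x" if "x \<in> ibox a b" for x
      using Hh \<theta>'_in[OF that] \<theta>\<theta>'[OF that] by (auto simp: cube_cup_def h_def)
    show "H (\<theta>' (fst (x, 1)), snd (x, 1)) = f (U (\<theta>' x))" if "x \<in> ibox a b" for x
      using HU \<theta>'_in[OF that] by simp
  qed
qed

section \<open>Extension of lifts over a subdivided box\<close>

context
  fixes E :: "'e topology" and Y :: "'y topology" and f :: "'e \<Rightarrow> 'y" and A B :: "'y set"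
    and v :: "(nat \<Rightarrow> real) \<Rightarrow> 'y" and N :: "nat \<Rightarrow> nat" and n :: nat
  assumes lift: "lifting_over E Y f A" "lifting_over E Y f B" "lifting_over E Y f (A \<inter> B)"
    and v: "continuous_map (top_of_set (ibox (\<lambda>_. 0) N)) Y v"
    and N: "\<forall>i\<ge>n. N i = 0"
    and small: "\<forall>a b. (\<forall>i. a i \<le> b i \<and> b i \<le> Suc (a i) \<and> b i \<le> N i) \<longrightarrow>
       v ` ibox a b \<subseteq> A \<or> v ` ibox a b \<subseteq> B"
begin

text \<open>The homotopy of a partial lift has to stay inside every member of the cover that contains the
  image of the carrier of the point; this is what makes lifts over adjacent cells compatible.\<close>

definition partial_lift where
  "partial_lift S U H \<longleftrightarrow>
     continuous_map (top_of_set S) E U \<and> continuous_map (top_of_set (S \<times> {0..1::real})) Y H \<and>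
     (\<forall>x\<in>S. H (x, 0) = v x \<and> H (x, 1) = f (U x) \<and>
       (\<forall>t\<in>{0..1}. (v ` carrier_box x \<subseteq> A \<longrightarrow> H (x, t) \<in> A) \<and> (v ` carrier_box x \<subseteq> B \<longrightarrow> H (x, t) \<in> B)))"

lemma partial_lift_Un:
  assumes S: "partial_lift S U H" "closed S" and T: "partial_lift T U' H'" "closed T"
    and eq: "\<And>x. x \<in> S \<inter> T \<Longrightarrow> U x = U' x" "\<And>x t. x \<in> S \<inter> T \<Longrightarrow> t \<in> {0..1} \<Longrightarrow> H (x, t) = H' (x, t)"
  shows "partial_lift (S \<union> T) (\<lambda>x. if x \<in> S then U x else U' x)
    (\<lambda>z. if z \<in> S \<times> {0..1} then H z else H' z)"
proof -
  have "continuous_map (top_of_set (S \<union> T)) E (\<lambda>x. if x \<in> S then U x else U' x)"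
    using S T eq by (intro continuous_map_top_of_set_Un) (auto simp: partial_lift_def)
  moreover have "continuous_map (top_of_set (S \<times> {0..1} \<union> T \<times> {0..1::real})) Y (\<lambda>z. if z \<in> S \<times> {0..1} then H z else H' z)"
    using S T eq by (intro continuous_map_top_of_set_Un closed_Times) (auto simp: partial_lift_def)
  moreover have "(S \<union> T) \<times> {0..1::real} = S \<times> {0..1} \<union> T \<times> {0..1}" by blast
  ultimately show ?thesis
    using S(1) T(1) unfolding partial_lift_def by (auto split: if_splits)
qed

text \<open>\<open>S\<close> ranges over all closed sets that meet \<open>C\<close> exactly in
  \<open>bC\<close>. Lifts over other cells are thus carried along unchanged while \<open>C\<close>
  is attached.\<close>

definition extendable where
  "extendable C bC \<longleftrightarrow> (\<forall>S U H. closed S \<and> S \<inter> C = bC \<and> partial_lift S U H \<longrightarrow>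
     (\<exists>U' H'. partial_lift (S \<union> C) U' H' \<and>
        (\<forall>x\<in>S. U' x = U x \<and> (\<forall>t\<in>{0..1}. H' (x, t) = H (x, t)))))"

lemma finite_ibox_support:
  assumes "\<And>i. b i \<le> N i"
  shows "finite {i. a i < b i}"
proof (rule finite_subset)
  show "{i. a i < b i} \<subseteq> {..<n}"
  proof
    fix i assume "i \<in> {i. a i < b i}"
    then show "i \<in> {..<n}" using N assms[of i] by (cases "i < n") auto
  qed
qed simp

lemma extendable_unit_ibox:
  assumes le: "\<And>i. a i \<le> b i" and unit: "\<And>i. b i \<le> Suc (a i)" and bN: "\<And>i. b i \<le> N i"
  shows "extendable (ibox a b) (ibox_boundary a b)"
  unfolding extendable_def
proof (intro allI impI, elim conjE)
  fix S U H assume clS: "closed S" and Sc: "S \<inter> ibox a b = ibox_boundary a b" and L: "partial_lift S U H"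
  \<comment> \<open>The intersection of those among \<open>A\<close> and \<open>B\<close> that
    contain the image of the cell. This is where lifting over \<open>A \<inter> B\<close> enters: a
    cell mapped into both sets must keep its homotopy in both.\<close>
  define W where "W = (if v ` ibox a b \<subseteq> A then if v ` ibox a b \<subseteq> B then A \<inter> B else A else B)"
  have AB: "v ` ibox a b \<subseteq> A \<or> v ` ibox a b \<subseteq> B" using small le unit bN by blast
  then have W: "lifting_over E Y f W" "v ` ibox a b \<subseteq> W" using lift by (auto simp: W_def)
  have bS: "ibox_boundary a b \<subseteq> S" using Sc by blast
  have box_sub: "ibox a b \<subseteq> ibox (\<lambda>_. 0) N" using bN by (rule ibox_subset)
  \<comment> \<open>A boundary point has its carrier inside the box, so its homotopy, chosen
    earlier, already stays in every member of the cover that contains the image of the box.\<close>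
  have HW: "H ` (ibox_boundary a b \<times> {0..1}) \<subseteq> W"
  proof clarify
    fix x and t :: real assume x: "x \<in> ibox_boundary a b" and t: "t \<in> {0..1}"
    have "v ` carrier_box x \<subseteq> v ` ibox a b"
      using carrier_box_subset[of x a b] x ibox_boundary_subset[of a b] by blast
    moreover have "(v ` carrier_box x \<subseteq> A \<longrightarrow> H (x, t) \<in> A) \<and> (v ` carrier_box x \<subseteq> B \<longrightarrow> H (x, t) \<in> B)"
      using L x t bS unfolding partial_lift_def by blast
    ultimately show "H (x, t) \<in> W" using AB unfolding W_def by auto
  qed
  have vc: "continuous_map (top_of_set (ibox a b)) Y v"
    using v box_sub by (rule continuous_map_top_of_set_subset)
  have Uc: "continuous_map (top_of_set (ibox_boundary a b)) E U"
    using L bS unfolding partial_lift_def by (auto intro: continuous_map_top_of_set_subset)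
  have Hc: "continuous_map (top_of_set (ibox_boundary a b \<times> {0..1})) Y H"
    using L bS unfolding partial_lift_def by (auto intro: continuous_map_top_of_set_subset[of "S \<times> {0..1}"])
  have H0: "\<forall>x\<in>ibox_boundary a b. H (x, 0) = v x" and H1: "\<forall>x\<in>ibox_boundary a b. H (x, 1) = f (U x)"
    using L bS unfolding partial_lift_def by blast+
  obtain U' H' where U': "continuous_map (top_of_set (ibox a b)) E U'"
    and H': "continuous_map (top_of_set (ibox a b \<times> {0..1::real})) Y H'"
    and eqU: "\<forall>x\<in>ibox_boundary a b. U' x = U x"
    and eqH: "\<forall>x\<in>ibox_boundary a b. \<forall>t\<in>{0..1}. H' (x, t) = H (x, t)"
    and H'0: "\<forall>x\<in>ibox a b. H' (x, 0) = v x" and H'1: "\<forall>x\<in>ibox a b. H' (x, 1) = f (U' x)"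
    and H'W: "H' ` (ibox a b \<times> {0..1}) \<subseteq> W"
    using lifting_over_unit_ibox[OF W(1) finite_ibox_support[OF bN] le unit vc Uc Hc H0 H1 W(2) HW]
    by (elim exE conjE) (rule that)
  have "partial_lift (ibox a b) U' H'"
    unfolding partial_lift_def
  proof (intro conjI ballI U' H' H'0[rule_format] H'1[rule_format])
    fix x and t :: real assume x: "x \<in> ibox a b" and t: "t \<in> {0..1}"
    have "(v ` carrier_box x \<subseteq> A \<longrightarrow> H' (x, t) \<in> A) \<and> (v ` carrier_box x \<subseteq> B \<longrightarrow> H' (x, t) \<in> B)"
    \<comment> \<open>Boundary points keep the earlier homotopy; every other point has the whole box
      as its carrier, and \<open>W\<close> was chosen for the whole box.\<close>
    proof (cases "x \<in> ibox_boundary a b")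
      case True
      then show ?thesis using L bS t eqH True unfolding partial_lift_def by auto
    next
      case False
      then have "carrier_box x = ibox a b" using carrier_box_eq[OF unit x] by simp
      moreover have "H' (x, t) \<in> W" using H'W x t by auto
      ultimately show ?thesis unfolding W_def by (auto split: if_splits)
    qed
    then show "v ` carrier_box x \<subseteq> A \<longrightarrow> H' (x, t) \<in> A" "v ` carrier_box x \<subseteq> B \<longrightarrow> H' (x, t) \<in> B"
      by blast+
  qed
  then have "partial_lift (S \<union> ibox a b) (\<lambda>x. if x \<in> S then U x else U' x)
    (\<lambda>z. if z \<in> S \<times> {0..1} then H z else H' z)"
    using L clS closed_ibox Sc eqU eqH by (intro partial_lift_Un) auto
  then show "\<exists>U' H'. partial_lift (S \<union> ibox a b) U' H' \<and>
        (\<forall>x\<in>S. U' x = U x \<and> (\<forall>t\<in>{0..1}. H' (x, t) = H (x, t)))"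
    by (intro exI conjI, assumption) auto
qed

text \<open>\<open>C\<close> is attached to \<open>S\<close> first, and then \<open>D\<close> to
  \<open>S \<union> C\<close>. The contact sets have to come out right for every \<open>S\<close>
  that meets \<open>F\<close> in \<open>bF\<close>, because \<open>extendable\<close> quantifies
  over all of these.\<close>

lemma extendable_Un:
  assumes C: "extendable C bC" "closed C" and D: "extendable D bD"
    and C': "\<And>S. S \<inter> F = bF \<Longrightarrow> S \<inter> C = bC" and D': "\<And>S. S \<inter> F = bF \<Longrightarrow> (S \<union> C) \<inter> D = bD"
    and F: "C \<union> D = F"
  shows "extendable F bF"
  unfolding extendable_def
proof (intro allI impI, elim conjE)
  fix S U H assume clS: "closed S" and SF: "S \<inter> F = bF" and L: "partial_lift S U H"
  obtain U1 H1 where 1: "partial_lift (S \<union> C) U1 H1"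
    "\<forall>x\<in>S. U1 x = U x \<and> (\<forall>t\<in>{0..1}. H1 (x, t) = H (x, t))"
    using C(1)[unfolded extendable_def] clS C'[OF SF] L by metis
  obtain U2 H2 where 2: "partial_lift (S \<union> C \<union> D) U2 H2"
    "\<forall>x\<in>S \<union> C. U2 x = U1 x \<and> (\<forall>t\<in>{0..1}. H2 (x, t) = H1 (x, t))"
    using D(1)[unfolded extendable_def, rule_format, of "S \<union> C" U1 H1] clS C(2) D'[OF SF] 1(1) by auto
  have "S \<union> C \<union> D = S \<union> F" using F by blast
  then show "\<exists>U' H'. partial_lift (S \<union> F) U' H' \<and>
        (\<forall>x\<in>S. U' x = U x \<and> (\<forall>t\<in>{0..1}. H' (x, t) = H (x, t)))"
    using 1 2 by (intro exI[of _ U2] exI[of _ H2]) auto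
qed

text \<open>A long box is cut by a wall at distance 1 from its lower face. The wall, the slab below
  it and the rest of the box all have smaller total edge length. They are attached in this order, so
  that each piece meets what is already there exactly in its own boundary.\<close>

lemma extendable_ibox:
  assumes "\<And>i. a i \<le> b i" and "\<And>i. b i \<le> N i"
  shows "extendable (ibox a b) (ibox_boundary a b)"
  using assms
proof (induction "\<Sum>i<n. b i - a i" arbitrary: a b rule: less_induct)
  case less
  show ?case
  proof (cases "\<forall>i. b i \<le> Suc (a i)")
    case True
    then show ?thesis using less.prems by (intro extendable_unit_ibox) auto
  next
    case False
    then obtain i where i: "Suc (a i) < b i" by (auto simp: not_le)
    define s where "s = Suc (a i)"
    have s: "a i < s" "s < b i" using i by (auto simp: s_def)
    have "i < n" using N less.prems(2)[of i] i by (cases "i < n") auto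
    have dec: "(\<Sum>j<n. b' j - a' j) < (\<Sum>j<n. b j - a j)"
      if "\<And>j. b' j - a' j \<le> b j - a j" "b' i - a' i < b i - a i" for a' b' :: "nat \<Rightarrow> nat"
      using that \<open>i < n\<close> by (intro sum_strict_mono_ex1) auto
    note sp = ibox_split[where a = a and b = b and i = i and s = s, OF s]
    define Q where "Q x \<longleftrightarrow> (\<exists>j. j \<noteq> i \<and> a j < b j \<and> (x j = real (a j) \<or> x j = real (b j)))" for x
    note bsp = ibox_boundary_split[where a = a and b = b and i = i and s = s, OF s, folded Q_def]
    have up: "(a(i := s)) j \<le> b j" "a j \<le> (b(i := s)) j" "(a(i := s)) j \<le> (b(i := s)) j"
      "(b(i := s)) j \<le> N j" for j
      using less.prems(1)[of j] less.prems(2)[of j] s by auto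
    have d: "extendable (ibox (a(i := s)) (b(i := s))) (ibox_boundary (a(i := s)) (b(i := s)))"
      by (rule less.hyps[OF dec]) (use up s in auto)
    have c1: "extendable (ibox a (b(i := s))) (ibox_boundary a (b(i := s)))"
      by (rule less.hyps[OF dec]) (use up s in auto)
    have c2: "extendable (ibox (a(i := s)) b) (ibox_boundary (a(i := s)) b)"
      by (rule less.hyps[OF dec]) (use up s less.prems in auto)
    have rs: "real (a i) < real s" "real s < real (b i)" using s by auto
    let ?D = "ibox (a(i := s)) (b(i := s))" and ?C1 = "ibox a (b(i := s))" and ?C2 = "ibox (a(i := s)) b"
    \<comment> \<open>Wall and slab are first combined into one extension step. Its contact set
      lacks the relative interior of the wall, since the wall is attached as part of this
      step.\<close>
    define bF1 where "bF1 = ibox_boundary a b \<inter> ?C1"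
    have "extendable ?C1 bF1"
    proof (rule extendable_Un[OF d closed_ibox c1])
      fix S assume S: "S \<inter> ?C1 = bF1"
      have S': "x \<in> S \<longleftrightarrow> Q x \<or> x i = real (a i)" if "x \<in> ibox a b" "x i \<le> real s" for x
      proof -
        have "x \<in> S \<longleftrightarrow> x \<in> S \<inter> ?C1" using that by (simp add: sp)
        then have "x \<in> S \<longleftrightarrow> x \<in> bF1" by (simp only: S)
        then show ?thesis using that rs unfolding bF1_def sp bsp by auto
      qed
      show "S \<inter> ?D = ibox_boundary (a(i := s)) (b(i := s))"
        unfolding sp bsp using S' rs by auto
      show "(S \<union> ?D) \<inter> ?C1 = ibox_boundary a (b(i := s))"
        unfolding sp bsp using S' rs by auto
    qed (auto simp: sp)
    then show ?thesis
    proof (rule extendable_Un[OF _ closed_ibox c2])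
      fix S assume S: "S \<inter> ibox a b = ibox_boundary a b"
      have S': "x \<in> S \<longleftrightarrow> Q x \<or> x i = real (a i) \<or> x i = real (b i)" if "x \<in> ibox a b" for x
      proof -
        have "x \<in> S \<longleftrightarrow> x \<in> S \<inter> ibox a b" using that by simp
        then have "x \<in> S \<longleftrightarrow> x \<in> ibox_boundary a b" by (simp only: S)
        then show ?thesis using that unfolding bsp by auto
      qed
      show "S \<inter> ?C1 = bF1" unfolding bF1_def S[symmetric] sp by auto
      show "(S \<union> ?C1) \<inter> ?C2 = ibox_boundary (a(i := s)) b"
        unfolding sp bsp using S' rs by auto
    qed (auto simp: sp)
  qed
qed

text \<open>The stationary homotopy is an admissible start over the boundary: a point lies in its
  own carrier, so a homotopy that never moves \<open>v x\<close> satisfies the carrier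
  conditions.\<close>

lemma partial_lift_ibox:
  assumes U: "continuous_map (top_of_set (ibox_boundary (\<lambda>_. 0) N)) E U"
    and fU: "\<forall>x\<in>ibox_boundary (\<lambda>_. 0) N. f (U x) = v x"
  shows "\<exists>U' H'. continuous_map (top_of_set (ibox (\<lambda>_. 0) N)) E U' \<and>
    continuous_map (top_of_set (ibox (\<lambda>_. 0) N \<times> {0..1::real})) Y H' \<and>
    (\<forall>x\<in>ibox (\<lambda>_. 0) N. H' (x, 0) = v x \<and> H' (x, 1) = f (U' x)) \<and>
    (\<forall>x\<in>ibox_boundary (\<lambda>_. 0) N. U' x = U x \<and> (\<forall>t\<in>{0..1}. H' (x, t) = v x))"
proof -
  let ?C = "ibox (\<lambda>_. 0) N" and ?S = "ibox_boundary (\<lambda>_. 0) N"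
  have "partial_lift ?S U (\<lambda>z. v (fst z))"
    unfolding partial_lift_def
  proof (intro conjI ballI U impI)
    show "continuous_map (top_of_set (?S \<times> {0..1::real})) Y (\<lambda>z. v (fst z))"
      using ibox_boundary_subset[of "\<lambda>_. 0" N]
      by (intro continuous_map_top_of_set_compose[OF v] continuous_on_fst continuous_on_id) auto
  next
    fix x assume x: "x \<in> ?S"
    show "v (fst (x, 0)) = v x" by simp
    show "v (fst (x, 1)) = f (U x)" using fU x by simp
    fix t
    have "x \<in> carrier_box x" using mem_carrier_box x ibox_boundary_subset by blast
    then show "v (fst (x, t)) \<in> A" if "v ` carrier_box x \<subseteq> A" using that by auto
    from \<open>x \<in> carrier_box x\<close> show "v (fst (x, t)) \<in> B" if "v ` carrier_box x \<subseteq> B" using that by auto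
  qed
  moreover have "closed ?S" by (intro closed_ibox_boundary finite_ibox_support) simp
  moreover have "?S \<inter> ?C = ?S" "?S \<union> ?C = ?C" using ibox_boundary_subset[of "\<lambda>_. 0" N] by auto
  moreover have "extendable ?C ?S" by (rule extendable_ibox) auto
  ultimately obtain U' H' where L: "partial_lift ?C U' H'"
    "\<forall>x\<in>?S. U' x = U x \<and> (\<forall>t\<in>{0..1}. H' (x, t) = v (fst (x, t)))"
    using extendable_def[of ?C ?S, THEN iffD1, rule_format, of ?S U "\<lambda>z. v (fst z)"] by auto
  then show ?thesis
    by (intro exI[of _ U'] exI[of _ H']) (auto simp: partial_lift_def)
qed

end


section \<open>Subdivision subordinate to an open cover, and gluing\<close>

lemma dist_fun_le:
  fixes x y :: "nat \<Rightarrow> real"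
  assumes "\<And>i. \<bar>x i - y i\<bar> \<le> c"
  shows "dist x y \<le> 2 * c"
proof (rule field_le_epsilon)
  fix e :: real assume "e > 0"
  \<comment> \<open>The metric on functions is a sum of truncated coordinate distances with weights
    \<open>(1 / 2) ^ k\<close>: the total weight is 2, which gives the factor in the claim, and the
    coordinates after the first ones contribute an arbitrarily small tail.\<close>
  then obtain M where M: "(1 / 2) ^ M < e" using real_arch_pow_inv[of e "1 / 2"] by auto
  have "Max {dist (x (from_nat k)) (y (from_nat k)) |k. k \<le> M} \<le> c"
    using assms by (subst Max_le_iff) (auto simp: dist_real_def)
  then show "dist x y \<le> 2 * c + e"
    using dist_fun_le_dist_first_terms[of x y M] M by linarith
qed

text \<open>A Lebesgue number of the pulled back cover yields a grid each of whose cells maps into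
  \<open>A\<close> or into \<open>B\<close>. The lift over the grid is stationary over the boundary,
  so the covering map on the cap can be taken independent of time.\<close>

lemma deformation_lifting_open_cover:
  assumes opn: "openin Y A" "openin Y B" and cov: "topspace Y \<subseteq> A \<union> B"
    and lift: "lifting_over E Y f A" "lifting_over E Y f B" "lifting_over E Y f (A \<inter> B)"
  shows "deformation_lifting E Y f"
  unfolding deformation_lifting_def
proof (intro allI impI, elim conjE, goal_cases)
  case (1 n u v)
  note u = 1(1) and v = 1(2) and vu = 1(3)
  have ex: "\<exists>O'. open O' \<and> {x \<in> cube n. v x \<in> W} = cube n \<inter> O'" if "openin Y W" for W
    using openin_continuous_map_preimage[OF v that] by (simp add: openin_open)
  obtain OA where OA: "open OA" "{x \<in> cube n. v x \<in> A} = cube n \<inter> OA"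
    using ex[OF opn(1)] by (elim exE conjE) (rule that)
  obtain OB where OB: "open OB" "{x \<in> cube n. v x \<in> B} = cube n \<inter> OB"
    using ex[OF opn(2)] by (elim exE conjE) (rule that)
  have "cube n \<subseteq> \<Union>{OA, OB}"
  proof
    fix x assume x: "x \<in> cube n"
    then have "v x \<in> topspace Y" using continuous_map_image_subset_topspace[OF v] by auto
    then have "v x \<in> A \<or> v x \<in> B" using cov by blast
    moreover have "x \<in> OA" if "v x \<in> A" using OA(2) x that by blast
    moreover have "x \<in> OB" if "v x \<in> B" using OB(2) x that by blast
    ultimately show "x \<in> \<Union>{OA, OB}" by blast
  qed
  then obtain e where e: "e > 0" "\<forall>x\<in>cube n. \<exists>G\<in>{OA, OB}. ball x e \<subseteq> G"
    by (rule Heine_Borel_lemma[OF compact_cube, of n "{OA, OB}"]) (use OA(1) OB(1) in auto)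
  obtain N0 where "4 / e < real N0" using reals_Archimedean2 by blast
  define N where "N = Suc N0"
  have N: "4 / e < real N" "real N > 0" using \<open>4 / e < real N0\<close> by (auto simp: N_def)
  \<comment> \<open>A grid cell has edge \<open>2 / real N\<close> in the coordinates of the cube,
    and \<open>dist_fun_le\<close> doubles this bound; hence a cell lies in the ball of radius
    \<open>e\<close> around its lower corner.\<close>
  then have Ne: "4 / real N < e" using e(1) by (simp add: field_simps)
  define Nn where "Nn i = (if i < n then N else 0)" for i
  define \<sigma> where "\<sigma> x = (\<lambda>i. if i < n then 2 * x i / real N - 1 else 0)" for x :: "nat \<Rightarrow> real"
  define \<sigma>' where "\<sigma>' y = (\<lambda>i. if i < n then real N * (y i + 1) / 2 else 0)" for y :: "nat \<Rightarrow> real"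
  have \<sigma>_in: "\<sigma> x \<in> cube n" if "x \<in> ibox (\<lambda>_. 0) Nn" for x
  proof -
    have "\<bar>\<sigma> x i\<bar> \<le> 1" if "i < n" for i
    proof -
      have "0 \<le> x i \<and> x i \<le> real N"
        using \<open>x \<in> ibox (\<lambda>_. 0) Nn\<close>[unfolded ibox_def mem_Collect_eq, rule_format, of i] that by (simp add: Nn_def)
      then show ?thesis using that N by (auto simp: \<sigma>_def abs_le_iff field_simps)
    qed
    then show ?thesis by (auto simp: cube_def supn_le_iff \<sigma>_def)
  qed
  have \<sigma>'_in: "\<sigma>' y \<in> ibox (\<lambda>_. 0) Nn" if "y \<in> cube n" for y
    unfolding ibox_def
  proof (intro CollectI allI)
    fix i
    have "\<bar>y i\<bar> \<le> 1" if "i < n" using abs_le_supn[OF that, of y] \<open>y \<in> cube n\<close> by (simp add: cube_def)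
    then have "0 \<le> real N * (y i + 1)" "real N * (y i + 1) \<le> real N * 2" if "i < n"
      using that by (auto intro!: mult_nonneg_nonneg mult_left_mono)
    then show "real 0 \<le> \<sigma>' y i \<and> \<sigma>' y i \<le> real (Nn i)"
      by (auto simp: \<sigma>'_def Nn_def)
  qed
  have \<sigma>\<sigma>': "\<sigma> (\<sigma>' y) = y" if "y \<in> cube n" for y
    using that N by (auto simp: \<sigma>_def \<sigma>'_def cube_def)
  have \<sigma>_bd: "\<sigma> x \<in> cube_boundary n" if xb: "x \<in> ibox_boundary (\<lambda>_. 0) Nn" for x
  proof -
    obtain i where i: "0 < Nn i" "x i = 0 \<or> x i = real (Nn i)" and x: "x \<in> ibox (\<lambda>_. 0) Nn"
      using xb by (auto simp: ibox_boundary_def)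
    then have "i < n" "\<bar>\<sigma> x i\<bar> = 1" using N by (auto simp: Nn_def \<sigma>_def split: if_splits)
    then show ?thesis using \<sigma>_in[OF x] supn_eq_1_iff[of n "\<sigma> x"] by (auto simp: cube_def cube_boundary_def)
  qed
  have \<sigma>'_bd: "\<sigma>' y \<in> ibox_boundary (\<lambda>_. 0) Nn" if "y \<in> cube_boundary n" for y
  proof -
    have "supn n y = 1" "y \<in> cube n" using that by (auto simp: cube_boundary_def cube_def)
    then obtain i where "i < n" "\<bar>y i\<bar> = 1" using supn_attained[of n y] by auto
    then have "0 < Nn i" "\<sigma>' y i = 0 \<or> \<sigma>' y i = real (Nn i)"
      using N by (auto simp: Nn_def \<sigma>'_def abs_eq_iff' split: if_splits)
    then show ?thesis using \<sigma>'_in[OF \<open>y \<in> cube n\<close>] by (auto simp: ibox_boundary_def)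
  qed
  have c\<sigma>: "continuous_on S \<sigma>" for S
  proof (rule continuous_on_coordinatewise_then_product)
    show "continuous_on S (\<lambda>x. \<sigma> x i)" for i
      unfolding \<sigma>_def using N by (cases "i < n") (auto intro!: continuous_intros continuous_on_coordinate)
  qed
  have c\<sigma>': "continuous_on S \<sigma>'" for S
  proof (rule continuous_on_coordinatewise_then_product)
    show "continuous_on S (\<lambda>x. \<sigma>' x i)" for i
      unfolding \<sigma>'_def by (cases "i < n") (auto intro!: continuous_intros continuous_on_coordinate)
  qed
  have small: "(\<lambda>x. v (\<sigma> x)) ` ibox a b \<subseteq> A \<or> (\<lambda>x. v (\<sigma> x)) ` ibox a b \<subseteq> B"
    if le: "\<And>i. a i \<le> b i" and unit: "\<And>i. b i \<le> Suc (a i)" and bN: "\<And>i. b i \<le> Nn i" for a b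
  proof -
    define c where "c i = real (a i)" for i
    have c: "c \<in> ibox a b" using le by (simp add: c_def ibox_def)
    have sub: "x \<in> ibox (\<lambda>_. 0) Nn" if "x \<in> ibox a b" for x
      using ibox_subset[of b Nn a, OF bN] that by blast
    have "\<sigma> x \<in> ball (\<sigma> c) e" if "x \<in> ibox a b" for x
    proof -
      have "\<bar>\<sigma> c i - \<sigma> x i\<bar> \<le> 2 / real N" for i
      proof -
        have "real (a i) \<le> x i" "x i \<le> real (b i)" using that by (auto simp: ibox_def)
        moreover have "real (b i) \<le> real (a i) + 1" using unit[of i] by linarith
        ultimately have "\<bar>c i - x i\<bar> \<le> 1" by (simp add: c_def)
        then have "2 / real N * \<bar>c i - x i\<bar> \<le> 2 / real N * 1"
          using N by (intro mult_left_mono) auto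
        moreover have "\<sigma> c i - \<sigma> x i = 2 / real N * (c i - x i)" if "i < n"
          using that by (simp add: \<sigma>_def right_diff_distrib diff_divide_distrib)
        then have "\<bar>\<sigma> c i - \<sigma> x i\<bar> = \<bar>2 / real N\<bar> * \<bar>c i - x i\<bar>" if "i < n"
          using that by (simp only: abs_mult)
        moreover have "\<sigma> c i - \<sigma> x i = 0" if "\<not> i < n" using that by (simp add: \<sigma>_def)
        ultimately show ?thesis using N by (cases "i < n") auto
      qed
      then have "dist (\<sigma> c) (\<sigma> x) \<le> 2 * (2 / real N)" by (rule dist_fun_le)
      then show ?thesis using Ne by simp
    qed
    moreover have "\<exists>G\<in>{OA, OB}. ball (\<sigma> c) e \<subseteq> G" using e(2) \<sigma>_in[OF sub[OF c]] by blast
    ultimately consider "\<forall>x\<in>ibox a b. \<sigma> x \<in> OA" | "\<forall>x\<in>ibox a b. \<sigma> x \<in> OB" by blast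
    then show ?thesis
    proof cases
      case 1
      then have "v (\<sigma> x) \<in> A" if "x \<in> ibox a b" for x using OA(2) \<sigma>_in[OF sub[OF that]] that by blast
      then show ?thesis by blast
    next
      case 2
      then have "v (\<sigma> x) \<in> B" if "x \<in> ibox a b" for x using OB(2) \<sigma>_in[OF sub[OF that]] that by blast
      then show ?thesis by blast
    qed
  qed
  have vc: "continuous_map (top_of_set (ibox (\<lambda>_. 0) Nn)) Y (\<lambda>x. v (\<sigma> x))"
    by (rule continuous_map_top_of_set_compose[OF v c\<sigma> \<sigma>_in])
  have uc: "continuous_map (top_of_set (ibox_boundary (\<lambda>_. 0) Nn)) E (\<lambda>x. u (\<sigma> x))"
    by (rule continuous_map_top_of_set_compose[OF u c\<sigma> \<sigma>_bd])
  have Nn: "\<forall>i\<ge>n. Nn i = 0" by (simp add: Nn_def)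
  have fu: "\<forall>x\<in>ibox_boundary (\<lambda>_. 0) Nn. f (u (\<sigma> x)) = v (\<sigma> x)"
    using vu \<sigma>_bd by simp
  have small': "\<forall>a b. (\<forall>i. a i \<le> b i \<and> b i \<le> Suc (a i) \<and> b i \<le> Nn i) \<longrightarrow>
       (\<lambda>x. v (\<sigma> x)) ` ibox a b \<subseteq> A \<or> (\<lambda>x. v (\<sigma> x)) ` ibox a b \<subseteq> B"
    using small by blast
  from partial_lift_ibox[OF lift vc Nn small' uc fu]
  obtain U H where U: "continuous_map (top_of_set (ibox (\<lambda>_. 0) Nn)) E U"
    and H: "continuous_map (top_of_set (ibox (\<lambda>_. 0) Nn \<times> {0..1::real})) Y H"
    and H0: "\<forall>x\<in>ibox (\<lambda>_. 0) Nn. H (x, 0) = v (\<sigma> x) \<and> H (x, 1) = f (U x)"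
    and Uu: "\<forall>x\<in>ibox_boundary (\<lambda>_. 0) Nn. U x = u (\<sigma> x) \<and> (\<forall>t\<in>{0..1}. H (x, t) = v (\<sigma> x))"
    by (elim exE conjE) (rule that)
  show ?case
  proof (intro exI conjI ballI)
    show "continuous_map (top_of_set (cube_cap n)) E (\<lambda>z. U (\<sigma>' (fst z)))"
      using \<sigma>'_in cube_boundary_subset[of n]
      by (intro continuous_map_top_of_set_compose[OF U] continuous_on_compose2[OF c\<sigma>']
            continuous_on_fst
          continuous_on_id) (auto simp: cube_cap_def)
    show "continuous_map (top_of_set (cube n \<times> {0..1})) Y (\<lambda>z. H (\<sigma>' (fst z), snd z))"
      using \<sigma>'_in
      by (intro continuous_map_top_of_set_compose[OF H] continuous_on_basics
            continuous_on_compose2[OF c\<sigma>']) auto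
    show "H (\<sigma>' (fst (x, 0)), snd (x, 0)) = v x" if "x \<in> cube n" for x
      using H0 \<sigma>'_in[OF that] \<sigma>\<sigma>'[OF that] by simp
    show "U (\<sigma>' (fst (x, 0))) = u x" if "x \<in> cube_boundary n" for x
      using Uu \<sigma>'_bd[OF that] \<sigma>\<sigma>'[of x] that cube_boundary_subset[of n] by auto
    show "H (\<sigma>' (fst z), snd z) = f (U (\<sigma>' (fst z)))" if z: "z \<in> cube_cap n" for z
    proof -
      obtain x t where xt: "z = (x, t)" by fastforce
      consider "x \<in> cube n" "t = 1" | "x \<in> cube_boundary n" "t \<in> {0..1}"
        using z unfolding xt cube_cap_def by blast
      then show ?thesis
      proof cases
        case 1
        then show ?thesis using H0 \<sigma>'_in by (simp add: xt)
      next
        case 2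
        then have "H (\<sigma>' x, t) = v (\<sigma> (\<sigma>' x))" "f (U (\<sigma>' x)) = f (u (\<sigma> (\<sigma>' x)))"
          using Uu \<sigma>'_bd by auto
        then show ?thesis using fu \<sigma>'_bd 2 by (simp add: xt)
      qed
    qed
  qed
qed

text \<open>Over \<open>A \<union> B\<close> the two sets cover the target. The deformation obtained
  there is converted back to the relative property, so that gluing can be iterated.\<close>

lemma lifting_over_Un:
  assumes "openin Y A" "openin Y B"
    and "lifting_over E Y f A" "lifting_over E Y f B" "lifting_over E Y f (A \<inter> B)"
  shows "lifting_over E Y f (A \<union> B)"
proof -
  let ?E = "subtopology E {x \<in> topspace E. f x \<in> A \<union> B}" and ?Y = "subtopology Y (A \<union> B)"
  have *: "lifting_over ?E ?Y f W" if "lifting_over E Y f W" "W \<subseteq> A \<union> B" for W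
  proof -
    have "{x \<in> topspace E. f x \<in> A \<union> B} \<inter> {x \<in> topspace ?E. f x \<in> W} = {x \<in> topspace E. f x \<in> W}"
      using that(2) by auto
    moreover have "(A \<union> B) \<inter> W = W" using that(2) by blast
    ultimately show ?thesis
      using that(1) unfolding lifting_over_def subtopology_subtopology by simp
  qed
  have "openin ?Y A" "openin ?Y B" using assms(1,2) by (auto simp: openin_subtopology)
  then have "deformation_lifting ?E ?Y f"
    by (rule deformation_lifting_open_cover) (use assms * in auto)
  then show ?thesis
    unfolding lifting_over_def by (rule deformation_lifting_imp_relative_lifting)
qed

section \<open>Transfer of lifting along compatible deformation retractions\<close>

lemma deformation_lifting_retract:
  fixes \<eta> :: "real \<times> 'e \<Rightarrow> 'e" and \<gamma> :: "real \<times> 'y \<Rightarrow> 'y"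
  assumes \<phi>: "deformation_lifting K X \<phi>"
    and i: "continuous_map K E i" and j: "continuous_map X Y j"
    and \<rho>: "continuous_map E K \<rho>" and \<sigma>: "continuous_map Y X \<sigma>"
    and \<eta>: "continuous_map (prod_topology (top_of_set {0..1}) E) E \<eta>"
    and \<gamma>: "continuous_map (prod_topology (top_of_set {0..1}) Y) Y \<gamma>"
    and \<phi>\<rho>: "\<And>x. x \<in> topspace E \<Longrightarrow> \<phi> (\<rho> x) = \<sigma> (f x)"
    and fi: "\<And>k. k \<in> topspace K \<Longrightarrow> f (i k) = j (\<phi> k)"
    and \<eta>0: "\<And>x. x \<in> topspace E \<Longrightarrow> \<eta> (0, x) = x" and \<eta>1: "\<And>x. x \<in> topspace E \<Longrightarrow> \<eta> (1, x) = i (\<rho> x)"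
    and \<gamma>0: "\<And>y. y \<in> topspace Y \<Longrightarrow> \<gamma> (0, y) = y" and \<gamma>1: "\<And>y. y \<in> topspace Y \<Longrightarrow> \<gamma> (1, y) = j (\<sigma> y)"
    and f\<eta>: "\<And>t x. t \<in> {0..1} \<Longrightarrow> x \<in> topspace E \<Longrightarrow> f (\<eta> (t, x)) = \<gamma> (t, f x)"
  shows "deformation_lifting E Y f"
  unfolding deformation_lifting_def
proof (intro allI impI, elim conjE, goal_cases)
  case (1 n u v)
  note u = 1(1) and v = 1(2) and vu = 1(3)
  have uE: "u x \<in> topspace E" if "x \<in> cube_boundary n" for x using u that by (auto simp: continuous_map_def)
  have vY: "v x \<in> topspace Y" if "x \<in> cube n" for x using v that by (auto simp: continuous_map_def)
  have "continuous_map (top_of_set (cube_boundary n)) K (\<lambda>x. \<rho> (u x))"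
    using continuous_map_compose[OF u \<rho>] by (simp add: o_def)
  moreover have "continuous_map (top_of_set (cube n)) X (\<lambda>x. \<sigma> (v x))"
    using continuous_map_compose[OF v \<sigma>] by (simp add: o_def)
  moreover have "\<forall>x\<in>cube_boundary n. \<sigma> (v x) = \<phi> (\<rho> (u x))" using \<phi>\<rho> vu uE by simp
  ultimately obtain L H where L: "continuous_map (top_of_set (cube_cap n)) K L"
    and H: "continuous_map (top_of_set (cube n \<times> {0..1::real})) X H"
    and H0: "\<forall>x\<in>cube n. H (x, 0) = \<sigma> (v x)"
    and L0: "\<forall>x\<in>cube_boundary n. L (x, 0) = \<rho> (u x)"
    and HL: "\<forall>z\<in>cube_cap n. H z = \<phi> (L z)"
    using \<phi>[unfolded deformation_lifting_def, rule_format, of n "\<lambda>x. \<rho> (u x)" "\<lambda>x. \<sigma> (v x)"] by blast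
  have along: "continuous_map (top_of_set S) Z (\<lambda>z. \<zeta> (2 * snd z, w (fst z)))"
    if \<zeta>: "continuous_map (prod_topology (top_of_set {0..1}) Z) Z \<zeta>"
      and w: "continuous_map (top_of_set T) Z w" and S: "S \<subseteq> T \<times> {0..1/2::real}"
    for Z :: "'z topology" and \<zeta> w S and T :: "(nat \<Rightarrow> real) set"
  proof -
    have "continuous_map (top_of_set S) Z (\<lambda>z. w (fst z))"
      using S by (intro continuous_map_top_of_set_compose[OF w] continuous_on_fst continuous_on_id) auto
    moreover have "continuous_map (top_of_set S) (top_of_set {0..1}) (\<lambda>z. 2 * snd z)"
      using S by (auto simp: continuous_map_in_subtopology intro!: continuous_on_mult continuous_on_snd continuous_on_id)
    ultimately have "continuous_map (top_of_set S) (prod_topology (top_of_set {0..1}) Z) (\<lambda>z. (2 * snd z, w (fst z)))"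
      by (simp add: continuous_map_paired)
    from continuous_map_compose[OF this \<zeta>] show ?thesis by (simp add: o_def)
  qed
  \<comment> \<open>In the first half of the time the square is pushed by \<open>\<eta>\<close> and
    \<open>\<gamma>\<close>; by \<open>f\<eta>\<close> this is a map of arrows over the boundary
    throughout. The pushed square is the image under \<open>i\<close> and \<open>j\<close> of a
    square over \<phi>, whose deformation fills the second half.\<close>
  define L' where "L' z = (if z \<in> cube_boundary n \<times> {0..1/2} then \<eta> (2 * snd z, u (fst z))
      else i (L (fst z, 2 * snd z - 1)))" for z
  define H' where "H' z = (if z \<in> cube n \<times> {0..1/2} then \<gamma> (2 * snd z, v (fst z))
      else j (H (fst z, 2 * snd z - 1)))" for z
  \<comment> \<open>The part of the cap that belongs to the second half. The first half contributes
    sides only, because the cap has no bottom.\<close>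
  define S where "S = cube n \<times> {1} \<union> cube_boundary n \<times> {1/2..1::real}"
  have "continuous_map (top_of_set (cube_boundary n \<times> {0..1/2} \<union> S)) E L'"
    unfolding L'_def
  proof (rule continuous_map_top_of_set_Un)
    show "continuous_map (top_of_set (cube_boundary n \<times> {0..1/2})) E (\<lambda>z. \<eta> (2 * snd z, u (fst z)))"
      by (rule along[OF \<eta> u]) auto
    have "continuous_map (top_of_set S) K (\<lambda>z. L (fst z, 2 * snd z - 1))"
      by (intro continuous_map_top_of_set_compose[OF L] continuous_on_basics) (auto simp: S_def cube_cap_def)
    from continuous_map_compose[OF this i]
    show "continuous_map (top_of_set S) E (\<lambda>z. i (L (fst z, 2 * snd z - 1)))" by (simp add: o_def)
    show "closed S" unfolding S_def by (intro closed_Un closed_Times closed_cube closed_cube_boundary) auto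
    fix z assume "z \<in> cube_boundary n \<times> {0..1/2}" "z \<in> S"
    then obtain x where "z = (x, 1/2)" "x \<in> cube_boundary n" by (cases z) (auto simp: S_def)
    then show "\<eta> (2 * snd z, u (fst z)) = i (L (fst z, 2 * snd z - 1))"
      using \<eta>1 L0 uE by simp
  qed (intro closed_Times closed_cube_boundary closed_real_atLeastAtMost)
  moreover have "cube_boundary n \<times> {0..1/2} \<union> S = cube_cap n" by (force simp: S_def cube_cap_def)
  ultimately have L': "continuous_map (top_of_set (cube_cap n)) E L'" by simp
  have "continuous_map (top_of_set (cube n \<times> {0..1/2} \<union> cube n \<times> {1/2..1})) Y H'"
    unfolding H'_def
  proof (rule continuous_map_top_of_set_Un)
    show "continuous_map (top_of_set (cube n \<times> {0..1/2})) Y (\<lambda>z. \<gamma> (2 * snd z, v (fst z)))"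
      by (rule along[OF \<gamma> v]) auto
    have "continuous_map (top_of_set (cube n \<times> {1/2..1})) X (\<lambda>z. H (fst z, 2 * snd z - 1))"
      by (intro continuous_map_top_of_set_compose[OF H] continuous_on_basics) auto
    from continuous_map_compose[OF this j]
    show "continuous_map (top_of_set (cube n \<times> {1/2..1})) Y (\<lambda>z. j (H (fst z, 2 * snd z - 1)))" by (simp add: o_def)
    fix z assume "z \<in> cube n \<times> {0..1/2}" "z \<in> cube n \<times> {1/2..1::real}"
    then obtain x where "z = (x, 1/2)" "x \<in> cube n" by (cases z) auto
    then show "\<gamma> (2 * snd z, v (fst z)) = j (H (fst z, 2 * snd z - 1))"
      using \<gamma>1 H0 vY by simp
  qed (intro closed_Times closed_cube closed_real_atLeastAtMost)+
  moreover have "cube n \<times> {0..1/2} \<union> cube n \<times> {1/2..1} = cube n \<times> {0..1::real}" by force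
  ultimately have H': "continuous_map (top_of_set (cube n \<times> {0..1})) Y H'" by simp
  have LK: "L z \<in> topspace K" if "z \<in> cube_cap n" for z using L that by (auto simp: continuous_map_def)
  have "H' z = f (L' z)" if z: "z \<in> cube_cap n" for z
  proof (cases "z \<in> cube_boundary n \<times> {0..1/2}")
    case True
    then obtain x t where "z = (x, t)" "x \<in> cube_boundary n" "t \<in> {0..1/2}" "x \<in> cube n"
      using cube_boundary_subset[of n] by auto
    then show ?thesis using f\<eta>[of "2 * t" "u x"] vu uE by (simp add: H'_def L'_def)
  next
    case False
    then have zS: "z \<in> S" using z by (force simp: S_def cube_cap_def)
    then have nz: "z \<notin> cube n \<times> {0..1/2}" using False by (auto simp: S_def)
    have cap: "(fst z, 2 * snd z - 1) \<in> cube_cap n" using zS by (auto simp: S_def cube_cap_def)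
    show ?thesis using nz False HL cap fi[OF LK[OF cap]] by (simp add: H'_def L'_def)
  qed
  moreover have "\<forall>x\<in>cube n. H' (x, 0) = v x" using \<gamma>0 vY by (simp add: H'_def)
  moreover have "\<forall>x\<in>cube_boundary n. L' (x, 0) = u x" using \<eta>0 uE by (simp add: L'_def)
  ultimately show ?case
    using L' H' by blast
qed

subsection \<open>Finite spaces, quotients and sums\<close>

lemma topspace_poset_top [simp]: "topspace (poset_top S le) = S"
proof (rule antisym)
  show "topspace (poset_top S le) \<subseteq> S"
    using openin_poset_top[of S le "topspace (poset_top S le)"] by auto
  have "openin (poset_top S le) S" by (simp add: openin_poset_top)
  then show "S \<subseteq> topspace (poset_top S le)" by (rule openin_subset)
qed

lemma continuous_map_poset_top:
  assumes "\<And>x. x \<in> S \<Longrightarrow> h x \<in> S'" "\<And>x y. x \<in> S \<Longrightarrow> y \<in> S \<Longrightarrow> le y x \<Longrightarrow> le' (h y) (h x)"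
  shows "continuous_map (poset_top S le) (poset_top S' le') h"
  using assms unfolding continuous_map_def by (auto simp: openin_poset_top)

lemma subtopology_poset_top:
  assumes V: "openin (poset_top S le) V"
  shows "subtopology (poset_top S le) V = poset_top V le"
proof -
  have VS: "V \<subseteq> S" "\<And>x y. x \<in> V \<Longrightarrow> y \<in> S \<Longrightarrow> le y x \<Longrightarrow> y \<in> V"
    using V by (auto simp: openin_poset_top)
  show ?thesis
    unfolding topology_eq openin_open_subtopology[OF V]
    unfolding openin_poset_top using VS by blast
qed

lemma topspace_quot_top [simp]: "topspace (quot_top X q) = q ` topspace X"
proof (rule antisym)
  show "topspace (quot_top X q) \<subseteq> q ` topspace X"
    using openin_quot_top[of X q "topspace (quot_top X q)"] by auto
  have "{x \<in> topspace X. q x \<in> q ` topspace X} = topspace X" by auto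
  then have "openin (quot_top X q) (q ` topspace X)" by (simp add: openin_quot_top)
  then show "q ` topspace X \<subseteq> topspace (quot_top X q)" by (rule openin_subset)
qed

lemma quotient_map_quot_top: "quotient_map X (quot_top X q) q"
  unfolding quotient_map_def by (auto simp: openin_quot_top)

lemma continuous_map_from_sum_topology:
  assumes "\<And>i. i \<in> I \<Longrightarrow> continuous_map (X i) Y (\<lambda>x. f (i, x))"
  shows "continuous_map (sum_topology X I) Y f"
  unfolding continuous_map_def
proof (intro conjI allI impI)
  show "f \<in> topspace (sum_topology X I) \<rightarrow> topspace Y"
    using assms[THEN continuous_map_image_subset_topspace] by (fastforce simp: image_subset_iff)
  fix U assume U: "openin Y U"
  show "openin (sum_topology X I) {x \<in> topspace (sum_topology X I). f x \<in> U}"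
    unfolding openin_sum_topology
  proof (intro conjI ballI)
    fix i assume i: "i \<in> I"
    have "{x. (i, x) \<in> {x \<in> topspace (sum_topology X I). f x \<in> U}} = {x \<in> topspace (X i). f (i, x) \<in> U}"
      using i by auto
    then show "openin (X i) {x. (i, x) \<in> {x \<in> topspace (sum_topology X I). f x \<in> U}}"
      using openin_continuous_map_preimage[OF assms[OF i] U] by simp
  qed auto
qed

text \<open>Each summand of a sum is open, so its product with \<open>Z\<close> is open and
  continuity can be checked there.\<close>

lemma continuous_map_from_prod_sum_topology:
  assumes "\<And>i. i \<in> I \<Longrightarrow> continuous_map (prod_topology Z (X i)) Y (\<lambda>w. f (fst w, (i, snd w)))"
  shows "continuous_map (prod_topology Z (sum_topology X I)) Y f"
proof (rule pasting_lemma[where I = I and T = "\<lambda>i. topspace Z \<times> ({i} \<times> topspace (X i))" and f = "\<lambda>_. f"])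
  have opn: "openin (sum_topology X I) ({i} \<times> U)" if "i \<in> I" "openin (X i) U" for i U
  proof -
    have "{i} \<times> U = (\<lambda>x. (i, x)) ` U" by auto
    then show ?thesis
      using open_map_component_injection[OF that(1), of X] that(2) by (simp add: open_map_def)
  qed
  show "openin (prod_topology Z (sum_topology X I)) (topspace Z \<times> ({i} \<times> topspace (X i)))" if "i \<in> I" for i
    using opn[OF that] by (simp add: openin_prod_Times_iff)
  show "continuous_map (subtopology (prod_topology Z (sum_topology X I)) (topspace Z \<times> ({i} \<times> topspace (X i)))) Y f"
    if i: "i \<in> I" for i
  proof -
    let ?T = "subtopology (sum_topology X I) ({i} \<times> topspace (X i))"
    have "continuous_map ?T (X i) snd"
      unfolding continuous_map_def
    proof (intro conjI allI impI)
      fix U assume U: "openin (X i) U"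
      have "{x \<in> topspace ?T. snd x \<in> U} = {i} \<times> U" using i openin_subset[OF U] by auto
      moreover have "openin ?T ({i} \<times> U)"
        using opn[OF i U] openin_subset[OF U] by (auto simp: openin_subtopology)
      ultimately show "openin ?T {x \<in> topspace ?T. snd x \<in> U}" by simp
    qed auto
    then have "continuous_map (prod_topology Z ?T) (X i) (\<lambda>w. snd (snd w))"
      using continuous_map_compose[OF continuous_map_snd] by (fastforce simp: o_def)
    then have "continuous_map (prod_topology Z ?T) (prod_topology Z (X i)) (\<lambda>w. (fst w, snd (snd w)))"
      using continuous_map_fst by (simp add: continuous_map_paired)
    from continuous_map_compose[OF this assms[OF i]]
    have "continuous_map (prod_topology Z ?T) Y (\<lambda>w. f (fst w, (i, snd (snd w))))"
      by (simp add: o_def)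
    then have "continuous_map (prod_topology Z ?T) Y f"
      by (rule continuous_map_eq) auto
    then show ?thesis
      by (simp add: prod_topology_subtopology subtopology_subtopology Times_Int_Times flip: subtopology_topspace)
  qed
qed auto

subsection \<open>Barycentric coordinates on chains\<close>

lemma finite_upset: "finite P \<Longrightarrow> finite (upset P p)"
  by (simp add: upset_def)

definition min_support :: "('p::order \<Rightarrow> real) \<Rightarrow> 'p" where
  "min_support \<beta> = (THE m. \<beta> m \<noteq> 0 \<and> (\<forall>r. \<beta> r \<noteq> 0 \<longrightarrow> m \<le> r))"

lemma min_supportI:
  assumes "\<beta> m \<noteq> 0" "\<And>r. \<beta> r \<noteq> 0 \<Longrightarrow> m \<le> r"
  shows "min_support \<beta> = m"
  unfolding min_support_def using assms by (intro the_equality) (auto intro: antisym)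

text \<open>The support is a nonempty finite chain, so a minimal element of it is least.\<close>

lemma min_support:
  assumes \<beta>: "\<beta> \<in> order_complex_points Q" and "finite Q"
  shows "min_support \<beta> \<in> Q" "\<beta> (min_support \<beta>) > 0" "\<beta> r \<noteq> 0 \<Longrightarrow> min_support \<beta> \<le> r"
proof -
  define S where "S = {q. \<beta> q \<noteq> 0}"
  have SQ: "S \<subseteq> Q" using \<beta> by (auto simp: S_def order_complex_points_def)
  have "S \<noteq> {}"
  proof
    assume "S = {}"
    then have "sum \<beta> Q = 0" by (auto simp: S_def)
    then show False using \<beta> by (simp add: order_complex_points_def)
  qed
  then obtain m where m: "m \<in> S" "\<forall>b\<in>S. b \<le> m \<longrightarrow> m = b"
    using finite_has_minimal[of S] finite_subset[OF SQ \<open>finite Q\<close>] by blast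
  have least: "m \<le> r" if "\<beta> r \<noteq> 0" for r
  proof -
    have "m \<le> r \<or> r \<le> m" using \<beta> m(1) that by (auto simp: order_complex_points_def S_def)
    then show ?thesis using m(2) that by (auto simp: S_def)
  qed
  have eq: "min_support \<beta> = m" by (rule min_supportI) (use m(1) least in \<open>auto simp: S_def\<close>)
  show "min_support \<beta> \<in> Q" using eq m(1) SQ by auto
  have "0 \<le> \<beta> m" using \<beta> by (simp add: order_complex_points_def)
  then show "\<beta> (min_support \<beta>) > 0" using eq m(1) by (simp add: S_def)
  show "\<beta> r \<noteq> 0 \<Longrightarrow> min_support \<beta> \<le> r" using eq least by simp
qed

lemma topspace_order_complex [simp]: "topspace (order_complex Q) = order_complex_points Q"
  by (simp add: order_complex_def)

definition vertex :: "'p \<Rightarrow> 'p \<Rightarrow> real" where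
  "vertex r = (\<lambda>s. if s = r then 1 else 0)"

lemma vertex_in_order_complex: "r \<in> Q \<Longrightarrow> finite Q \<Longrightarrow> vertex r \<in> order_complex_points Q"
  by (auto simp: order_complex_points_def vertex_def split: if_splits)

lemma min_support_vertex: "min_support (vertex r) = r"
  by (rule min_supportI) (auto simp: vertex_def split: if_splits)

text \<open>During the first half of the time the coordinates not below \<open>r\<close> are faded out, so that in the
  second half the remaining chain lies below \<open>r\<close> and can be contracted to the vertex \<open>r\<close>.\<close>

definition slide_weight :: "'p::order \<Rightarrow> real \<Rightarrow> ('p \<Rightarrow> real) \<Rightarrow> 'p \<Rightarrow> real" where
  "slide_weight r t \<beta> s = \<beta> s * (if s \<le> r then min 1 (2 - 2 * t) else max 0 (1 - 2 * t))
     + (if s = r then max 0 (2 * t - 1) else 0)"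

text \<open>The normalization runs over all of \<open>P\<close>, so the formula depends on \<beta>
  but not on the index of the summand in which \<beta> is considered. This makes it compatible with
  the identifications in the homotopy colimit.\<close>

definition slide :: "'p::order set \<Rightarrow> 'p \<Rightarrow> real \<Rightarrow> ('p \<Rightarrow> real) \<Rightarrow> 'p \<Rightarrow> real" where
  "slide P r t \<beta> s = slide_weight r t \<beta> s / (\<Sum>s'\<in>P. slide_weight r t \<beta> s')"

lemma slide_weight_nonneg: "0 \<le> \<beta> s \<Longrightarrow> t \<in> {0..1} \<Longrightarrow> 0 \<le> slide_weight r t \<beta> s"
  by (auto simp: slide_weight_def intro!: add_nonneg_nonneg mult_nonneg_nonneg)

context
  fixes P :: "'p::order set" and p r :: 'p and \<beta> :: "'p \<Rightarrow> real" and t :: real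
  assumes fin: "finite P" and p: "p \<in> P" and r: "r \<in> P"
    and \<beta>: "\<beta> \<in> order_complex_points (upset P p)" and m: "min_support \<beta> \<le> r" and t: "t \<in> {0..1}"
begin

lemmas ms = min_support[OF \<beta> finite_upset[OF fin]]

lemma le_min_support: "p \<le> min_support \<beta>"
  using ms(1) by (simp add: upset_def)

lemma coord_nonneg: "0 \<le> \<beta> s"
  using \<beta> by (simp add: order_complex_points_def)

lemma slide_weight_min_pos: "t < 1 \<Longrightarrow> 0 < slide_weight r t \<beta> (min_support \<beta>)"
  using ms(2) m t by (auto simp: slide_weight_def intro!: add_pos_nonneg mult_pos_pos)

text \<open>Before \<open>t = 1\<close> the least element of the support lies below \<open>r\<close>
  and keeps a positive weight; at \<open>t = 1\<close> the element \<open>r\<close> itself has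
  weight 1.\<close>

lemma sum_slide_weight_pos: "0 < (\<Sum>s\<in>P. slide_weight r t \<beta> s)"
proof (cases "t < 1")
  case True
  then show ?thesis
    using slide_weight_min_pos ms(1) coord_nonneg t fin
    by (intro sum_pos2[of P "min_support \<beta>"]) (auto simp: upset_def intro!: slide_weight_nonneg)
next
  case False
  then have "t = 1" using t by auto
  then have "slide_weight r t \<beta> r = 1" by (simp add: slide_weight_def)
  then show ?thesis
    using r coord_nonneg t fin by (intro sum_pos2[of P r]) (auto intro!: slide_weight_nonneg)
qed

lemma slide_eq_0_iff: "slide P r t \<beta> s = 0 \<longleftrightarrow> slide_weight r t \<beta> s = 0"
  using sum_slide_weight_pos by (simp add: slide_def)

lemma slide_weight_neq_0D:
  assumes "slide_weight r t \<beta> s \<noteq> 0"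
  shows "\<beta> s \<noteq> 0 \<or> s = r" "t \<ge> 1 / 2 \<Longrightarrow> s \<le> r" "t \<le> 1 / 2 \<Longrightarrow> \<beta> s \<noteq> 0"
  using assms by (auto simp: slide_weight_def split: if_splits)

text \<open>Up to \<open>t = 1 / 2\<close> no coordinate outside the old support becomes nonzero;
  afterwards every surviving element is at most \<open>r\<close>, so a chain remains a chain when
  \<open>r\<close> joins it.\<close>

lemma slide_in: "slide P r t \<beta> \<in> order_complex_points (upset P p)"
proof -
  have pr: "p \<le> r" using le_min_support m by simp
  have z: "slide P r t \<beta> s = 0" if "s \<notin> upset P p" for s
  proof -
    have "\<beta> s = 0" "s \<noteq> r" using that \<beta> r pr by (auto simp: order_complex_points_def upset_def)
    then show ?thesis using slide_weight_neq_0D(1)[of s] slide_eq_0_iff by blast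
  qed
  have "(\<Sum>s\<in>upset P p. slide P r t \<beta> s) = (\<Sum>s\<in>P. slide P r t \<beta> s)"
    using fin z by (intro sum.mono_neutral_left) (auto simp: upset_def)
  also have "\<dots> = 1"
    using sum_slide_weight_pos unfolding slide_def by (simp flip: sum_divide_distrib)
  finally have s1: "(\<Sum>s\<in>upset P p. slide P r t \<beta> s) = 1" .
  have nn: "0 \<le> slide P r t \<beta> s" for s
    using sum_slide_weight_pos slide_weight_nonneg[of \<beta> s t r] coord_nonneg t by (simp add: slide_def)
  have "s \<le> s' \<or> s' \<le> s" if "slide P r t \<beta> s \<noteq> 0" "slide P r t \<beta> s' \<noteq> 0" for s s'
  proof -
    have w: "slide_weight r t \<beta> s \<noteq> 0" "slide_weight r t \<beta> s' \<noteq> 0" using that slide_eq_0_iff by auto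
    have chain: "s \<le> s' \<or> s' \<le> s" if "\<beta> s \<noteq> 0" "\<beta> s' \<noteq> 0"
      using \<beta> that by (auto simp: order_complex_points_def)
    show ?thesis
    proof (cases "t \<le> 1 / 2")
      case True
      then show ?thesis using slide_weight_neq_0D(3)[OF w(1)] slide_weight_neq_0D(3)[OF w(2)] chain by blast
    next
      case False
      then show ?thesis
        using slide_weight_neq_0D(1,2)[OF w(1)] slide_weight_neq_0D(1,2)[OF w(2)] chain by auto
    qed
  qed
  then show ?thesis using z s1 nn by (auto simp: order_complex_points_def)
qed

text \<open>The least element keeps a positive weight, and the only element that can join the
  support is \<open>r\<close>, which lies above it. The image under the comparison map therefore
  stands still until the final moment.\<close>

lemma min_support_slide: "t < 1 \<Longrightarrow> min_support (slide P r t \<beta>) = min_support \<beta>"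
  using slide_weight_min_pos slide_weight_neq_0D(1) ms(3) m
  by (intro min_supportI) (force simp: slide_eq_0_iff)+

end

lemma slide_0:
  assumes "finite P" "\<beta> \<in> order_complex_points (upset P p)"
  shows "slide P r 0 \<beta> = \<beta>"
proof -
  have w: "slide_weight r 0 \<beta> = \<beta>" by (auto simp: slide_weight_def)
  have "sum \<beta> P = sum \<beta> (upset P p)"
    using assms by (intro sum.mono_neutral_right) (auto simp: order_complex_points_def upset_def)
  then have "sum \<beta> P = 1" using assms(2) by (simp add: order_complex_points_def)
  then show ?thesis by (auto simp: slide_def w)
qed

lemma slide_1:
  assumes "finite P" "r \<in> P"
  shows "slide P r 1 \<beta> = vertex r"
proof -
  have w: "slide_weight r 1 \<beta> = vertex r" by (auto simp: slide_weight_def vertex_def)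
  have "sum (vertex r) P = 1" using assms by (simp add: vertex_def)
  then show ?thesis by (auto simp: slide_def w)
qed

subsection \<open>The comparison map\<close>

context
  fixes P :: "'p::order set"
    and Kt :: "'p \<Rightarrow> 'a topology" and Km :: "'p \<Rightarrow> 'p \<Rightarrow> 'a \<Rightarrow> 'a"
    and Xs :: "'p \<Rightarrow> 'b set" and Xle :: "'p \<Rightarrow> 'b \<Rightarrow> 'b \<Rightarrow> bool" and g :: "'p \<Rightarrow> 'p \<Rightarrow> 'b \<Rightarrow> 'b"
    and \<phi> :: "'p \<Rightarrow> 'a \<Rightarrow> 'b"
  assumes fin: "finite P"
    and K: "space_diagram P Kt Km"
    and X: "poset_diagram P Xs Xle g"
    and \<phi>: "\<forall>p\<in>P. continuous_map (Kt p) (poset_top (Xs p) (Xle p)) (\<phi> p)"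
    and nat: "\<forall>p\<in>P. \<forall>q\<in>P. p \<le> q \<longrightarrow> (\<forall>\<alpha>\<in>topspace (Kt p). \<phi> q (Km p q \<alpha>) = g p q (\<phi> p \<alpha>))"
    and whe: "\<forall>p\<in>P. weak_homotopy_equivalence (Kt p) (poset_top (Xs p) (Xle p)) (\<phi> p)"
begin

lemma Km_cont: "p \<in> P \<Longrightarrow> q \<in> P \<Longrightarrow> p \<le> q \<Longrightarrow> continuous_map (Kt p) (Kt q) (Km p q)"
  using K by (simp add: space_diagram_def)

lemma Km_in: "p \<in> P \<Longrightarrow> q \<in> P \<Longrightarrow> p \<le> q \<Longrightarrow> \<alpha> \<in> topspace (Kt p) \<Longrightarrow> Km p q \<alpha> \<in> topspace (Kt q)"
  using continuous_map_image_subset_topspace[OF Km_cont[of p q]] by (simp add: image_subset_iff)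

lemma Km_comp: "p \<in> P \<Longrightarrow> q \<in> P \<Longrightarrow> r \<in> P \<Longrightarrow> p \<le> q \<Longrightarrow> q \<le> r \<Longrightarrow> \<alpha> \<in> topspace (Kt p) \<Longrightarrow>
    Km q r (Km p q \<alpha>) = Km p r \<alpha>"
  using K by (simp add: space_diagram_def)

lemma Km_refl: "p \<in> P \<Longrightarrow> \<alpha> \<in> topspace (Kt p) \<Longrightarrow> Km p p \<alpha> = \<alpha>"
  using K by (simp add: space_diagram_def)

lemma \<phi>_in: "p \<in> P \<Longrightarrow> \<alpha> \<in> topspace (Kt p) \<Longrightarrow> \<phi> p \<alpha> \<in> Xs p"
  using continuous_map_image_subset_topspace[OF \<phi>[rule_format, of p]] by (simp add: image_subset_iff)

lemma Xle_refl: "p \<in> P \<Longrightarrow> x \<in> Xs p \<Longrightarrow> Xle p x x"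
  using X by (simp add: poset_diagram_def finite_poset_def)

lemma Xle_trans: "p \<in> P \<Longrightarrow> x \<in> Xs p \<Longrightarrow> y \<in> Xs p \<Longrightarrow> z \<in> Xs p \<Longrightarrow> Xle p x y \<Longrightarrow> Xle p y z \<Longrightarrow> Xle p x z"
proof -
  assume p: "p \<in> P"
  then have "finite_poset (Xs p) (Xle p)" using X by (simp add: poset_diagram_def)
  then show "x \<in> Xs p \<Longrightarrow> y \<in> Xs p \<Longrightarrow> z \<in> Xs p \<Longrightarrow> Xle p x y \<Longrightarrow> Xle p y z \<Longrightarrow> Xle p x z"
    unfolding finite_poset_def by blast
qed

lemma g_in: "p \<in> P \<Longrightarrow> q \<in> P \<Longrightarrow> p \<le> q \<Longrightarrow> x \<in> Xs p \<Longrightarrow> g p q x \<in> Xs q"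
  using X by (simp add: poset_diagram_def image_subset_iff)

lemma g_mono: "p \<in> P \<Longrightarrow> q \<in> P \<Longrightarrow> p \<le> q \<Longrightarrow> x \<in> Xs p \<Longrightarrow> y \<in> Xs p \<Longrightarrow> Xle p x y \<Longrightarrow> Xle q (g p q x) (g p q y)"
  using X by (simp add: poset_diagram_def)

lemma g_refl: "p \<in> P \<Longrightarrow> x \<in> Xs p \<Longrightarrow> g p p x = x"
  using X by (simp add: poset_diagram_def)

lemma g_comp: "p \<in> P \<Longrightarrow> q \<in> P \<Longrightarrow> r \<in> P \<Longrightarrow> p \<le> q \<Longrightarrow> q \<le> r \<Longrightarrow> x \<in> Xs p \<Longrightarrow>
    g q r (g p q x) = g p r x"
  using X by (simp add: poset_diagram_def)

lemma \<phi>_nat: "p \<in> P \<Longrightarrow> q \<in> P \<Longrightarrow> p \<le> q \<Longrightarrow> \<alpha> \<in> topspace (Kt p) \<Longrightarrow> \<phi> q (Km p q \<alpha>) = g p q (\<phi> p \<alpha>)"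
  using nat by blast

lemmas finite_upsets = finite_upset[OF fin]

abbreviation (input) "hc \<equiv> hocolim P Kt Km"
abbreviation (input) "cls \<equiv> \<lambda>x. hocolim_equiv P Kt Km `` {x}"
abbreviation (input) "nh \<equiv> nh_hocolim P Xs Xle g"
abbreviation (input) "pre \<equiv> hocolim_pre P Kt"
abbreviation (input) "coords p \<equiv> order_complex_points (upset P p)"

definition over :: "'p set \<Rightarrow> ('p \<times> 'b) set" where
  "over D = {y \<in> Sigma P Xs. fst y \<in> D}"

lemma topspace_nh: "topspace nh = Sigma P Xs"
  by (simp add: nh_hocolim_def)

lemma topspace_pre: "topspace pre = (SIGMA p:P. topspace (Kt p) \<times> coords p)"
  by (auto simp: hocolim_pre_def)

lemma pre_memD:
  assumes "(p, \<alpha>, \<beta>) \<in> topspace pre"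
  shows "p \<in> P" "\<alpha> \<in> topspace (Kt p)" "\<beta> \<in> coords p"
    "min_support \<beta> \<in> P" "p \<le> min_support \<beta>"
proof -
  show *: "p \<in> P" "\<alpha> \<in> topspace (Kt p)" "\<beta> \<in> coords p"
    using assms by (auto simp: topspace_pre)
  show "min_support \<beta> \<in> P" "p \<le> min_support \<beta>"
    using min_support(1)[OF *(3) finite_upsets] by (auto simp: upset_def)
qed

lemma quotient_map_cls: "quotient_map pre hc cls"
  unfolding hocolim_def by (rule quotient_map_quot_top)

lemma cls_in: "x \<in> topspace pre \<Longrightarrow> cls x \<in> topspace hc"
  using quotient_imp_surjective_map[OF quotient_map_cls] by blast

lemma equiv_sym: "sym (hocolim_equiv P Kt Km)"
  unfolding hocolim_equiv_def by (intro sym_rtrancl) (auto simp: sym_def)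

lemma cls_eqI:
  assumes "(x, y) \<in> hocolim_rel P Kt Km"
  shows "cls x = cls y"
proof -
  have xy: "(x, y) \<in> hocolim_equiv P Kt Km" using assms by (auto simp: hocolim_equiv_def)
  then have yx: "(y, x) \<in> hocolim_equiv P Kt Km" using equiv_sym by (rule symD[rotated])
  have trans: "trans (hocolim_equiv P Kt Km)" by (simp add: hocolim_equiv_def trans_rtrancl)
  show ?thesis using xy yx trans by (auto dest: transD)
qed

text \<open>A function compatible with the generating relation is constant along the zigzags of
  which the equivalence consists.\<close>

lemma cls_eqD:
  assumes eq: "cls x = cls y"
    and h: "\<And>p p' \<alpha> \<beta>. p \<in> P \<Longrightarrow> p' \<in> P \<Longrightarrow> p \<le> p' \<Longrightarrow> \<alpha> \<in> topspace (Kt p) \<Longrightarrow>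
        \<beta> \<in> coords p' \<Longrightarrow> h (p, \<alpha>, \<beta>) = h (p', Km p p' \<alpha>, \<beta>)"
  shows "h x = h y"
proof -
  have "(y, y) \<in> hocolim_equiv P Kt Km" by (simp add: hocolim_equiv_def)
  then have "(x, y) \<in> hocolim_equiv P Kt Km" using eq by blast
  then have "(x, y) \<in> (hocolim_rel P Kt Km \<union> (hocolim_rel P Kt Km)\<inverse>)\<^sup>*" by (simp add: hocolim_equiv_def)
  then show ?thesis
  proof induction
    case (step y z)
    then have "h y = h z" using h by (auto simp: hocolim_rel_def)
    then show ?case using step by simp
  qed simp
qed

lemma rel_min_support:
  assumes "p' \<in> P" "\<beta> \<in> coords p'"
  shows "min_support \<beta> \<in> P" "p' \<le> min_support \<beta>"
  using min_support(1)[OF assms(2) finite_upsets] by (auto simp: upset_def)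

definition compare_pre :: "'p \<times> ('a \<times> ('p \<Rightarrow> real)) \<Rightarrow> 'p \<times> 'b" where
  "compare_pre = (\<lambda>(p, \<alpha>, \<beta>). (min_support \<beta>, \<phi> (min_support \<beta>) (Km p (min_support \<beta>) \<alpha>)))"

lemma compare_pre_in: "x \<in> topspace pre \<Longrightarrow> compare_pre x \<in> Sigma P Xs"
  using pre_memD[of "fst x" "fst (snd x)" "snd (snd x)"]
  by (simp add: compare_pre_def case_prod_unfold Km_in \<phi>_in)

text \<open>The least element of the support lies below \<open>r\<close> iff some element of the
  support does, and each condition \<open>\<beta> s > 0\<close> is open.\<close>

lemma openin_min_support_le:
  "openin (order_complex (upset P p)) {\<beta> \<in> coords p. min_support \<beta> \<le> r}"
proof -
  have c: "continuous_map (order_complex (upset P p)) euclideanreal (\<lambda>\<beta>. \<beta> s)" for s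
    unfolding order_complex_def
    by (intro continuous_map_from_subtopology continuous_map_product_projection) simp
  have opn: "openin (order_complex (upset P p)) {\<beta> \<in> coords p. \<beta> s \<in> {0<..}}" for s
    using openin_continuous_map_preimage[OF c[of s], of "{0<..}"] by simp
  have "{\<beta> \<in> coords p. min_support \<beta> \<le> r} =
     (\<Union>s\<in>{s. s \<le> r}. {\<beta> \<in> coords p. \<beta> s \<in> {0<..}})"
  proof (intro equalityI subsetI)
    fix \<beta> assume "\<beta> \<in> {\<beta> \<in> coords p. min_support \<beta> \<le> r}"
    then show "\<beta> \<in> (\<Union>s\<in>{s. s \<le> r}. {\<beta> \<in> coords p. \<beta> s \<in> {0<..}})"
      using min_support(2)[of \<beta> "upset P p"] finite_upsets by auto
  next
    fix \<beta> assume "\<beta> \<in> (\<Union>s\<in>{s. s \<le> r}. {\<beta> \<in> coords p. \<beta> s \<in> {0<..}})"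
    then obtain s where s: "s \<le> r" "\<beta> \<in> coords p" "\<beta> s > 0" by auto
    then have "min_support \<beta> \<le> s" using min_support(3)[OF s(2) finite_upsets, of s] by simp
    then show "\<beta> \<in> {\<beta> \<in> coords p. min_support \<beta> \<le> r}" using s by auto
  qed
  then show ?thesis using opn by auto
qed

text \<open>On each summand the preimage of a down-set is a union of open boxes. A point lies in the
  box belonging to its own image; conversely, naturality of \<phi> puts the image of any point of
  the box for \<open>(r, y)\<close> below \<open>(r, y)\<close>.\<close>

lemma continuous_compare_pre: "continuous_map pre nh compare_pre"
  unfolding hocolim_pre_def
proof (rule continuous_map_from_sum_topology)
  fix p assume p: "p \<in> P"
  let ?S = "topspace (Kt p)" and ?T = "coords p"
  let ?Z = "prod_topology (Kt p) (order_complex (upset P p))"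
  show "continuous_map ?Z nh (\<lambda>x. compare_pre (p, x))"
    unfolding continuous_map_def
  proof (intro conjI allI impI)
    show "(\<lambda>x. compare_pre (p, x)) \<in> topspace ?Z \<rightarrow> topspace nh"
      using compare_pre_in p by (auto simp: topspace_nh topspace_pre)
    fix U assume "openin nh U"
    then have U: "U \<subseteq> Sigma P Xs" "\<And>x y. x \<in> U \<Longrightarrow> y \<in> Sigma P Xs \<Longrightarrow> nh_hocolim_le P Xle g y x \<Longrightarrow> y \<in> U"
      by (auto simp: nh_hocolim_def openin_poset_top)
    define A where "A r y = {\<alpha> \<in> ?S. \<phi> r (Km p r \<alpha>) \<in> {y' \<in> Xs r. Xle r y' y}}" for r y
    define B where "B r = {\<beta> \<in> ?T. min_support \<beta> \<le> r}" for r
    have A_open: "openin (Kt p) (A r y)" if r: "(r, y) \<in> U" "p \<le> r" for r y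
    proof -
      have ry: "r \<in> P" "y \<in> Xs r" using U(1) r by auto
      have "openin (poset_top (Xs r) (Xle r)) {y' \<in> Xs r. Xle r y' y}"
        using Xle_trans[OF ry(1)] ry(2) unfolding openin_poset_top by blast
      moreover have "continuous_map (Kt p) (poset_top (Xs r) (Xle r)) (\<phi> r \<circ> Km p r)"
        using Km_cont[OF p ry(1) r(2)] \<phi> ry(1) by (intro continuous_map_compose) auto
      ultimately have "openin (Kt p) {\<alpha> \<in> ?S. (\<phi> r \<circ> Km p r) \<alpha> \<in> {y' \<in> Xs r. Xle r y' y}}"
        by (rule openin_continuous_map_preimage[rotated])
      then show ?thesis by (simp only: A_def o_apply)
    qed
    have "{x \<in> topspace ?Z. compare_pre (p, x) \<in> U} = (\<Union>(r, y)\<in>{z \<in> U. p \<le> fst z}. A r y \<times> B r)"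
    proof (intro equalityI subsetI)
      fix x assume x: "x \<in> {x \<in> topspace ?Z. compare_pre (p, x) \<in> U}"
      obtain \<alpha> \<beta> where ab: "x = (\<alpha>, \<beta>)" "\<alpha> \<in> ?S" "\<beta> \<in> ?T" using x by auto
      define m where "m = min_support \<beta>"
      have m: "m \<in> P" "p \<le> m" using rel_min_support[OF p ab(3)] by (auto simp: m_def)
      have "(m, \<phi> m (Km p m \<alpha>)) \<in> U" using x by (simp add: compare_pre_def ab m_def)
      moreover have "\<phi> m (Km p m \<alpha>) \<in> Xs m" using \<phi>_in Km_in p m ab by simp
      then have "\<alpha> \<in> A m (\<phi> m (Km p m \<alpha>))" using ab Xle_refl m by (simp add: A_def)
      moreover have "\<beta> \<in> B m" using ab by (simp add: B_def m_def)
      ultimately show "x \<in> (\<Union>(r, y)\<in>{z \<in> U. p \<le> fst z}. A r y \<times> B r)"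
        using m ab by (intro UN_I[of "(m, \<phi> m (Km p m \<alpha>))"]) auto
    next
      fix x assume "x \<in> (\<Union>(r, y)\<in>{z \<in> U. p \<le> fst z}. A r y \<times> B r)"
      then obtain r y where ry: "(r, y) \<in> U" "p \<le> r" "x \<in> A r y \<times> B r" by auto
      then obtain \<alpha> \<beta> where ab: "x = (\<alpha>, \<beta>)" "\<alpha> \<in> ?S" "\<beta> \<in> ?T" "Xle r (\<phi> r (Km p r \<alpha>)) y" "min_support \<beta> \<le> r"
        by (auto simp: A_def B_def)
      define m where "m = min_support \<beta>"
      have m: "m \<in> P" "p \<le> m" "m \<le> r" using rel_min_support[OF p ab(3)] ab by (auto simp: m_def)
      have r: "r \<in> P" using ry U(1) by auto
      have "g m r (\<phi> m (Km p m \<alpha>)) = \<phi> r (Km m r (Km p m \<alpha>))"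
        using \<phi>_nat[of m r "Km p m \<alpha>"] Km_in p m r ab by simp
      also have "\<dots> = \<phi> r (Km p r \<alpha>)" using Km_comp[of p m r \<alpha>] p m r ab by simp
      finally have "nh_hocolim_le P Xle g (m, \<phi> m (Km p m \<alpha>)) (r, y)"
        using ab m by (simp add: nh_hocolim_le_def)
      moreover have "(m, \<phi> m (Km p m \<alpha>)) \<in> Sigma P Xs" using \<phi>_in Km_in p m ab by simp
      ultimately have "(m, \<phi> m (Km p m \<alpha>)) \<in> U" using U(2) ry(1) by blast
      then show "x \<in> {x \<in> topspace ?Z. compare_pre (p, x) \<in> U}" using ab by (simp add: compare_pre_def m_def)
    qed
    moreover have "openin ?Z (A r y \<times> B r)" if "(r, y) \<in> U" "p \<le> r" for r y
      using A_open[OF that] openin_min_support_le[of p r] by (simp add: openin_prod_Times_iff B_def)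
    ultimately show "openin ?Z {x \<in> topspace ?Z. compare_pre (p, x) \<in> U}" by auto
  qed
qed

lemma compare_pre_respects: "cls x = cls y \<Longrightarrow> compare_pre x = compare_pre y"
proof (erule cls_eqD)
  fix p p' \<alpha> \<beta>
  assume *: "p \<in> P" "p' \<in> P" "p \<le> p'" "\<alpha> \<in> topspace (Kt p)" "\<beta> \<in> coords p'"
  then show "compare_pre (p, \<alpha>, \<beta>) = compare_pre (p', Km p p' \<alpha>, \<beta>)"
    using rel_min_support[OF *(2,5)] by (simp add: compare_pre_def Km_comp)
qed

lemma compare_exists: "\<exists>\<psi>. continuous_map hc nh \<psi> \<and> (\<forall>x\<in>topspace pre. \<psi> (cls x) = compare_pre x)"
proof (rule quotient_map_lift_exists[OF quotient_map_cls continuous_compare_pre])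
  fix \<psi> assume "continuous_map hc nh \<psi>" "\<And>x. x \<in> topspace pre \<Longrightarrow> \<psi> (cls x) = compare_pre x"
  then show ?thesis by (intro exI[of _ \<psi>] conjI ballI)
qed (rule compare_pre_respects)

lemma openin_over:
  assumes "\<And>q r. q \<in> P \<Longrightarrow> r \<in> D \<Longrightarrow> q \<le> r \<Longrightarrow> q \<in> D"
  shows "openin nh (over D)"
  unfolding nh_hocolim_def openin_poset_top over_def
  using assms by (auto simp: nh_hocolim_le_def)

section \<open>The part over a principal down-set\<close>

context
  fixes \<psi> :: "('p \<times> ('a \<times> ('p \<Rightarrow> real))) set \<Rightarrow> 'p \<times> 'b" and r :: 'p
  assumes \<psi>: "continuous_map hc nh \<psi>"
    and \<psi>_cls: "\<forall>x\<in>topspace pre. \<psi> (cls x) = compare_pre x"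
    and r: "r \<in> P"
begin

abbreviation (input) "slice p \<equiv> topspace (Kt p) \<times> {\<beta> \<in> coords p. min_support \<beta> \<le> r}"
abbreviation (input) "below \<equiv> over {q \<in> P. q \<le> r}"
abbreviation (input) "pre_below \<equiv> sum_topology (\<lambda>p. subtopology (prod_topology (Kt p) (order_complex (upset P p))) (slice p)) P"
abbreviation (input) "hc_below \<equiv> subtopology hc {e \<in> topspace hc. \<psi> e \<in> below}"
abbreviation (input) "nh_below \<equiv> subtopology nh below"

lemma openin_below: "openin nh below"
  by (rule openin_over) (auto intro: order_trans)

lemma pre_below_memD:
  assumes "(p, \<alpha>, \<beta>) \<in> topspace pre_below"
  shows "p \<in> P" "\<alpha> \<in> topspace (Kt p)" "\<beta> \<in> coords p" "min_support \<beta> \<le> r"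
    "(p, \<alpha>, \<beta>) \<in> topspace pre" "p \<le> r" "min_support \<beta> \<in> P" "p \<le> min_support \<beta>"
proof -
  show *: "p \<in> P" "\<alpha> \<in> topspace (Kt p)" "\<beta> \<in> coords p" "min_support \<beta> \<le> r"
    "(p, \<alpha>, \<beta>) \<in> topspace pre"
    using assms by (auto simp: topspace_pre)
  show **: "min_support \<beta> \<in> P" "p \<le> min_support \<beta>" using rel_min_support[OF *(1,3)] by auto
  then show "p \<le> r" using *(4) by simp
qed

text \<open>A quotient map restricts to a quotient map over an open set. The domain of the
  restriction is again a sum, with the slices as summands, so maps out of the part below
  \<open>r\<close> can be built summand by summand.\<close>

lemma quotient_map_cls_below: "quotient_map pre_below hc_below cls"
proof -
  have eq: "{x \<in> topspace pre. cls x \<in> {e \<in> topspace hc. \<psi> e \<in> below}} = Sigma P slice"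
  proof (intro equalityI subsetI)
    fix x assume x: "x \<in> {x \<in> topspace pre. cls x \<in> {e \<in> topspace hc. \<psi> e \<in> below}}"
    obtain p \<alpha> \<beta> where xp: "x = (p, \<alpha>, \<beta>)" by (cases x) auto
    have "compare_pre x \<in> below" using x \<psi>_cls by auto
    then have "min_support \<beta> \<le> r" by (simp add: over_def compare_pre_def xp)
    then show "x \<in> Sigma P slice" using x by (auto simp: xp topspace_pre)
  next
    fix x assume x: "x \<in> Sigma P slice"
    obtain p \<alpha> \<beta> where xp: "x = (p, \<alpha>, \<beta>)" by (cases x) auto
    have pre: "x \<in> topspace pre" using x by (auto simp: xp topspace_pre)
    have "compare_pre x \<in> below"
      using compare_pre_in[OF pre] x by (auto simp: over_def compare_pre_def xp)
    then show "x \<in> {x \<in> topspace pre. cls x \<in> {e \<in> topspace hc. \<psi> e \<in> below}}"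
      using pre cls_in[OF pre] \<psi>_cls by simp
  qed
  have "openin hc {e \<in> topspace hc. \<psi> e \<in> below}"
    using \<psi> openin_below by (rule openin_continuous_map_preimage)
  then have "quotient_map (subtopology pre (Sigma P slice)) hc_below cls"
    using quotient_map_restriction[OF quotient_map_cls eq] by blast
  then show ?thesis unfolding hocolim_pre_def subtopology_sum_topology .
qed

lemma hc_below_cases:
  assumes "e \<in> topspace hc_below"
  obtains p \<alpha> \<beta> where "e = cls (p, \<alpha>, \<beta>)" "(p, \<alpha>, \<beta>) \<in> topspace pre_below"
proof -
  obtain x where x: "e = cls x" "x \<in> topspace pre_below"
    using assms quotient_imp_surjective_map[OF quotient_map_cls_below] by blast
  show thesis by (rule that[of "fst x" "fst (snd x)" "snd (snd x)"]) (use x in simp_all)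
qed

lemma cls_below_in: "x \<in> topspace pre_below \<Longrightarrow> cls x \<in> topspace hc_below"
  using quotient_imp_surjective_map[OF quotient_map_cls_below] by blast

lemma \<psi>_cls_below: "(p, \<alpha>, \<beta>) \<in> topspace pre_below \<Longrightarrow> \<psi> (cls (p, \<alpha>, \<beta>)) = compare_pre (p, \<alpha>, \<beta>)"
  using \<psi>_cls pre_below_memD(5) by blast

lemma retraction_exists:
  "\<exists>\<rho>. continuous_map hc_below (Kt r) \<rho> \<and>
     (\<forall>p \<alpha> \<beta>. (p, \<alpha>, \<beta>) \<in> topspace pre_below \<longrightarrow> \<rho> (cls (p, \<alpha>, \<beta>)) = Km p r \<alpha>)"
proof -
  \<comment> \<open>\<open>cls_eqD\<close> asks for compatibility on all representatives, including
    those whose chain does not start below \<open>r\<close>. That condition depends only on \<beta>,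
    which related representatives share, so one default value serves for all of them.\<close>
  define h where "h = (\<lambda>(p, \<alpha>, \<beta> :: 'p \<Rightarrow> real). if min_support \<beta> \<le> r then Km p r \<alpha> else undefined)"
  have h: "continuous_map pre_below (Kt r) h"
  proof (rule continuous_map_from_sum_topology)
    fix p assume p: "p \<in> P"
    let ?Z = "subtopology (prod_topology (Kt p) (order_complex (upset P p))) (slice p)"
    show "continuous_map ?Z (Kt r) (\<lambda>x. h (p, x))"
    proof (cases "p \<le> r")
      case True
      have "continuous_map ?Z (Kt r) (Km p r \<circ> fst)"
        by (intro continuous_map_compose[OF _ Km_cont[OF p r True]] continuous_map_from_subtopology
              continuous_map_fst)
      then show ?thesis by (rule continuous_map_eq) (auto simp: h_def)
    next
      case False
      \<comment> \<open>The index \<open>p\<close> lies below the least element of the chain, so a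
        point of the slice would force \<open>p \<le> r\<close>.\<close>
      have "topspace ?Z = {}"
        using rel_min_support[OF p] False by (fastforce dest: order_trans)
      then show ?thesis by (simp add: continuous_map_def)
    qed
  qed
  have resp: "h x = h y" if "cls x = cls y" for x y
    using that
  proof (rule cls_eqD)
    fix p p' \<alpha> \<beta>
    assume *: "p \<in> P" "p' \<in> P" "p \<le> p'" "\<alpha> \<in> topspace (Kt p)" "\<beta> \<in> coords p'"
    show "h (p, \<alpha>, \<beta>) = h (p', Km p p' \<alpha>, \<beta>)"
    proof (cases "min_support \<beta> \<le> r")
      case True
      then have "p' \<le> r" using rel_min_support(2)[OF *(2,5)] by simp
      then show ?thesis using True * r by (simp add: h_def Km_comp)
    qed (simp add: h_def)
  qed
  show ?thesis
  proof (rule quotient_map_lift_exists[OF quotient_map_cls_below h])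
    fix \<rho> assume \<rho>: "continuous_map hc_below (Kt r) \<rho>" "\<And>x. x \<in> topspace pre_below \<Longrightarrow> \<rho> (cls x) = h x"
    show ?thesis
    proof (intro exI[of _ \<rho>] conjI allI impI \<rho>(1))
      fix p \<alpha> \<beta> assume m: "(p, \<alpha>, \<beta>) \<in> topspace pre_below"
      show "\<rho> (cls (p, \<alpha>, \<beta>)) = Km p r \<alpha>" using \<rho>(2)[OF m] pre_below_memD(4)[OF m] by (simp add: h_def)
    qed
  qed (rule resp)
qed

lemma slide_in_pre_below:
  assumes "(p, \<alpha>, \<beta>) \<in> topspace pre_below" "t \<in> {0..1}"
  shows "(p, \<alpha>, slide P r t \<beta>) \<in> topspace pre_below"
proof -
  note * = pre_below_memD[OF assms(1)]
  have "min_support (slide P r t \<beta>) \<le> r"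
  proof (cases "t < 1")
    case True
    then show ?thesis using min_support_slide[OF fin *(1) r *(3,4) assms(2)] *(4) by simp
  next
    case False
    then have "t = 1" using assms(2) by simp
    then show ?thesis by (simp add: slide_1[OF fin r] min_support_vertex)
  qed
  then show ?thesis using * slide_in[OF fin *(1) r *(3,4) assms(2)] by auto
qed

lemma continuous_map_slide:
  assumes p: "p \<in> P"
  defines "Z \<equiv> prod_topology (top_of_set {0..1}) (subtopology (prod_topology (Kt p) (order_complex (upset P p))) (slice p))"
  shows "continuous_map Z (order_complex (upset P p)) (\<lambda>w. slide P r (fst w) (snd (snd w)))"
proof -
  have T: "continuous_map Z euclideanreal fst"
    unfolding Z_def by (rule continuous_map_into_fulltopology[OF continuous_map_fst])
  have "continuous_map Z (order_complex (upset P p)) (snd \<circ> snd)"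
    unfolding Z_def
    by (rule continuous_map_compose[OF continuous_map_snd continuous_map_from_subtopology[OF continuous_map_snd]])
  then have B: "continuous_map Z euclideanreal (\<lambda>w. snd (snd w) s)" for s
    unfolding order_complex_def continuous_map_in_subtopology continuous_map_componentwise_UNIV by (simp add: o_def)
  have W: "continuous_map Z euclideanreal (\<lambda>w. slide_weight r (fst w) (snd (snd w)) s)" for s
    unfolding slide_weight_def
    by (cases "s \<le> r"; cases "s = r")
      (auto intro!: continuous_map_add continuous_map_real_mult continuous_map_real_min continuous_map_real_max
        continuous_map_diff B T)
  have mem: "\<beta> \<in> coords p" "min_support \<beta> \<le> r" "t \<in> {0..1}"
    if "(t, \<alpha>, \<beta>) \<in> topspace Z" for t \<alpha> \<beta>
    using that by (auto simp: Z_def)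
  have "continuous_map Z euclideanreal (\<lambda>w. slide P r (fst w) (snd (snd w)) s)" for s
    unfolding slide_def
  proof (intro continuous_map_real_divide W continuous_map_sum fin)
    fix w assume w: "w \<in> topspace Z"
    obtain t \<alpha> \<beta> where wt: "w = (t, \<alpha>, \<beta>)" by (cases w) auto
    show "(\<Sum>s'\<in>P. slide_weight r (fst w) (snd (snd w)) s') \<noteq> 0"
      using sum_slide_weight_pos[OF fin p r mem[OF w[unfolded wt]]] by (simp add: wt)
  qed
  moreover have "slide P r (fst w) (snd (snd w)) \<in> coords p" if w: "w \<in> topspace Z" for w
  proof -
    obtain t \<alpha> \<beta> where wt: "w = (t, \<alpha>, \<beta>)" by (cases w) auto
    show ?thesis using slide_in[OF fin p r mem[OF w[unfolded wt]]] by (simp add: wt)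
  qed
  ultimately show ?thesis
    unfolding order_complex_def continuous_map_in_subtopology continuous_map_componentwise_UNIV by auto
qed

text \<open>The homotopy is built on representatives. It descends because the interval is locally
  compact Hausdorff, so that its product with the quotient map is again a quotient map.\<close>

lemma deformation_exists:
  "\<exists>\<eta>. continuous_map (prod_topology (top_of_set {0..1::real}) hc_below) hc_below \<eta> \<and>
     (\<forall>t\<in>{0..1}. \<forall>p \<alpha> \<beta>. (p, \<alpha>, \<beta>) \<in> topspace pre_below \<longrightarrow>
        \<eta> (t, cls (p, \<alpha>, \<beta>)) = cls (p, \<alpha>, slide P r t \<beta>))"
proof -
  let ?I = "top_of_set {0..1::real}"
  define h where "h = (\<lambda>(t :: real, p, \<alpha>, \<beta>). if min_support \<beta> \<le> r \<and> t \<in> {0..1} then cls (p, \<alpha>, slide P r t \<beta>) else undefined)"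
  have h_eq: "h (t, p, \<alpha>, \<beta>) = cls (p, \<alpha>, slide P r t \<beta>)" if "(p, \<alpha>, \<beta>) \<in> topspace pre_below" "t \<in> {0..1}" for t p \<alpha> \<beta>
    using pre_below_memD(4)[OF that(1)] that(2) by (simp add: h_def)
  have "locally_compact_space ?I" "Hausdorff_space ?I"
    by (auto simp: locally_compact_space_euclidean closed_imp_locally_compact compact_imp_locally_compact_space compact_space_subtopology Hausdorff_space_subtopology)
  then have q: "quotient_map (prod_topology ?I pre_below) (prod_topology ?I hc_below) (\<lambda>(t, x). (t, cls x))"
    using quotient_map_cls_below by (intro quotient_map_prod_right) auto
  have h: "continuous_map (prod_topology ?I pre_below) hc_below h"
  proof (rule continuous_map_from_prod_sum_topology)
    fix p assume p: "p \<in> P"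
    let ?Z = "prod_topology ?I (subtopology (prod_topology (Kt p) (order_complex (upset P p))) (slice p))"
    have "continuous_map ?Z (Kt p) (fst \<circ> snd)"
      by (rule continuous_map_compose[OF continuous_map_snd continuous_map_from_subtopology[OF continuous_map_fst]])
    then have 1: "continuous_map ?Z (prod_topology (Kt p) (order_complex (upset P p)))
        (\<lambda>w. (fst (snd w), slide P r (fst w) (snd (snd w))))"
      using continuous_map_slide[OF p] by (simp add: continuous_map_paired o_def)
    have 2: "continuous_map (prod_topology (Kt p) (order_complex (upset P p))) hc (\<lambda>x. cls (p, x))"
      using continuous_map_compose[OF continuous_map_component_injection[OF p] quotient_imp_continuous_map[OF quotient_map_cls, unfolded hocolim_pre_def]]
      by (simp add: o_def)
    have "continuous_map ?Z hc (\<lambda>w. cls (p, fst (snd w), slide P r (fst w) (snd (snd w))))"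
      using continuous_map_compose[OF 1 2] by (simp add: o_def)
    then have c: "continuous_map ?Z hc (\<lambda>w. h (fst w, p, snd w))"
      by (rule continuous_map_eq) (auto simp: h_def)
    moreover have "h (fst w, p, snd w) \<in> {e \<in> topspace hc. \<psi> e \<in> below}" if "w \<in> topspace ?Z" for w
    proof -
      obtain t \<alpha> \<beta> where wt: "w = (t, \<alpha>, \<beta>)" by (cases w) auto
      have m: "(p, \<alpha>, \<beta>) \<in> topspace pre_below" "t \<in> {0..1}" using that p by (auto simp: wt)
      have "cls (p, \<alpha>, slide P r t \<beta>) \<in> topspace hc_below"
        by (rule cls_below_in[OF slide_in_pre_below[OF m]])
      then show ?thesis using h_eq[OF m] by (simp add: wt)
    qed
    ultimately show "continuous_map ?Z hc_below (\<lambda>w. h (fst w, p, snd w))"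
      by (intro continuous_map_into_subtopology) blast+
  qed
  have resp: "h (t, x) = h (t, y)" if "cls x = cls y" for t x y
    using that
  proof (rule cls_eqD)
    fix p p' \<alpha> \<beta>
    assume *: "p \<in> P" "p' \<in> P" "p \<le> p'" "\<alpha> \<in> topspace (Kt p)" "\<beta> \<in> coords p'"
    show "h (t, p, \<alpha>, \<beta>) = h (t, p', Km p p' \<alpha>, \<beta>)"
    proof (cases "min_support \<beta> \<le> r \<and> t \<in> {0..1}")
      case True
      \<comment> \<open>The slide keeps \<beta> in the smaller complex over \<open>p'\<close>, so
        the slid representatives are again related.\<close>
      then have "slide P r t \<beta> \<in> coords p'"
        using slide_in[OF fin *(2) r *(5)] by blast
      then have "cls (p, \<alpha>, slide P r t \<beta>) = cls (p', Km p p' \<alpha>, slide P r t \<beta>)"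
        using * by (intro cls_eqI) (auto simp: hocolim_rel_def)
      then show ?thesis using True by (simp add: h_def)
    next
      case False
      then show ?thesis by (simp only: h_def prod.case if_False)
    qed
  qed
  show ?thesis
  proof (rule quotient_map_lift_exists[OF q h])
    fix \<eta> assume \<eta>: "continuous_map (prod_topology ?I hc_below) hc_below \<eta>"
      "\<And>x. x \<in> topspace (prod_topology ?I pre_below) \<Longrightarrow> \<eta> ((\<lambda>(t, x). (t, cls x)) x) = h x"
    show ?thesis
    proof (intro exI[of _ \<eta>] conjI ballI allI impI \<eta>(1))
      fix t p \<alpha> \<beta> assume m: "t \<in> {0..1::real}" "(p, \<alpha>, \<beta>) \<in> topspace pre_below"
      then have "(t, p, \<alpha>, \<beta>) \<in> topspace (prod_topology ?I pre_below)" by simp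
      from \<eta>(2)[OF this] show "\<eta> (t, cls (p, \<alpha>, \<beta>)) = cls (p, \<alpha>, slide P r t \<beta>)"
        using h_eq[OF m(2,1)] by simp
    qed
  next
    fix w w' :: "real \<times> 'p \<times> 'a \<times> ('p \<Rightarrow> real)"
    assume "(\<lambda>(t, x). (t, cls x)) w = (\<lambda>(t, x). (t, cls x)) w'"
    then have eq: "fst w = fst w'" "cls (snd w) = cls (snd w')"
      by (simp_all only: case_prod_unfold prod.inject)
    show "h w = h w'"
      using resp[OF eq(2), of "fst w"] unfolding eq(1) prod.collapse by (metis eq(1) prod.collapse)
  qed
qed

lemma nh_below_eq: "nh_below = poset_top below (nh_hocolim_le P Xle g)"
  using openin_below unfolding nh_hocolim_def by (rule subtopology_poset_top)

lemma below_iff: "(s, x) \<in> below \<longleftrightarrow> s \<in> P \<and> x \<in> Xs s \<and> s \<le> r"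
  by (auto simp: over_def)

lemma continuous_map_below_inclusion: "continuous_map (poset_top (Xs r) (Xle r)) nh_below (\<lambda>x. (r, x))"
  unfolding nh_below_eq
  by (rule continuous_map_poset_top) (use r in \<open>auto simp: below_iff nh_hocolim_le_def g_refl\<close>)

lemma continuous_map_below_retraction:
  "continuous_map nh_below (poset_top (Xs r) (Xle r)) (\<lambda>y. g (fst y) r (snd y))"
  unfolding nh_below_eq
proof (rule continuous_map_poset_top)
  show "g (fst y) r (snd y) \<in> Xs r" if "y \<in> below" for y
    using that g_in r by (cases y) (simp add: below_iff)
  fix x y assume xy: "x \<in> below" "y \<in> below" "nh_hocolim_le P Xle g y x"
  obtain s a s' b where ab: "x = (s, a)" "y = (s', b)" by (cases x, cases y) auto
  have *: "s \<in> P" "a \<in> Xs s" "s \<le> r" "s' \<in> P" "b \<in> Xs s'" "s' \<le> r" "s' \<le> s" "Xle s (g s' s b) a"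
    using xy by (auto simp: ab below_iff nh_hocolim_le_def)
  have "Xle r (g s r (g s' s b)) (g s r a)" using * r by (intro g_mono g_in) auto
  then show "Xle r (g (fst y) r (snd y)) (g (fst x) r (snd x))" using * r by (simp add: ab g_comp)
qed

text \<open>Every \<open>y\<close> lies below its image under the retraction and open sets are
  down-closed. So the preimage of an open \<open>U\<close> is the union of
  \<open>{0..<1} \<times> U\<close> and the cylinder over the preimage of \<open>U\<close> under the
  retraction: an upward jump at the end of time is continuous.\<close>

lemma continuous_map_below_jump:
  "continuous_map (prod_topology (top_of_set {0..1::real}) nh_below) nh_below
     (\<lambda>(t, y). if t < 1 then y else (r, g (fst y) r (snd y)))"
proof -
  let ?I = "top_of_set {0..1::real}"
  define j where "j y = (r, g (fst y) r (snd y))" for y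
  have j_in: "j y \<in> below" "nh_hocolim_le P Xle g y (j y)" if "y \<in> below" for y
    using that r by (cases y, simp add: j_def below_iff nh_hocolim_le_def g_in Xle_refl)+
  define N where "N = nh_below"
  have top: "topspace N = below" by (simp add: N_def nh_below_eq del: topspace_subtopology)
  have jc: "continuous_map N N j"
    using continuous_map_compose[OF continuous_map_below_retraction continuous_map_below_inclusion]
    by (simp add: o_def j_def[abs_def] N_def)
  have "continuous_map (prod_topology ?I N) N (\<lambda>(t, y). if t < 1 then y else j y)"
    unfolding continuous_map_def
  proof (intro conjI allI impI)
    show "(\<lambda>(t, y). if t < 1 then y else j y) \<in> topspace (prod_topology ?I N) \<rightarrow> topspace N"
      using j_in(1) by (auto simp: top)
    fix U assume U: "openin N U"
    have Ud: "y \<in> U" if "x \<in> U" "y \<in> below" "nh_hocolim_le P Xle g y x" for x y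
      using U that unfolding N_def nh_below_eq openin_poset_top by blast
    have "{w \<in> topspace (prod_topology ?I N). (\<lambda>(t, y). if t < 1 then y else j y) w \<in> U}
      = ({0..1} \<inter> {..<1}) \<times> U \<union> {0..1} \<times> {y \<in> topspace N. j y \<in> U}" (is "?L = ?R")
    proof (intro equalityI subsetI)
      fix w assume "w \<in> ?L"
      then show "w \<in> ?R" by (cases w) (auto simp: top split: if_splits)
    next
      fix w assume w: "w \<in> ?R"
      obtain t y where ty: "w = (t, y)" by (meson surj_pair)
      have "U \<subseteq> below" using openin_subset[OF U] top by simp
      moreover have "y \<in> U" if "j y \<in> U" "y \<in> below" using Ud[OF that j_in(2)[OF that(2)]] .
      ultimately show "w \<in> ?L" using w by (auto simp: ty top)
    qed
    moreover have "openin (prod_topology ?I N) (({0..1} \<inter> {..<1}) \<times> U)"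
      using U by (auto simp: openin_prod_Times_iff openin_open)
    moreover have "openin (prod_topology ?I N) ({0..1} \<times> {y \<in> topspace N. j y \<in> U})"
      using openin_continuous_map_preimage[OF jc U] by (auto simp: openin_prod_Times_iff)
    ultimately show "openin (prod_topology ?I N)
        {w \<in> topspace (prod_topology ?I N). (\<lambda>(t, y). if t < 1 then y else j y) w \<in> U}"
      by (simp only: openin_Un)
  qed
  then show ?thesis unfolding N_def j_def .
qed

lemma vertex_in_pre_below: "\<alpha> \<in> topspace (Kt r) \<Longrightarrow> (r, \<alpha>, vertex r) \<in> topspace pre_below"
  using r vertex_in_order_complex[of r "upset P r"] finite_upsets
  by (auto simp: min_support_vertex upset_def)

text \<open>The two homotopies match strictly. For \<open>t < 1\<close> the slide preserves the
  least element of the chain and \<open>\<gamma>\<close> is the identity; at \<open>t = 1\<close>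
  both sides move to \<open>r\<close>, with equal values by naturality of \<phi>.\<close>

lemma lifting_over_below: "lifting_over hc nh \<psi> below"
proof -
  obtain \<rho> where \<rho>: "continuous_map hc_below (Kt r) \<rho>"
    and \<rho>_cls: "\<forall>p \<alpha> \<beta>. (p, \<alpha>, \<beta>) \<in> topspace pre_below \<longrightarrow> \<rho> (cls (p, \<alpha>, \<beta>)) = Km p r \<alpha>"
    using retraction_exists by (elim exE conjE) (rule that)
  obtain \<eta> where \<eta>: "continuous_map (prod_topology (top_of_set {0..1::real}) hc_below) hc_below \<eta>"
    and \<eta>_cls: "\<forall>t\<in>{0..1}. \<forall>p \<alpha> \<beta>. (p, \<alpha>, \<beta>) \<in> topspace pre_below \<longrightarrow>
        \<eta> (t, cls (p, \<alpha>, \<beta>)) = cls (p, \<alpha>, slide P r t \<beta>)"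
    using deformation_exists by (elim exE conjE) (rule that)
  define i where "i \<alpha> = cls (r, \<alpha>, vertex r)" for \<alpha>
  define \<gamma> where "\<gamma> = (\<lambda>(t :: real, y). if t < 1 then y else (r, g (fst y) r (snd y)))"
  have i: "continuous_map (Kt r) hc_below i"
  proof -
    have v: "vertex r \<in> coords r"
      using r finite_upsets by (intro vertex_in_order_complex) (auto simp: upset_def)
    have "continuous_map (Kt r) (prod_topology (Kt r) (order_complex (upset P r))) (\<lambda>\<alpha>. (\<alpha>, vertex r))"
      using v by (simp add: continuous_map_paired)
    from continuous_map_compose[OF this
        continuous_map_component_injection[OF r, of "\<lambda>p. prod_topology (Kt p) (order_complex (upset P p))"]]
    have "continuous_map (Kt r) pre (\<lambda>\<alpha>. (r, \<alpha>, vertex r))"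
      by (simp add: o_def hocolim_pre_def)
    from continuous_map_compose[OF this quotient_imp_continuous_map[OF quotient_map_cls]]
    have "continuous_map (Kt r) hc i" by (simp add: o_def i_def[abs_def])
    moreover have "i \<alpha> \<in> {e \<in> topspace hc. \<psi> e \<in> below}" if "\<alpha> \<in> topspace (Kt r)" for \<alpha>
      using cls_below_in[OF vertex_in_pre_below[OF that]] by (simp add: i_def)
    ultimately show ?thesis by (intro continuous_map_into_subtopology) auto
  qed
  have "deformation_lifting hc_below nh_below \<psi>"
  proof (rule deformation_lifting_retract[where i = i and j = "\<lambda>x. (r, x)" and \<rho> = \<rho>
        and \<sigma> = "\<lambda>y. g (fst y) r (snd y)" and \<eta> = \<eta> and \<gamma> = \<gamma>])
    show "deformation_lifting (Kt r) (poset_top (Xs r) (Xle r)) (\<phi> r)"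
      using whe r by (intro weak_homotopy_equivalence_imp_deformation_lifting) auto
    show "continuous_map (poset_top (Xs r) (Xle r)) nh_below (\<lambda>x. (r, x))"
      by (rule continuous_map_below_inclusion)
    show "continuous_map nh_below (poset_top (Xs r) (Xle r)) (\<lambda>y. g (fst y) r (snd y))"
      by (rule continuous_map_below_retraction)
    show "continuous_map (prod_topology (top_of_set {0..1}) nh_below) nh_below \<gamma>"
      unfolding \<gamma>_def by (rule continuous_map_below_jump)
    show "\<gamma> (0, y) = y" "\<gamma> (1, y) = (r, g (fst y) r (snd y))" for y by (simp_all add: \<gamma>_def)
    show "\<psi> (i \<alpha>) = (r, \<phi> r \<alpha>)" if "\<alpha> \<in> topspace (Kt r)" for \<alpha>
      using \<psi>_cls_below[OF vertex_in_pre_below[OF that]] that r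
      by (simp add: i_def compare_pre_def min_support_vertex Km_refl)
    fix e assume "e \<in> topspace hc_below"
    then obtain p \<alpha> \<beta> where e: "e = cls (p, \<alpha>, \<beta>)" and m: "(p, \<alpha>, \<beta>) \<in> topspace pre_below"
      by (rule hc_below_cases)
    note * = pre_below_memD[OF m]
    have \<psi>e: "\<psi> e = (min_support \<beta>, \<phi> (min_support \<beta>) (Km p (min_support \<beta>) \<alpha>))"
      using \<psi>_cls_below[OF m] by (simp add: e compare_pre_def)
    have g\<phi>: "g (fst (\<psi> e)) r (snd (\<psi> e)) = \<phi> r (Km p r \<alpha>)"
      using \<phi>_nat[of "min_support \<beta>" r "Km p (min_support \<beta>) \<alpha>"] * r
      by (simp add: \<psi>e Km_in Km_comp)
    have \<rho>e: "\<rho> e = Km p r \<alpha>" using \<rho>_cls m e by blast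
    have \<eta>e: "\<eta> (t, e) = cls (p, \<alpha>, slide P r t \<beta>)" if "t \<in> {0..1}" for t using \<eta>_cls m e that by blast
    show "\<phi> r (\<rho> e) = g (fst (\<psi> e)) r (snd (\<psi> e))" by (simp add: \<rho>e g\<phi>)
    show "\<eta> (0, e) = e" using \<eta>e[of 0] slide_0[OF fin *(3)] by (simp add: e)
    \<comment> \<open>The vertex \<open>r\<close> belongs to the complex over \<open>r\<close>, so
      the relation allows \<alpha> to be transported to \<open>Kt r\<close>.\<close>
    have "cls (p, \<alpha>, vertex r) = cls (r, Km p r \<alpha>, vertex r)"
      using * r vertex_in_order_complex[of r "upset P r"] finite_upsets
      by (intro cls_eqI) (auto simp: hocolim_rel_def upset_def)
    then show "\<eta> (1, e) = i (\<rho> e)" using \<eta>e[of 1] slide_1[OF fin r] by (simp add: \<rho>e i_def)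
    fix t :: real assume t: "t \<in> {0..1}"
    have \<psi>\<eta>: "\<psi> (\<eta> (t, e)) = compare_pre (p, \<alpha>, slide P r t \<beta>)"
      using \<psi>_cls_below[OF slide_in_pre_below[OF m t]] \<eta>e[OF t] by simp
    show "\<psi> (\<eta> (t, e)) = \<gamma> (t, \<psi> e)"
    proof (cases "t < 1")
      case True
      then show ?thesis using min_support_slide[OF fin *(1) r *(3,4) t True]
        by (simp add: \<psi>\<eta> compare_pre_def \<gamma>_def \<psi>e)
    next
      case False
      then have "t = 1" using t by simp
      then show ?thesis using g\<phi> \<psi>\<eta> by (simp add: slide_1[OF fin r] compare_pre_def min_support_vertex \<gamma>_def)
    qed
  qed (fact i \<rho> \<eta>)+
  then show ?thesis
    unfolding lifting_over_def by (rule deformation_lifting_imp_relative_lifting)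
qed

end

section \<open>Induction over down-sets\<close>

lemma lifting_over_downset:
  assumes \<psi>: "continuous_map hc nh \<psi>"
    and \<psi>_cls: "\<forall>x\<in>topspace pre. \<psi> (cls x) = compare_pre x"
  shows "D \<subseteq> P \<Longrightarrow> (\<forall>q\<in>P. \<forall>r\<in>D. q \<le> r \<longrightarrow> q \<in> D) \<Longrightarrow> lifting_over hc nh \<psi> (over D)"
proof (induction "card D" arbitrary: D rule: less_induct)
  case less
  have finD: "finite D" using less.prems(1) fin finite_subset by blast
  show ?case
  proof (cases "D = {}")
    case True
    then have "over D = {}" by (simp add: over_def)
    \<comment> \<open>Over the empty set there is no lifting problem at all, since the bottom of the
      cup is nonempty in every dimension.\<close>
    then have "\<not> continuous_map (top_of_set (cube_cup n)) (subtopology nh (over D)) h" for n h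
      using zero_in_cube[of n] by (auto simp: continuous_map_def cube_cup_def)
    then show ?thesis unfolding lifting_over_def relative_lifting_def by blast
  next
    case False
    \<comment> \<open>Maximality of \<open>r\<close> makes \<open>D - {r}\<close> a down-set, so
      that it and its intersection with the down-set of \<open>r\<close> fall under the induction
      hypothesis.\<close>
    then obtain r where r: "r \<in> D" "\<forall>b\<in>D. r \<le> b \<longrightarrow> r = b" using finite_has_maximal[OF finD] by blast
    have rP: "r \<in> P" using r less.prems(1) by blast
    let ?B = "{q \<in> P. q \<le> r}"
    have B: "lifting_over hc nh \<psi> (over ?B)" using lifting_over_below[OF \<psi> \<psi>_cls rP] .
    have BD: "?B \<subseteq> D" using less.prems r by blast
    show ?thesis
    proof (cases "D = ?B")
      case True
      then show ?thesis using B by simp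
    next
      case neq: False
      have "card (D - {r}) < card D" using finD r(1) by (rule card_Diff1_less)
      moreover have down: "\<forall>q\<in>P. \<forall>r'\<in>D - {r}. q \<le> r' \<longrightarrow> q \<in> D - {r}"
        using less.prems r by (metis DiffE DiffI singletonD singletonI)
      ultimately have 1: "lifting_over hc nh \<psi> (over (D - {r}))"
        using less.prems by (intro less.hyps) auto
      have "(D - {r}) \<inter> ?B \<subset> D" using r by blast
      then have "card ((D - {r}) \<inter> ?B) < card D" using finD by (rule psubset_card_mono[rotated])
      moreover have "\<forall>q\<in>P. \<forall>r'\<in>(D - {r}) \<inter> ?B. q \<le> r' \<longrightarrow> q \<in> (D - {r}) \<inter> ?B"
        using down by (auto intro: order_trans)
      ultimately have 2: "lifting_over hc nh \<psi> (over ((D - {r}) \<inter> ?B))"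
        using less.prems by (intro less.hyps) auto
      have "over (D - {r}) \<inter> over ?B = over ((D - {r}) \<inter> ?B)" by (auto simp: over_def)
      moreover have "openin nh (over (D - {r}))" "openin nh (over ?B)"
        using down by (auto intro!: openin_over intro: order_trans)
      ultimately have "lifting_over hc nh \<psi> (over (D - {r}) \<union> over ?B)"
        using 1 2 B by (intro lifting_over_Un) auto
      moreover have "over (D - {r}) \<union> over ?B = over D" using BD r rP by (auto simp: over_def)
      ultimately show ?thesis by simp
    qed
  qed
qed

lemma hocolim_weak_homotopy_equivalence: "\<exists>\<psi>. weak_homotopy_equivalence hc nh \<psi>"
proof -
  obtain \<psi> where \<psi>: "continuous_map hc nh \<psi>"
    "\<forall>x\<in>topspace pre. \<psi> (cls x) = compare_pre x"
    using compare_exists by (elim exE conjE) (rule that)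
  have "lifting_over hc nh \<psi> (over P)" by (rule lifting_over_downset[OF \<psi>]) auto
  moreover have "over P = topspace nh" by (auto simp: over_def topspace_nh)
  moreover have "{x \<in> topspace hc. \<psi> x \<in> topspace nh} = topspace hc"
    using continuous_map_image_subset_topspace[OF \<psi>(1)] by blast
  ultimately have "relative_lifting hc nh \<psi>" by (simp add: lifting_over_def)
  then show ?thesis using relative_lifting_imp_weak_homotopy_equivalence[OF \<psi>(1)] by blast
qed

end

theorem theorem3p1:
  fixes P :: "'p::order set"
    and Kt :: "'p \<Rightarrow> 'a topology" and Km :: "'p \<Rightarrow> 'p \<Rightarrow> 'a \<Rightarrow> 'a"
    and Xs :: "'p \<Rightarrow> 'b set" and Xle :: "'p \<Rightarrow> 'b \<Rightarrow> 'b \<Rightarrow> bool" and g :: "'p \<Rightarrow> 'p \<Rightarrow> 'b \<Rightarrow> 'b"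
    and \<phi> :: "'p \<Rightarrow> 'a \<Rightarrow> 'b"
  assumes "finite P"
    and "space_diagram P Kt Km"
    and "poset_diagram P Xs Xle g"
    and "\<forall>p\<in>P. continuous_map (Kt p) (poset_top (Xs p) (Xle p)) (\<phi> p)"
    and "\<forall>p\<in>P. \<forall>q\<in>P. p \<le> q \<longrightarrow> (\<forall>\<alpha>\<in>topspace (Kt p). \<phi> q (Km p q \<alpha>) = g p q (\<phi> p \<alpha>))"
    and "\<forall>p\<in>P. weak_homotopy_equivalence (Kt p) (poset_top (Xs p) (Xle p)) (\<phi> p)"
  shows "\<exists>\<psi>. weak_homotopy_equivalence (hocolim P Kt Km) (nh_hocolim P Xs Xle g) \<psi>"
  using assms by (rule hocolim_weak_homotopy_equivalence)

end
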